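(* Let $\mu$ be a doubling Borel measure on $\mathbb{R}^n$, $w\in A_\infty$ with doubling order $D_w$, and $1\le p_0<q_0\le\infty$. Let $\mathcal{D}_1\subset\mathcal{D}_2$ be subspaces of $L^{q_0}(w)$ that are stable under truncation by indicator functions of measurable sets. Let $T$ be a sublinear operator defined on $\mathcal{D}_2$ and let $\{\mathcal{A}_r\}_{r>0}$ be a family of operators acting from $\mathcal{D}_1$ into $\mathcal{D}_2$. Assume: (a) There exists $q\in\mathcal{W}_w(p_0,q_0)$ such that $T$ is bounded from $L^q(w)$ to $L^{q,\infty}(w)$. (b) For all $j\ge1$ there exist constants $\alpha_j$ such that for any ball $B$ with radius $r(B)$ and any $f\in\mathcal{D}_1$ supported in $B$, $$\Big(\frac1{\mu(2^{j+1}B)}\int_{C_j(B)}|\mathcal{A}_{r(B)}f|^{q_0}\,d\mu\Big)^{1/q_0}\le\alpha_j\Big(\frac1{\mu(B)}\int_B|f|^{p_0}\,d\mu\Big)^{1/p_0}.$$ (c) There exists $\beta>(s_w)'$, i.e. $w\in RH_{\beta'}$, with the following property: for all $j\ge2$ there exist constants $\alpha_j$ such that for any ball $B$ with radius $r(B)$ and any $f\in\mathcal{D}_1$ supported in $B$, $$\Big(\frac1{\mu(2^{j+1}B)}\int_{C_j(B)}|T(I-\mathcal{A}_{r(B)})f|^{\beta}\,d\mu\Big)^{1/\beta}\le\alpha_j\Big(\frac1{\mu(B)}\int_B|f|^{p_0}\,d\mu\Big)^{1/p_0}.$$ (d) $\sum_j\alpha_j2^{D_wj}<\infty$ for the $\alpha_j$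 in (b) and (c). Then $T$ is of strong-type $(p,p)$ with respect to $w$ for all $p\in\mathcal{W}_w(p_0,q_0)$ with $p<q$. More precisely, for such $p$ there exists a constant $C$ such that for all $f\in\mathcal{D}_1$, $$\|Tf\|_{L^p(w)}\le C\,\|f\|_{L^p(w)}.$$
   Context: $\mu$ doubling: $\mu(2B)\le C\mu(B)<\infty$ for all balls $B$; $\lambda B$ is the concentric ball of radius $\lambda r(B)$. $C_1(B)=4B$, $C_j(B)=2^{j+1}B\setminus2^jB$ for $j\ge2$. $T$ is sublinear if $|T(f+g)|\le|Tf|+|Tg|$ and $|T(\lambda f)|=|\lambda||Tf|$. For $q_0=\infty$ the $L^{q_0}$-average is an essential supremum. Weights are taken with respect to $\mu$: $w\ge0$ locally $\mu$-integrable; $dw=w\,d\mu$; $L^p(w)=L^p(w\,d\mu)$ and $L^{p,\infty}(w)$ is the corresponding weak space. With $\frac1{\mu(B)}\int_B\cdot\,d\mu$ denoting averages, for $1<t<\infty$: $w\in A_t$ if $\big(\frac1{\mu(B)}\int_Bw\,d\mu\big)\big(\frac1{\mu(B)}\int_Bw^{1-t'}d\mu\big)^{t-1}\le C$ for all balls $B$; $w\in A_1$ if $\frac1{\mu(B)}\int_Bw\,d\mu\le Cw(x)$ for $\mu$-a.e. $x\in B$; $A_\infty=\bigcup_{t\ge1}A_t$; $w\in RH_t$ if $\big(\frac1{\mu(B)}\int_Bw^td\mu\big)^{1/t}\le C\frac1{\mu(B)}\int_Bw\,d\mu$ for all $B$; $w\in RH_\infty$ if $w(x)\le C\frac1{\mu(B)}\int_Bw\,d\mu$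 for $\mu$-a.e. $x\in B$; $RH_1$ is the class of all weights. $w$ has doubling order $D_w$ if $w(\lambda B)\le C\lambda^{D_w}w(B)$ for all balls $B$ and all $\lambda\ge1$, where $w(E)=\int_Ew\,d\mu$. $s_w=\sup\{s>1:w\in RH_s\}$; primes are conjugate exponents. $\mathcal{W}_w(p_0,q_0)=\{p:\ p_0<p<q_0,\ w\in A_{p/p_0}\cap RH_{(q_0/p)'}\}$ (for $q_0=\infty$ the only condition is $w\in A_{p/p_0}$). *)

theory Defs
  imports "HOL-Analysis.Analysis" "HOL-Probability.Essential_Supremum"
begin

text \<open>Real powers on \<open>[0,\<infinity>]\<close>, with \<open>0\<close> and \<open>\<infinity>\<close> exchanged by negative exponents.
  (For the library's \<open>powr\<close> one has \<open>0 powr a = 0\<close> also when \<open>a < 0\<close>, which would make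
  the \<open>A\<^sub>t\<close> condition below blind to the zeros of the weight.)\<close>

definition enn_powr :: "ennreal \<Rightarrow> real \<Rightarrow> ennreal" where
  "enn_powr x a =
    (if a = 0 then 1
     else if x = \<infinity> then (if a > 0 then \<infinity> else 0)
     else if x = 0 then (if a > 0 then 0 else \<infinity>)
     else ennreal (enn2real x powr a))"

text \<open>The exponent \<open>p'\<close> with \<open>1/p + 1/p' = 1\<close>; in \<^typ>\<open>ennreal\<close> this covers
  \<open>1' = \<infinity>\<close> and \<open>\<infinity>' = 1\<close>.\<close>

definition conj_exponent :: "ennreal \<Rightarrow> ennreal" where
  "conj_exponent p = inverse (1 - inverse p)"

definition doubling_measure :: "'a::metric_space measure \<Rightarrow> bool" where
  "doubling_measure M \<longleftrightarrow> sets M = sets borel \<and>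
    (\<exists>C::real. \<forall>x r. 0 < r \<longrightarrow>
       emeasure M (ball x (2 * r)) \<le> ennreal C * emeasure M (ball x r) \<and>
       emeasure M (ball x r) < \<infinity>)"

definition average :: "'a measure \<Rightarrow> 'a set \<Rightarrow> ('a \<Rightarrow> ennreal) \<Rightarrow> ennreal" where
  "average M B f = (\<integral>\<^sup>+x\<in>B. f x \<partial>M) / emeasure M B"

definition weight :: "'a::metric_space measure \<Rightarrow> ('a \<Rightarrow> real) \<Rightarrow> bool" where
  "weight M w \<longleftrightarrow> w \<in> borel_measurable M \<and> (\<forall>x. 0 \<le> w x) \<and>
    (\<forall>x r. 0 < r \<longrightarrow> set_integrable M (ball x r) w)"

definition wmeasure :: "'a measure \<Rightarrow> ('a \<Rightarrow> real) \<Rightarrow> 'a measure" where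
  "wmeasure M w = density M (\<lambda>x. ennreal (w x))"

definition A_class :: "'a::metric_space measure \<Rightarrow> real \<Rightarrow> ('a \<Rightarrow> real) set" where
  "A_class M t = {w. weight M w \<and> 1 \<le> t \<and>
    (if t = 1 then
       \<exists>C::real. \<forall>x r. 0 < r \<longrightarrow>
         (AE y in M. y \<in> ball x r \<longrightarrow>
            average M (ball x r) (\<lambda>z. ennreal (w z)) \<le> ennreal C * ennreal (w y))
     else
       \<exists>C::real. \<forall>x r. 0 < r \<longrightarrow>
         average M (ball x r) (\<lambda>z. ennreal (w z)) *
         enn_powr (average M (ball x r) (\<lambda>z. enn_powr (ennreal (w z)) (1 - t / (t - 1)))) (t - 1)
           \<le> ennreal C)}"

definition A_infinity :: "'a::metric_space measure \<Rightarrow> ('a \<Rightarrow> real) set" where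
  "A_infinity M = (\<Union>t\<in>{1..}. A_class M t)"

text \<open>For \<open>t = 1\<close> the condition holds with \<open>C = 1\<close>, so \<open>RH\<^sub>1\<close> consists of all weights.\<close>

definition RH_class :: "'a::metric_space measure \<Rightarrow> ennreal \<Rightarrow> ('a \<Rightarrow> real) set" where
  "RH_class M t = {w. weight M w \<and> 1 \<le> t \<and>
    (if t = \<infinity> then
       \<exists>C::real. \<forall>x r. 0 < r \<longrightarrow>
         (AE y in M. y \<in> ball x r \<longrightarrow>
            ennreal (w y) \<le> ennreal C * average M (ball x r) (\<lambda>z. ennreal (w z)))
     else
       \<exists>C::real. \<forall>x r. 0 < r \<longrightarrow>
         enn_powr (average M (ball x r) (\<lambda>z. enn_powr (ennreal (w z)) (enn2real t)))
             (1 / enn2real t)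
           \<le> ennreal C * average M (ball x r) (\<lambda>z. ennreal (w z)))}"

definition doubling_order :: "'a::metric_space measure \<Rightarrow> ('a \<Rightarrow> real) \<Rightarrow> real \<Rightarrow> bool" where
  "doubling_order M w D \<longleftrightarrow>
    (\<exists>C::real. \<forall>x r l. 0 < r \<longrightarrow> 1 \<le> l \<longrightarrow>
       emeasure (wmeasure M w) (ball x (l * r))
         \<le> ennreal (C * l powr D) * emeasure (wmeasure M w) (ball x r))"

definition RH_sup :: "'a::metric_space measure \<Rightarrow> ('a \<Rightarrow> real) \<Rightarrow> ennreal" where
  "RH_sup M w = Sup {s. 1 < s \<and> w \<in> RH_class M s}"

definition W_exponents ::
    "'a::metric_space measure \<Rightarrow> ('a \<Rightarrow> real) \<Rightarrow> real \<Rightarrow> ennreal \<Rightarrow> real set" where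
  "W_exponents M w p0 q0 =
    {p. p0 < p \<and> ennreal p < q0 \<and> w \<in> A_class M (p / p0) \<and>
        w \<in> RH_class M (conj_exponent (q0 / ennreal p))}"

definition Lp_norm :: "ennreal \<Rightarrow> 'a measure \<Rightarrow> ('a \<Rightarrow> complex) \<Rightarrow> ennreal" where
  "Lp_norm p M f =
    (if p = \<infinity> then esssup M (\<lambda>x. ennreal (norm (f x)))
     else enn_powr (\<integral>\<^sup>+x. enn_powr (ennreal (norm (f x))) (enn2real p) \<partial>M) (1 / enn2real p))"

text \<open>The elements are functions, not classes modulo equality almost everywhere.\<close>

definition Lp_space :: "ennreal \<Rightarrow> 'a measure \<Rightarrow> ('a \<Rightarrow> complex) set" where
  "Lp_space p M = {f \<in> borel_measurable M. Lp_norm p M f < \<infinity>}"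

definition weak_Lp_norm :: "real \<Rightarrow> 'a measure \<Rightarrow> ('a \<Rightarrow> complex) \<Rightarrow> ennreal" where
  "weak_Lp_norm p M f =
    (SUP l\<in>{0::real<..}. ennreal l * enn_powr (emeasure M {x \<in> space M. l < norm (f x)}) (1 / p))"

text \<open>\<open>(1/\<mu>(B) \<integral>\<^bsub>E\<^esub> |f|\<^sup>s d\<mu>)\<^sup>1\<^sup>/\<^sup>s\<close>, where the normalising set \<open>B\<close> may differ from the
  domain of integration \<open>E\<close>; for \<open>s = \<infinity>\<close> the essential supremum over \<open>E\<close>.\<close>

definition Lp_average ::
    "ennreal \<Rightarrow> 'a measure \<Rightarrow> 'a set \<Rightarrow> 'a set \<Rightarrow> ('a \<Rightarrow> complex) \<Rightarrow> ennreal" where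
  "Lp_average s M B E f =
    (if s = \<infinity> then esssup M (\<lambda>x. ennreal (norm (f x)) * indicator E x)
     else enn_powr ((\<integral>\<^sup>+x\<in>E. enn_powr (ennreal (norm (f x))) (enn2real s) \<partial>M) / emeasure M B)
            (1 / enn2real s))"

definition annulus :: "nat \<Rightarrow> 'a::metric_space \<Rightarrow> real \<Rightarrow> 'a set" where
  "annulus j x r =
    (if j = 1 then ball x (4 * r) else ball x (2 ^ (j + 1) * r) - ball x (2 ^ j * r))"

definition function_subspace :: "('a \<Rightarrow> complex) set \<Rightarrow> bool" where
  "function_subspace D \<longleftrightarrow> (\<lambda>x. 0) \<in> D \<and>
    (\<forall>f\<in>D. \<forall>g\<in>D. (\<lambda>x. f x + g x) \<in> D) \<and> (\<forall>c. \<forall>f\<in>D. (\<lambda>x. c * f x) \<in> D)"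

definition truncation_stable :: "'a measure \<Rightarrow> ('a \<Rightarrow> complex) set \<Rightarrow> bool" where
  "truncation_stable M D \<longleftrightarrow> (\<forall>f\<in>D. \<forall>E\<in>sets M. (\<lambda>x. indicator E x * f x) \<in> D)"

definition sublinear_operator ::
    "'a measure \<Rightarrow> ('a \<Rightarrow> complex) set \<Rightarrow> (('a \<Rightarrow> complex) \<Rightarrow> ('a \<Rightarrow> complex)) \<Rightarrow> bool" where
  "sublinear_operator M D T \<longleftrightarrow>
    (\<forall>f\<in>D. T f \<in> borel_measurable M) \<and>
    (\<forall>f\<in>D. \<forall>g\<in>D. AE x in M. norm (T (\<lambda>y. f y + g y) x) \<le> norm (T f x) + norm (T g x)) \<and>
    (\<forall>c. \<forall>f\<in>D. AE x in M. norm (T (\<lambda>y. c * f y) x) = norm c * norm (T f x))"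

end

theory Submission
  imports Defs
begin

text \<open>For \<open>f \<in> D1\<close> let \<open>\<Omega>\<close> be the set where the maximal function of \<open>|f|\<^bsup>p0\<^esup>\<close> exceeds
  \<open>\<lambda>\<^bsup>p0\<^esup>\<close>. On Whitney balls of \<open>\<Omega>\<close> the \<open>L\<^bsup>p0\<^esup>\<close> averages of \<open>f\<close> are at most a constant times
  \<open>\<lambda>\<close>. Cut \<open>f\<close> into its restriction to the complement of \<open>\<Omega>\<close> and pieces \<open>b\<^sub>i\<close> supported in these balls, and write
  \<open>b\<^sub>i = A b\<^sub>i + (I - A) b\<^sub>i\<close>. The weak type \<open>(q,q)\<close> bound handles the first part and \<open>\<Sum> A b\<^sub>i\<close>, whose
  \<open>L\<^sup>q(w)\<close> norm is \<open>O(\<lambda> w(\<Omega>)\<^bsup>1/q\<^esup>)\<close> by duality and Kolmogorov's inequality; the terms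
  \<open>T (I - A) b\<^sub>i\<close> are summable off the dilated balls by (c). This bounds \<open>w(|T f| > 3 \<lambda>)\<close> by
  \<open>w(\<Omega>)\<close> and the integral of \<open>|f|\<^sup>q / \<lambda>\<^sup>q\<close> over \<open>{|f| \<le> \<lambda>}\<close>. Integrating
  against \<open>p \<lambda>\<^bsup>p-1\<^esup>\<close> and using Muckenhoupt's theorem for \<open>A\<^bsub>p/p0\<^esub>\<close> gives the strong type directly,
  with neither interpolation nor openness of the weight classes.\<close>

section \<open>Powers and Hoelder's inequality on \<open>[0,\<infinity>]\<close>\<close>

text \<open>The obstacle is that \<open>D1\<close> is closed only under truncation and
  \<open>T\<close> is merely sublinear: the pieces carry no cancellation, and infinite sums cannot
  be put inside \<open>T\<close>. Cancellation is replaced by the off-diagonal decay in (c), and all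
  sums stay finite, with a limit taken only in the good part. Membership of \<open>q\<close> in
  \<open>W_exponents\<close> gives RH with exponent (q0/q)', which turns the q0 averages of (b) into
  L^q(w) bounds; RH with exponent \<beta>' turns the averages of (c) into L^1(w) bounds, enough for
  Chebyshev; A with index p/p0 acts through the maximal function of |f|^p0. The factor 2^(D_w j) in
  (d) is the price of comparing w on a ball of radius 2^(j+1) r with w on the ball of radius r/3:
  only the latter balls are disjoint. All estimates are made at height 1, and homogeneity of
  \<open>T\<close> moves them to any height. The condition p < q makes the integral of p t^(p-1)
  (|f|/t)^q over t >= |f| converge, which is what an interpolation theorem would otherwise
  supply.\<close>

abbreviation norm_powr :: "complex \<Rightarrow> real \<Rightarrow> ennreal" where
  "norm_powr z a \<equiv> enn_powr (ennreal (norm z)) a"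

abbreviation power_integral :: "'a measure \<Rightarrow> real \<Rightarrow> ('a \<Rightarrow> complex) \<Rightarrow> ennreal" where
  "power_integral N a f \<equiv> \<integral>\<^sup>+x. norm_powr (f x) a \<partial>N"

lemma enn_powr_ennreal: "0 \<le> x \<Longrightarrow> 0 < a \<Longrightarrow> enn_powr (ennreal x) a = ennreal (x powr a)"
  by (simp add: enn_powr_def)

lemma enn_powr_zero [simp]: "0 < a \<Longrightarrow> enn_powr 0 a = 0"
  by (simp add: enn_powr_def)

lemma enn_powr_top [simp]: "0 < a \<Longrightarrow> enn_powr top a = top"
  by (simp add: enn_powr_def)

lemma enn_powr_1 [simp]: "enn_powr x 1 = x"
  by (cases x) (auto simp: enn_powr_def)

lemma enn_powr_one [simp]: "0 < a \<Longrightarrow> enn_powr 1 a = 1"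
  by (simp add: enn_powr_def)

lemma enn_powr_mono: "0 < a \<Longrightarrow> x \<le> y \<Longrightarrow> enn_powr x a \<le> enn_powr y a"
  by (cases x; cases y) (auto simp: enn_powr_ennreal top_unique intro!: ennreal_leI powr_mono2)

lemma enn_powr_powr: "0 < a \<Longrightarrow> 0 < b \<Longrightarrow> enn_powr (enn_powr x a) b = enn_powr x (a * b)"
  by (cases x) (auto simp: enn_powr_ennreal powr_powr)

lemma enn_powr_powr_inverse [simp]:
  "0 < a \<Longrightarrow> enn_powr (enn_powr x a) (1 / a) = x"
  "0 < a \<Longrightarrow> enn_powr (enn_powr x (1 / a)) a = x"
  by (simp_all add: enn_powr_powr)

lemma enn_powr_le_iff: "0 < a \<Longrightarrow> enn_powr x a \<le> enn_powr y a \<longleftrightarrow> x \<le> y"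
  using enn_powr_mono[of a x y] enn_powr_mono[of "1/a" "enn_powr x a" "enn_powr y a"] by auto

lemma enn_powr_less_iff: "0 < a \<Longrightarrow> enn_powr x a < enn_powr y a \<longleftrightarrow> x < y"
  using enn_powr_le_iff[of a y x] by (simp add: not_le[symmetric])

lemma enn_powr_less_top_iff: "0 < a \<Longrightarrow> enn_powr x a < top \<longleftrightarrow> x < top"
  using enn_powr_less_iff[of a x top] by simp

lemma enn_powr_eq_0_iff: "0 < a \<Longrightarrow> enn_powr x a = 0 \<longleftrightarrow> x = 0"
  using enn_powr_le_iff[of a x 0] by simp

lemma enn_powr_mult: "0 < a \<Longrightarrow> enn_powr (x * y) a = enn_powr x a * enn_powr y a"
proof (cases x; cases y)
  fix r s :: real
  assume "0 < a" "0 \<le> r" "x = ennreal r" "0 \<le> s" "y = ennreal s"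
  then show ?thesis
    by (simp add: enn_powr_ennreal powr_mult flip: ennreal_mult)
qed (auto simp: ennreal_mult_top ennreal_top_mult enn_powr_ennreal)

lemma enn_powr_add: "0 < a \<Longrightarrow> 0 < b \<Longrightarrow> enn_powr x (a + b) = enn_powr x a * enn_powr x b"
  by (cases x) (auto simp: enn_powr_ennreal powr_add ennreal_top_mult simp flip: ennreal_mult)

lemma enn_powr_inverse: "0 < a \<Longrightarrow> enn_powr (inverse x) a = inverse (enn_powr x a)"
proof (cases x)
  case (real r)
  then show "0 < a \<Longrightarrow> ?thesis"
    by (cases "r = 0") (simp_all add: inverse_ennreal enn_powr_ennreal inverse_powr)
qed simp

lemma enn_powr_divide: "0 < a \<Longrightarrow> enn_powr (x / y) a = enn_powr x a / enn_powr y a"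
  by (simp add: divide_ennreal_def enn_powr_mult enn_powr_inverse)

lemma enn_powr_indicator: "0 < a \<Longrightarrow> enn_powr (x * indicator E y) a = enn_powr x a * indicator E y"
  by (simp split: split_indicator)

lemma measurable_enn_powr [measurable]: "(\<lambda>x. enn_powr x a) \<in> borel_measurable borel"
  unfolding enn_powr_def by measurable

text \<open>An order isomorphism of [0,\<infinity>] preserves suprema; the nontrivial direction
  applies the inverse power \<open>1/a\<close> to an upper bound.\<close>

lemma enn_powr_SUP:
  assumes "0 < a"
  shows "enn_powr (SUP i\<in>I. f i) a = (SUP i\<in>I. enn_powr (f i) a)"
proof (rule antisym)
  have "f i \<le> enn_powr (SUP i\<in>I. enn_powr (f i) a) (1/a)" if "i \<in> I" for i
    using enn_powr_mono[of "1/a" "enn_powr (f i) a", OF _ SUP_upper[OF that, of "\<lambda>i. enn_powr (f i) a"]] assms by simp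
  then have "(SUP i\<in>I. f i) \<le> enn_powr (SUP i\<in>I. enn_powr (f i) a) (1/a)"
    by (rule SUP_least)
  from enn_powr_mono[OF assms this]
  show "enn_powr (SUP i\<in>I. f i) a \<le> (SUP i\<in>I. enn_powr (f i) a)" using assms by simp
next
  show "(SUP i\<in>I. enn_powr (f i) a) \<le> enn_powr (SUP i\<in>I. f i) a"
    by (intro SUP_least enn_powr_mono assms SUP_upper)
qed

section \<open>Young's and Hoelder's inequalities for conjugate exponents\<close>

lemma conjugate_gt_1:
  fixes p p' :: real
  assumes "1 < p" "1 / p + 1 / p' = 1"
  shows "1 < p'"
proof -
  have "0 < 1 - 1 / p" "1 - 1 / p < 1" using assms(1) by auto
  then have "0 < 1 / p'" "1 / p' < 1" using assms(2) by linarith+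
  then show ?thesis by (cases "p' > 0") (auto simp: divide_less_eq)
qed

lemma Young_ennreal:
  assumes "1 < p" "1 / p + 1 / p' = 1"
  shows "x * y \<le> ennreal (1 / p) * enn_powr x p + ennreal (1 / p') * enn_powr y p'"
proof -
  note p' = conjugate_gt_1[OF assms]
  show ?thesis
  proof (cases x; cases y)
    fix r s assume "0 \<le> r" "x = ennreal r" "0 \<le> s" "y = ennreal s"
    then show ?thesis
      using Youngs_inequality[OF assms(1) p' assms(2), of r s] assms(1) p'
      by (auto simp: enn_powr_ennreal intro!: ennreal_leI simp flip: ennreal_mult ennreal_plus)
  qed (use assms p' in \<open>auto simp: ennreal_mult_top ennreal_top_mult top_unique\<close>)
qed

text \<open>Young's inequality is integrated after normalising both functions to norm 1. Dividing by
  the norms is legitimate only if they are neither 0 nor infinite, so those values are separated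
  first.\<close>

lemma Holder_nn_integral:
  assumes p: "1 < p" "1 / p + 1 / p' = 1"
    and [measurable]: "f \<in> borel_measurable M" "g \<in> borel_measurable M"
  shows "(\<integral>\<^sup>+x. f x * g x \<partial>M) \<le>
    enn_powr (\<integral>\<^sup>+x. enn_powr (f x) p \<partial>M) (1 / p) * enn_powr (\<integral>\<^sup>+x. enn_powr (g x) p' \<partial>M) (1 / p')"
proof -
  have p': "0 < p'" using conjugate_gt_1[OF p] by simp
  define F G where "F = enn_powr (\<integral>\<^sup>+x. enn_powr (f x) p \<partial>M) (1 / p)"
    and "G = enn_powr (\<integral>\<^sup>+x. enn_powr (g x) p' \<partial>M) (1 / p')"
  have F: "enn_powr F p = (\<integral>\<^sup>+x. enn_powr (f x) p \<partial>M)"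
    and G: "enn_powr G p' = (\<integral>\<^sup>+x. enn_powr (g x) p' \<partial>M)"
    unfolding F_def G_def using p p' by simp_all
  consider "F = 0 \<or> G = 0" | "F \<noteq> 0" "G \<noteq> 0" "F = top \<or> G = top"
    | "F \<noteq> 0" "G \<noteq> 0" "F < top" "G < top" by (metis less_top)
  then have "(\<integral>\<^sup>+x. f x * g x \<partial>M) \<le> F * G"
  proof cases
    case 1
    then have "(\<integral>\<^sup>+x. enn_powr (f x) p \<partial>M) = 0 \<or> (\<integral>\<^sup>+x. enn_powr (g x) p' \<partial>M) = 0"
      using F G p p' by auto
    then have "AE x in M. f x * g x = 0"
      using p p' by (auto simp: nn_integral_0_iff_AE enn_powr_eq_0_iff elim: AE_mp)
    then have "(\<integral>\<^sup>+x. f x * g x \<partial>M) = 0" by (simp add: nn_integral_0_iff_AE)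
    then show ?thesis by simp
  next
    case 2
    then show ?thesis by (auto simp: ennreal_mult_top ennreal_top_mult)
  next
    case 3
    have FG: "F * G \<noteq> 0" "F * G < top" using 3 by (auto simp: ennreal_mult_less_top)
    have "(\<integral>\<^sup>+x. f x * g x \<partial>M) = (\<integral>\<^sup>+x. (F * G) * ((f x / F) * (g x / G)) \<partial>M)"
    proof (rule nn_integral_cong)
      fix x
      have "(F * G) * ((f x / F) * (g x / G)) = (f x * (F / F)) * (g x * (G / G))"
        by (simp add: divide_ennreal_def mult_ac)
      then show "f x * g x = (F * G) * ((f x / F) * (g x / G))" using 3 by simp
    qed
    also have "\<dots> = F * G * (\<integral>\<^sup>+x. (f x / F) * (g x / G) \<partial>M)"
      by (rule nn_integral_cmult) simp
    also have "(\<integral>\<^sup>+x. (f x / F) * (g x / G) \<partial>M) \<le>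
        (\<integral>\<^sup>+x. ennreal (1 / p) * (enn_powr (f x) p / enn_powr F p)
            + ennreal (1 / p') * (enn_powr (g x) p' / enn_powr G p') \<partial>M)"
      using Young_ennreal[OF p] p p' by (intro nn_integral_mono) (simp flip: enn_powr_divide)
    also have "\<dots> = ennreal (1 / p) * (enn_powr F p / enn_powr F p)
            + ennreal (1 / p') * (enn_powr G p' / enn_powr G p')"
      unfolding F G by (subst nn_integral_add) (auto simp: nn_integral_cmult nn_integral_divide)
    also have "\<dots> = 1"
      using 3 p p' by (simp add: enn_powr_eq_0_iff enn_powr_less_top_iff flip: ennreal_plus)
    finally show ?thesis by (simp add: mult_left_mono)
  qed
  then show ?thesis by (simp add: F_def G_def)
qed

section \<open>Layer cake integrals\<close>

lemma nn_integral_powr_less_real: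
  assumes "0 < a" "0 \<le> r"
  shows "(\<integral>\<^sup>+t. ennreal (t powr (a - 1)) * indicator {t. 0 < t \<and> t < r} t \<partial>lborel) = ennreal (r powr a / a)"
proof -
  have "((\<lambda>t. t powr (a - 1)) has_integral (r powr (a - 1 + 1) / (a - 1 + 1))) {0..r}"
    by (rule has_integral_powr_from_0) (use assms in auto)
  then have "(\<integral>\<^sup>+t\<in>{0..r}. ennreal (t powr (a - 1)) \<partial>lborel) = ennreal (r powr a / a)"
    using nn_integral_has_integral_lebesgue'[of "{0..r}" "\<lambda>t. t powr (a - 1)"] by simp
  also have "(\<integral>\<^sup>+t\<in>{0..r}. ennreal (t powr (a - 1)) \<partial>lborel) =
     (\<integral>\<^sup>+t. ennreal (t powr (a - 1)) * indicator {t. 0 < t \<and> t < r} t \<partial>lborel)"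
    using AE_lborel_singleton[of 0] AE_lborel_singleton[of r]
    by (intro nn_integral_cong_AE) (auto split: split_indicator elim!: AE_mp)
  finally show ?thesis by simp
qed

text \<open>The inner integral of the layer cake formula. \<open>y\<close> ranges over
  [0,\<infinity>] because maximal functions may be infinite.\<close>

lemma nn_integral_powr_less:
  assumes "0 < a"
  shows "(\<integral>\<^sup>+t. ennreal (a * t powr (a - 1)) * indicator {t. 0 < t \<and> ennreal t < y} t \<partial>lborel) = enn_powr y a"
proof -
  have level: "(\<integral>\<^sup>+t. ennreal (a * t powr (a - 1)) * indicator {t. 0 < t \<and> t < r} t \<partial>lborel) = ennreal (r powr a)"
    if "0 \<le> r" for r
  proof -
    have "(\<integral>\<^sup>+t. ennreal (a * t powr (a - 1)) * indicator {t. 0 < t \<and> t < r} t \<partial>lborel)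
       = ennreal a * (\<integral>\<^sup>+t. ennreal (t powr (a - 1)) * indicator {t. 0 < t \<and> t < r} t \<partial>lborel)"
      using assms by (subst nn_integral_cmult[symmetric]) (auto simp: ennreal_mult mult.assoc)
    then show ?thesis
      using assms that by (simp add: nn_integral_powr_less_real flip: ennreal_mult)
  qed
  show ?thesis
  proof (cases y)
    case (real r)
    then have "{t. 0 < t \<and> ennreal t < y} = {t. 0 < t \<and> t < r}"
      by (auto simp: ennreal_less_iff)
    then show ?thesis using \<open>0 \<le> r\<close> \<open>y = _\<close> assms level[of r] by (simp add: enn_powr_ennreal)
  next
    case top
    let ?I = "\<integral>\<^sup>+t. ennreal (a * t powr (a - 1)) * indicator {t. 0 < t \<and> ennreal t < y} t \<partial>lborel"
    \<comment> \<open>Restricting the integral to levels below \<open>c powr (1 / a)\<close> gives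
      exactly \<open>c\<close>, so the full integral dominates every real number.\<close>
    have le: "ennreal c \<le> ?I" if "0 \<le> c" for c
    proof -
      have "ennreal c = ennreal ((c powr (1 / a)) powr a)"
        using assms that by (cases "c = 0") (auto simp: powr_powr)
      also have "\<dots> \<le> ?I"
        unfolding level[of "c powr (1 / a)", OF powr_ge_zero, symmetric]
        by (intro nn_integral_mono) (auto simp: top split: split_indicator)
      finally show ?thesis .
    qed
    have "?I = top"
    proof (cases ?I)
      case (real r)
      then show ?thesis using le[of "r + 1"] by simp
    qed
    then show ?thesis using top assms by simp
  qed
qed

lemma nn_integral_powr_ge:
  assumes "0 < b" "0 < m"
  shows "(\<integral>\<^sup>+t. ennreal (t powr (- b - 1)) * indicator {m..} t \<partial>lborel) = ennreal (m powr (- b) / b)"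
proof -
  have "(\<integral>\<^sup>+t. ennreal (t powr (- b - 1)) * indicator {m..} t \<partial>lborel) = ennreal (0 - (- (m powr (- b) / b)))"
  proof (rule nn_integral_FTC_atLeast)
    show "((\<lambda>t. - (t powr - b / b)) has_real_derivative t powr (- b - 1)) (at t)" if "m \<le> t" for t
      using assms that by (auto intro!: derivative_eq_intros)
    have "((\<lambda>t. t powr (- b)) \<longlongrightarrow> 0) at_top"
      by (rule tendsto_neg_powr) (use assms in \<open>auto intro: filterlim_ident\<close>)
    then show "((\<lambda>t. - (t powr - b / b)) \<longlongrightarrow> 0) at_top"
      using tendsto_minus[OF tendsto_divide[OF _ tendsto_const, of "\<lambda>t. t powr (- b)" 0 at_top b]] assms by simp
  qed (use assms in auto)
  then show ?thesis by simp
qed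

text \<open>Tonelli on the region below the graph of \<open>g\<close>. The density \<open>k\<close>
  is kept because the strong type bound closes with \<open>k = h\<close>: there the weak type bound
  produces integrals of \<open>h\<close> over superlevel sets of \<open>2 * h\<close>.\<close>

lemma layer_cake:
  assumes "sigma_finite_measure N" "0 < a"
    and [measurable]: "g \<in> borel_measurable N" "k \<in> borel_measurable N"
  shows "(\<integral>\<^sup>+x. k x * enn_powr (g x) a \<partial>N) =
    (\<integral>\<^sup>+t. ennreal (a * t powr (a - 1)) * indicator {0<..} t *
      (\<integral>\<^sup>+x. k x * indicator {x. ennreal t < g x} x \<partial>N) \<partial>lborel)"
proof -
  interpret pair_sigma_finite lborel N
    using assms(1) by (simp add: pair_sigma_finite_def lborel.sigma_finite_measure_axioms)
  let ?f = "\<lambda>t x. ennreal (a * t powr (a - 1)) * indicator {0<..} t * (k x * indicator {x. ennreal t < g x} x)"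
  have "(\<integral>\<^sup>+x. k x * enn_powr (g x) a \<partial>N) = (\<integral>\<^sup>+x. \<integral>\<^sup>+t. ?f t x \<partial>lborel \<partial>N)"
  proof (rule nn_integral_cong)
    fix x
    have "k x * enn_powr (g x) a = (\<integral>\<^sup>+t. k x * (ennreal (a * t powr (a - 1)) *
        indicator {t. 0 < t \<and> ennreal t < g x} t) \<partial>lborel)"
      by (subst nn_integral_cmult) (auto simp: nn_integral_powr_less[OF \<open>0 < a\<close>])
    also have "\<dots> = (\<integral>\<^sup>+t. ?f t x \<partial>lborel)"
      by (intro nn_integral_cong) (auto split: split_indicator simp: mult_ac)
    finally show "k x * enn_powr (g x) a = (\<integral>\<^sup>+t. ?f t x \<partial>lborel)" .
  qed
  also have "\<dots> = (\<integral>\<^sup>+t. \<integral>\<^sup>+x. ?f t x \<partial>N \<partial>lborel)"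
  proof (rule Fubini')
    have *: "(\<lambda>z. indicator {x. ennreal (fst z) < g x} (snd z) :: ennreal) \<in> borel_measurable (lborel \<Otimes>\<^sub>M N)"
    proof -
      have "{z \<in> space (lborel \<Otimes>\<^sub>M N). ennreal (fst z) < g (snd z)} \<in> sets (lborel \<Otimes>\<^sub>M N)"
        by measurable
      then have "(indicator {z \<in> space (lborel \<Otimes>\<^sub>M N). ennreal (fst z) < g (snd z)} :: _ \<Rightarrow> ennreal) \<in> borel_measurable (lborel \<Otimes>\<^sub>M N)"
        by simp
      then show ?thesis
        by (subst measurable_cong[where g = "indicator {z \<in> space (lborel \<Otimes>\<^sub>M N). ennreal (fst z) < g (snd z)}"])
          (auto simp: space_pair_measure split: split_indicator)
    qed
    show "(\<lambda>(t, x). ?f t x) \<in> borel_measurable (lborel \<Otimes>\<^sub>M N)"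
      unfolding split_beta' by (intro borel_measurable_times_ennreal *) measurable
  qed
  also have "\<dots> = (\<integral>\<^sup>+t. ennreal (a * t powr (a - 1)) * indicator {0<..} t *
      (\<integral>\<^sup>+x. k x * indicator {x. ennreal t < g x} x \<partial>N) \<partial>lborel)"
  proof (intro nn_integral_cong nn_integral_cmult)
    fix t :: real
    have "(\<lambda>x. k x * (if ennreal t < g x then 1 else 0)) \<in> borel_measurable N" by measurable
    then show "(\<lambda>x. k x * indicator {x. ennreal t < g x} x) \<in> borel_measurable N"
      by (simp add: indicator_def)
  qed
  finally show ?thesis .
qed

lemma layer_cake_emeasure:
  assumes "sigma_finite_measure N" "0 < a" and [measurable]: "g \<in> borel_measurable N" and E: "E \<in> sets N"
  shows "(\<integral>\<^sup>+x\<in>E. enn_powr (g x) a \<partial>N) =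
    (\<integral>\<^sup>+t. ennreal (a * t powr (a - 1)) * indicator {0<..} t * emeasure N {x\<in>E. ennreal t < g x} \<partial>lborel)"
proof -
  have "(\<integral>\<^sup>+x. indicator E x * indicator {x. ennreal t < g x} x \<partial>N) = emeasure N {x\<in>E. ennreal t < g x}" for t
  proof -
    have "{x\<in>space N. x \<in> E \<and> ennreal t < g x} \<in> sets N" using E by measurable
    moreover have "{x\<in>space N. x \<in> E \<and> ennreal t < g x} = {x\<in>E. ennreal t < g x}"
      using sets.sets_into_space[OF E] by auto
    ultimately have "{x\<in>E. ennreal t < g x} \<in> sets N" by simp
    from nn_integral_indicator[OF this, symmetric] show ?thesis
      by (simp only:) (intro nn_integral_cong, auto split: split_indicator)
  qed
  moreover have "(\<integral>\<^sup>+x\<in>E. enn_powr (g x) a \<partial>N) = (\<integral>\<^sup>+x. indicator E x * enn_powr (g x) a \<partial>N)"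
    by (simp add: mult.commute)
  ultimately show ?thesis
    using layer_cake[OF assms(1-3), of "indicator E"] E by simp
qed

section \<open>Doubling measures and the maximal function\<close>

abbreviation pball :: "'a::metric_space \<times> real \<Rightarrow> 'a set" where
  "pball i \<equiv> ball (fst i) (snd i)"

text \<open>Greedy choice: a ball of largest radius is kept and the balls meeting it are discarded.
  Each of these has at most the same radius, hence lies in the threefold dilate. Balls of
  nonpositive radius are empty.\<close>

lemma finite_Vitali:
  fixes S :: "('a::metric_space \<times> real) set"
  assumes "finite S"
  shows "\<exists>J\<subseteq>S. disjoint_family_on pball J \<and>
    (\<Union>i\<in>S. pball i) \<subseteq> (\<Union>i\<in>J. ball (fst i) (3 * snd i))"
  using assms
proof (induction rule: finite_psubset_induct)
  case (psubset S)
  show ?case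
  proof (cases "\<forall>i\<in>S. snd i \<le> 0")
    case True
    then show ?thesis by (intro exI[of _ "{}"]) (auto simp: disjoint_family_on_def)
  next
    case False
    define m where "m = Max (snd ` S)"
    have "S \<noteq> {}" using False by auto
    then have "m \<in> snd ` S" unfolding m_def using psubset.hyps by simp
    then obtain k where k: "k \<in> S" "snd k = m" by auto
    have max: "snd i \<le> snd k" if "i \<in> S" for i
      using that psubset.hyps by (simp add: k m_def)
    then have pos: "0 < snd k" using False by force
    define S' where "S' = {i\<in>S. pball i \<inter> ball (fst k) (snd k) = {}}"
    have "fst k \<in> ball (fst k) (snd k)" using pos by simp
    then have "k \<notin> S'" unfolding S'_def by blast
    moreover have "S' \<subseteq> S" by (auto simp: S'_def)
    ultimately have "S' \<subset> S" using k(1) by blast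
    from psubset.IH[OF this] obtain J where J: "J \<subseteq> S'"
      "disjoint_family_on pball J"
      "(\<Union>i\<in>S'. pball i) \<subseteq> (\<Union>i\<in>J. ball (fst i) (3 * snd i))" by blast
    have "pball i \<subseteq> ball (fst k) (3 * snd k)" if "i \<in> S" "i \<notin> S'" for i
    proof
      fix z assume z: "z \<in> pball i"
      have "pball i \<inter> ball (fst k) (snd k) \<noteq> {}" using that unfolding S'_def by blast
      then obtain p where "p \<in> pball i" "p \<in> ball (fst k) (snd k)" by blast
      then have p: "dist (fst i) p < snd i" "dist (fst k) p < snd k" by simp_all
      have "dist (fst k) z \<le> dist (fst k) p + dist (fst i) p + dist (fst i) z"
        using dist_triangle[of "fst k" z p] dist_triangle[of p z "fst i"] by (simp add: dist_commute)
      then show "z \<in> ball (fst k) (3 * snd k)" using p z max[OF that(1)] by simp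
    qed
    then have "(\<Union>i\<in>S. pball i) \<subseteq> (\<Union>i\<in>insert k J. ball (fst i) (3 * snd i))"
      using J(3) by blast
    moreover have "disjoint_family_on pball (insert k J)"
      using J(1,2) unfolding disjoint_family_on_def S'_def by blast
    moreover have "insert k J \<subseteq> S" using J(1) k(1) \<open>S' \<subset> S\<close> by blast
    ultimately show ?thesis by blast
  qed
qed

text \<open>Lindelof's theorem reduces an arbitrary family to a countable one. Its finite initial
  parts can be fed to \<open>finite_Vitali\<close>, and monotone exhaustion passes the estimate on
  to the whole union.\<close>

lemma countable_ball_cover:
  fixes F :: "('a::{metric_space,second_countable_topology} \<times> real) set"
  obtains S :: "nat \<Rightarrow> ('a \<times> real) set" where "incseq S" "\<And>n. finite (S n)" "\<And>n. S n \<subseteq> F"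
    "(\<Union>n. \<Union>i\<in>S n. pball i) = (\<Union>i\<in>F. pball i)"
proof -
  let ?b = "\<lambda>i::'a \<times> real. pball i"
  obtain \<F> where \<F>: "\<F> \<subseteq> ?b ` F" "countable \<F>" "\<Union>\<F> = \<Union>(?b ` F)"
    by (rule Lindelof[of "?b ` F"]) auto
  obtain G where G: "G \<subseteq> F" "countable G" "\<F> = ?b ` G"
    using \<F>(1,2) by (meson countable_subset_image)
  define S where "S n = {i\<in>G. to_nat_on G i < n}" for n
  show thesis
  proof (rule that[of S])
    show "incseq S" by (auto simp: S_def incseq_def)
    show "finite (S n)" for n
    proof (rule inj_on_finite[of "to_nat_on G" _ "{..<n}"])
      show "inj_on (to_nat_on G) (S n)"
        using inj_on_to_nat_on[OF G(2)] by (rule inj_on_subset) (auto simp: S_def)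
    qed (auto simp: S_def)
    show "S n \<subseteq> F" for n using G by (auto simp: S_def)
    have "(\<Union>n. S n) = G" by (auto simp: S_def)
    then have "(\<Union>n. \<Union>i\<in>S n. ?b i) = \<Union>\<F>" by (auto simp: G(3))
    then show "(\<Union>n. \<Union>i\<in>S n. ?b i) = (\<Union>i\<in>F. ?b i)" using \<F>(3) by simp
  qed
qed

lemma doubling_measure_finite: "doubling_measure N \<Longrightarrow> emeasure N (ball x r) < top"
proof (cases "0 < r")
  case True
  then show "doubling_measure N \<Longrightarrow> ?thesis" unfolding doubling_measure_def by (metis infinity_ennreal_def)
qed (simp add: ball_empty)

lemma doubling_measure_sets: "doubling_measure N \<Longrightarrow> sets N = sets borel"
  by (simp add: doubling_measure_def)

lemma doubling_measure_space: "doubling_measure N \<Longrightarrow> space N = UNIV"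
  by (metis doubling_measure_sets sets_eq_imp_space_eq space_borel)

text \<open>The factor 4 serves twice: it dominates the 3 of the Vitali lemma, and it is the
  dilation by which a Whitney ball meets the complement of its open set.\<close>

lemma doubling_measure_four:
  assumes "doubling_measure N"
  obtains C :: ennreal where "C < top" "\<And>x r. 0 < r \<Longrightarrow> emeasure N (ball x (4 * r)) \<le> C * emeasure N (ball x r)"
proof -
  obtain C :: real where C: "\<And>x r. 0 < r \<Longrightarrow> emeasure N (ball x (2 * r)) \<le> ennreal C * emeasure N (ball x r)"
    using assms unfolding doubling_measure_def by blast
  have "emeasure N (ball x (4 * r)) \<le> ennreal C * ennreal C * emeasure N (ball x r)" if "0 < r" for x r
    using C[of "2 * r" x] mult_left_mono[OF C[of r x], of "ennreal C"] that by (simp add: mult.assoc)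
  then show ?thesis by (intro that[of "ennreal C * ennreal C"]) (auto simp: ennreal_mult_less_top)
qed

lemma doubling_measure_sigma_finite:
  assumes "doubling_measure N"
  shows "sigma_finite_measure N"
proof
  have "(\<Union>n::nat. ball undefined (real n)) = (UNIV :: 'a set)"
    by (auto simp: reals_Archimedean2)
  then show "\<exists>A. countable A \<and> A \<subseteq> sets N \<and> \<Union>A = space N \<and> (\<forall>a\<in>A. emeasure N a \<noteq> \<infinity>)"
    using doubling_measure_finite[OF assms, THEN less_imp_neq]
    by (intro exI[of _ "range (\<lambda>n::nat. ball undefined (real n))"])
      (auto simp: doubling_measure_space[OF assms] doubling_measure_sets[OF assms])
qed

text \<open>Packages the covering argument: a bound on the total mass of finite disjoint subfamilies
  bounds the measure of the whole union. The weak type bound and the differentiation lemma differ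
  only in the family and in \<open>Y\<close>.\<close>

lemma doubling_measure_covering:
  fixes N :: "'a::{metric_space,second_countable_topology} measure"
  assumes N: "doubling_measure N"
  obtains K :: ennreal where "K < top"
    "\<And>F Y. (\<And>i. i \<in> F \<Longrightarrow> 0 < snd i) \<Longrightarrow>
      (\<And>J. finite J \<Longrightarrow> J \<subseteq> F \<Longrightarrow> disjoint_family_on pball J \<Longrightarrow>
        (\<Sum>i\<in>J. emeasure N (pball i)) \<le> Y) \<Longrightarrow>
      emeasure N (\<Union>i\<in>F. pball i) \<le> K * Y"
proof -
  obtain K where K: "K < top" "\<And>x r. 0 < r \<Longrightarrow> emeasure N (ball x (4 * r)) \<le> K * emeasure N (ball x r)"
    using doubling_measure_four[OF N] by blast
  have "emeasure N (\<Union>i\<in>F. pball i) \<le> K * Y"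
    if pos: "\<And>i. i \<in> F \<Longrightarrow> 0 < snd i" and Y: "\<And>J. finite J \<Longrightarrow> J \<subseteq> F \<Longrightarrow>
        disjoint_family_on pball J \<Longrightarrow>
        (\<Sum>i\<in>J. emeasure N (pball i)) \<le> Y" for F Y
  proof -
    obtain S where S: "incseq S" "\<And>n. finite (S n)" "\<And>n. S n \<subseteq> F"
      "(\<Union>n::nat. \<Union>i\<in>S n. pball i) = (\<Union>i\<in>F. pball i)"
      by (rule countable_ball_cover[of F]) blast
    have le: "emeasure N (\<Union>i\<in>S n. pball i) \<le> K * Y" for n
    proof -
      obtain J where J: "J \<subseteq> S n" "disjoint_family_on pball J"
        "(\<Union>i\<in>S n. pball i) \<subseteq> (\<Union>i\<in>J. ball (fst i) (3 * snd i))"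
        using finite_Vitali[OF S(2)] by blast
      have fJ: "finite J" and JF: "J \<subseteq> F" using J(1) S(2,3) finite_subset by blast+
      have "emeasure N (\<Union>i\<in>S n. pball i) \<le> emeasure N (\<Union>i\<in>J. ball (fst i) (3 * snd i))"
        using J(3) by (intro emeasure_mono) (auto simp: doubling_measure_sets[OF N] intro!: borel_open)
      also have "\<dots> \<le> (\<Sum>i\<in>J. emeasure N (ball (fst i) (3 * snd i)))"
        using fJ by (intro emeasure_subadditive_finite) (auto simp: doubling_measure_sets[OF N])
      also have "\<dots> \<le> (\<Sum>i\<in>J. K * emeasure N (pball i))"
      proof (intro sum_mono)
        fix i assume "i \<in> J"
        then have "0 < snd i" using JF by (intro pos) blast
        then have "emeasure N (ball (fst i) (3 * snd i)) \<le> emeasure N (ball (fst i) (4 * snd i))"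
          by (intro emeasure_mono) (auto simp: doubling_measure_sets[OF N])
        also have "\<dots> \<le> K * emeasure N (pball i)" using K \<open>0 < snd i\<close> by simp
        finally show "emeasure N (ball (fst i) (3 * snd i)) \<le> K * emeasure N (pball i)" .
      qed
      also have "\<dots> \<le> K * Y"
        unfolding sum_distrib_left[symmetric] using Y[OF fJ JF J(2)] by (rule mult_left_mono) simp
      finally show ?thesis .
    qed
    have "(SUP n. emeasure N (\<Union>i\<in>S n. pball i)) = emeasure N (\<Union>i\<in>F. pball i)"
      unfolding S(4)[symmetric]
    proof (rule SUP_emeasure_incseq)
      show "range (\<lambda>n. \<Union>i\<in>S n. pball i) \<subseteq> sets N"
        by (auto simp: doubling_measure_sets[OF N] intro!: borel_open open_UN)
      show "incseq (\<lambda>n. \<Union>i\<in>S n. pball i)"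
        using S(1) unfolding incseq_def by blast
    qed
    moreover have "(SUP n. emeasure N (\<Union>i\<in>S n. pball i)) \<le> K * Y"
      by (intro SUP_least le)
    ultimately show ?thesis by simp
  qed
  with K(1) show ?thesis by (rule that)
qed

text \<open>The uncentred Hardy-Littlewood maximal function. Since \<open>x\<close> may lie anywhere
  in the ball, every superlevel set is a union of balls, hence open, which settles
  measurability.\<close>

definition maximal :: "'a::metric_space measure \<Rightarrow> ('a \<Rightarrow> ennreal) \<Rightarrow> 'a \<Rightarrow> ennreal" where
  "maximal N h x = (SUP i\<in>{i. 0 < snd i \<and> x \<in> pball i}. average N (pball i) h)"

lemma average_le_maximal: "0 < r \<Longrightarrow> x \<in> ball y r \<Longrightarrow> average N (ball y r) h \<le> maximal N h x"
  unfolding maximal_def by (rule SUP_upper2[of "(y, r)"]) auto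

lemma maximal_leI:
  "(\<And>y r. 0 < r \<Longrightarrow> x \<in> ball y r \<Longrightarrow> average N (ball y r) h \<le> c) \<Longrightarrow> maximal N h x \<le> c"
  unfolding maximal_def by (rule SUP_least) auto

lemma maximal_level_set:
  "{x. l < maximal N h x} =
    (\<Union>i\<in>{i. 0 < snd i \<and> l < average N (pball i) h}. pball i)"
  by (auto simp: maximal_def less_SUP_iff) blast+

lemma open_maximal_level_set: "open {x. l < maximal N h x}"
  unfolding maximal_level_set by auto

lemma measurable_maximal [measurable]: "maximal N h \<in> borel_measurable borel"
  by (rule borel_measurableI_greater) (simp add: open_maximal_level_set)

lemma borel_measurable_maximal:
  "doubling_measure M \<Longrightarrow> maximal N h \<in> borel_measurable M"
  using measurable_maximal measurable_cong_sets[OF doubling_measure_sets refl] by blast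

section \<open>Weak type, strong type and Kolmogorov bounds for the maximal function\<close>

lemma ennreal_le_divideD:
  fixes a b c :: ennreal
  assumes "a \<le> b / c"
  shows "a * c \<le> b"
proof (cases "c = 0 \<or> c = top")
  case False
  then have "a * c \<le> (b / c) * c" using assms by (intro mult_right_mono) auto
  also have "\<dots> = b" using False by (simp add: ennreal_divide_times less_top)
  finally show ?thesis .
qed (use assms in auto)

lemma ennreal_divide_leI:
  fixes a b c :: ennreal
  assumes "b \<le> a * c"
  shows "b / c \<le> a"
proof (cases "c = 0 \<or> c = top")
  case False
  then have "b / c \<le> (a * c) / c" using assms by (intro divide_right_mono_ennreal)
  also have "\<dots> = a" using False by (simp add: ennreal_mult_divide_eq less_top)
  finally show ?thesis .
qed (use assms in auto)

lemma sum_nn_integral_disjoint_le: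
  assumes "finite J" "disjoint_family_on B J" "\<And>i. i \<in> J \<Longrightarrow> B i \<in> sets N" "\<And>i. i \<in> J \<Longrightarrow> B i \<subseteq> E"
    "E \<in> sets N" and [measurable]: "h \<in> borel_measurable N"
  shows "(\<Sum>i\<in>J. \<integral>\<^sup>+x\<in>B i. h x \<partial>N) \<le> (\<integral>\<^sup>+x\<in>E. h x \<partial>N)"
proof -
  have "(\<Sum>i\<in>J. \<integral>\<^sup>+x\<in>B i. h x \<partial>N) = (\<Sum>i\<in>J. emeasure (density N h) (B i))"
    using assms by (intro sum.cong) (simp_all add: emeasure_density)
  also have "\<dots> = emeasure (density N h) (\<Union>i\<in>J. B i)"
    using assms by (intro sum_emeasure) auto
  also have "\<dots> \<le> emeasure (density N h) E"
    using assms by (intro emeasure_mono) auto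
  also have "\<dots> = (\<integral>\<^sup>+x\<in>E. h x \<partial>N)" using assms by (simp add: emeasure_density)
  finally show ?thesis .
qed

text \<open>The superlevel set is the union of the balls with average above \<open>l\<close>. On
  such a ball \<open>l\<close> times the mass is at most the integral of \<open>h\<close>, and over
  disjoint balls these integrals add up to at most the full one.\<close>

lemma maximal_weak_type:
  fixes N :: "'a::{metric_space,second_countable_topology} measure"
  assumes N: "doubling_measure N"
  obtains K :: ennreal where "K < top"
    "\<And>h l. h \<in> borel_measurable N \<Longrightarrow> l * emeasure N {x. l < maximal N h x} \<le> K * (\<integral>\<^sup>+x. h x \<partial>N)"
proof -
  obtain K :: ennreal where K: "K < top" and cover:
    "\<And>F Y. (\<And>i. i \<in> F \<Longrightarrow> 0 < snd i) \<Longrightarrow>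
      (\<And>J. finite J \<Longrightarrow> J \<subseteq> F \<Longrightarrow> disjoint_family_on pball J \<Longrightarrow>
        (\<Sum>i\<in>J. emeasure N (pball i)) \<le> Y) \<Longrightarrow>
      emeasure N (\<Union>i\<in>F. pball i) \<le> K * Y"
    using doubling_measure_covering[OF N] by blast
  have "l * emeasure N {x. l < maximal N h x} \<le> K * (\<integral>\<^sup>+x. h x \<partial>N)"
    if h[measurable]: "h \<in> borel_measurable N" for h l
  proof (cases "l = 0 \<or> l = top")
    case False
    define F where "F = {i. 0 < snd i \<and> l < average N (pball i) h}"
    have "emeasure N {x. l < maximal N h x} \<le> K * ((\<integral>\<^sup>+x. h x \<partial>N) / l)"
      unfolding maximal_level_set F_def[symmetric]
    proof (rule cover)
      fix J assume J: "finite J" "J \<subseteq> F" "disjoint_family_on pball J"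
      have "(\<Sum>i\<in>J. emeasure N (pball i)) * l \<le> (\<Sum>i\<in>J. \<integral>\<^sup>+x\<in>pball i. h x \<partial>N)"
        unfolding sum_distrib_right
      proof (rule sum_mono)
        fix i assume "i \<in> J"
        then have "l \<le> (\<integral>\<^sup>+x\<in>pball i. h x \<partial>N) / emeasure N (pball i)"
          using J(2) by (auto simp: F_def average_def)
        from ennreal_le_divideD[OF this]
        show "emeasure N (pball i) * l \<le> (\<integral>\<^sup>+x\<in>pball i. h x \<partial>N)"
          by (simp add: mult.commute)
      qed
      also have "\<dots> \<le> (\<integral>\<^sup>+x\<in>UNIV. h x \<partial>N)"
        using J doubling_measure_space[OF N]
        by (intro sum_nn_integral_disjoint_le) (auto simp: doubling_measure_sets[OF N])
      finally have "(\<Sum>i\<in>J. emeasure N (pball i)) * l / l \<le> (\<integral>\<^sup>+x. h x \<partial>N) / l"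
        by (intro divide_right_mono_ennreal) simp
      then show "(\<Sum>i\<in>J. emeasure N (pball i)) \<le> (\<integral>\<^sup>+x. h x \<partial>N) / l"
        using False by (simp add: ennreal_mult_divide_eq less_top)
    qed (auto simp: F_def)
    then have "l * emeasure N {x. l < maximal N h x} \<le> l * (K * ((\<integral>\<^sup>+x. h x \<partial>N) / l))"
      by (intro mult_left_mono) auto
    also have "\<dots> = K * (\<integral>\<^sup>+x. h x \<partial>N)"
      using False by (simp add: ennreal_times_divide mult.left_commute[of l] mult.commute[of l] ennreal_mult_divide_eq less_top)
    finally show ?thesis .
  qed auto
  with K show ?thesis by (rule that)
qed

text \<open>Marcinkiewicz interpolation by hand: at level t only the part of \<open>h\<close> above
  t/2 matters, because the rest has maximal function at most t/2. The weak type bound is applied to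
  that part and the levels are integrated.\<close>

lemma maximal_strong_type:
  fixes N :: "'a::{metric_space,second_countable_topology} measure"
  assumes N: "doubling_measure N" and s: "1 < s"
  obtains K :: ennreal where "K < top"
    "\<And>h. h \<in> borel_measurable N \<Longrightarrow>
      (\<integral>\<^sup>+x. enn_powr (maximal N h x) s \<partial>N) \<le> K * (\<integral>\<^sup>+x. enn_powr (h x) s \<partial>N)"
proof -
  obtain K :: ennreal where K: "K < top" and weak:
    "\<And>h l. h \<in> borel_measurable N \<Longrightarrow> l * emeasure N {x. l < maximal N h x} \<le> K * (\<integral>\<^sup>+x. h x \<partial>N)"
    using maximal_weak_type[OF N] by blast
  note sets = doubling_measure_sets[OF N] and space = doubling_measure_space[OF N]
    and sf = doubling_measure_sigma_finite[OF N]
  note [measurable] = borel_measurable_maximal[OF N]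
  \<comment> \<open>The 2 comes from halving the level, s/(s-1) from rewriting the density s
    t^(s-2), left after the weak type bound consumes one power of t, as a multiple of (s-1) t^(s-2),
    and 2^(s-1) from the cut at 2h > t.\<close>
  define L where "L = ennreal (2 * s / (s - 1)) * K * ennreal (2 powr (s - 1))"
  have "(\<integral>\<^sup>+x. enn_powr (maximal N h x) s \<partial>N) \<le> L * (\<integral>\<^sup>+x. enn_powr (h x) s \<partial>N)"
    if h[measurable]: "h \<in> borel_measurable N" for h
  proof -
    define H where "H t = (\<integral>\<^sup>+x. h x * indicator {x. ennreal t < 2 * h x} x \<partial>N)" for t
    have level: "ennreal t * emeasure N {x. ennreal t < maximal N h x} \<le> 2 * K * H t" if "0 < t" for t
    proof -
      let ?h = "\<lambda>x. h x * indicator {x. ennreal t < 2 * h x} x"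
      have half: "ennreal t = 2 * ennreal (t / 2)" using that by (subst ennreal_numeral[symmetric], subst ennreal_mult[symmetric]) auto
      have [measurable]: "?h \<in> borel_measurable N"
      proof -
        have "(\<lambda>x. h x * (if ennreal t < 2 * h x then 1 else 0)) \<in> borel_measurable N" by measurable
        then show ?thesis by (simp add: indicator_def)
      qed
      have "maximal N h x \<le> ennreal (t / 2) + maximal N ?h x" for x
      proof (rule maximal_leI)
        fix y and r :: real assume r: "0 < r" "x \<in> ball y r"
        have [measurable]: "ball y r \<in> sets N" by (simp add: sets)
        have "(\<integral>\<^sup>+x\<in>ball y r. h x \<partial>N) \<le> (\<integral>\<^sup>+x. ennreal (t/2) * indicator (ball y r) x + ?h x * indicator (ball y r) x \<partial>N)"
        proof (rule nn_integral_mono)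
          fix x
          have "h x \<le> ennreal (t / 2) + ?h x"
          proof (cases "ennreal t < 2 * h x")
            case False
            then have "2 * h x \<le> 2 * ennreal (t / 2)" by (simp add: half)
            then have "h x \<le> ennreal (t/2)" by (subst (asm) ennreal_mult_le_mult_iff) auto
            then show ?thesis by (simp add: add_increasing2)
          qed simp
          then show "h x * indicator (ball y r) x \<le> ennreal (t/2) * indicator (ball y r) x + ?h x * indicator (ball y r) x"
            by (auto split: split_indicator)
        qed
        also have "\<dots> = ennreal (t/2) * emeasure N (ball y r) + (\<integral>\<^sup>+x\<in>ball y r. ?h x \<partial>N)"
          by (subst nn_integral_add) (auto simp: nn_integral_cmult)
        finally have "average N (ball y r) h \<le> (ennreal (t/2) * emeasure N (ball y r)) / emeasure N (ball y r) + average N (ball y r) ?h"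
          unfolding average_def by (simp add: divide_right_mono_ennreal flip: add_divide_distrib_ennreal)
        also have "(ennreal (t/2) * emeasure N (ball y r)) / emeasure N (ball y r) \<le> ennreal (t/2)"
          by (rule ennreal_divide_leI) simp
        finally show "average N (ball y r) h \<le> ennreal (t/2) + maximal N ?h x"
          using average_le_maximal[OF r, of N ?h] by (meson add_mono order_trans order_refl add_right_mono)
      qed
      moreover have "ennreal (t/2) < maximal N ?h x" if "ennreal t < ennreal (t / 2) + maximal N ?h x" for x
      proof (rule ccontr)
        assume "\<not> ennreal (t/2) < maximal N ?h x"
        then have "ennreal (t / 2) + maximal N ?h x \<le> ennreal (t / 2) + ennreal (t / 2)" by (intro add_left_mono) simp
        also have "\<dots> = ennreal t" using \<open>0 < t\<close> by (subst ennreal_plus[symmetric]) auto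
        finally show False using that by simp
      qed
      ultimately have "emeasure N {x. ennreal t < maximal N h x} \<le> emeasure N {x. ennreal (t/2) < maximal N ?h x}"
        by (intro emeasure_mono) (auto simp: sets open_maximal_level_set intro: less_le_trans)
      then have "ennreal t * emeasure N {x. ennreal t < maximal N h x} \<le> 2 * (ennreal (t/2) * emeasure N {x. ennreal (t/2) < maximal N ?h x})"
        unfolding half mult.assoc by (intro mult_left_mono) (simp_all flip: half)
      also have "\<dots> \<le> 2 * (K * (\<integral>\<^sup>+x. ?h x \<partial>N))" by (intro mult_left_mono weak) auto
      finally show ?thesis by (simp add: H_def mult.assoc)
    qed
    have "(\<integral>\<^sup>+x. enn_powr (maximal N h x) s \<partial>N) =
      (\<integral>\<^sup>+t. ennreal (s * t powr (s - 1)) * indicator {0<..} t * emeasure N {x. ennreal t < maximal N h x} \<partial>lborel)"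
      using layer_cake_emeasure[OF sf, of s "maximal N h" UNIV] s sets.top[of N] by (simp add: space)
    also have "\<dots> \<le> (\<integral>\<^sup>+t. (ennreal (2 * s / (s - 1)) * K) * (ennreal ((s - 1) * t powr (s - 1 - 1)) * indicator {0<..} t * H t) \<partial>lborel)"
    proof (rule nn_integral_mono)
      fix t :: real
      show "ennreal (s * t powr (s - 1)) * indicator {0<..} t * emeasure N {x. ennreal t < maximal N h x}
        \<le> (ennreal (2 * s / (s - 1)) * K) * (ennreal ((s - 1) * t powr (s - 1 - 1)) * indicator {0<..} t * H t)"
      proof (cases "0 < t")
        case True
        have "s * t powr (s - 1) = (s * t powr (s - 1 - 1)) * t"
          using True powr_add[of t "s - 1 - 1" 1] by simp
        then have "ennreal (s * t powr (s - 1)) * emeasure N {x. ennreal t < maximal N h x}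
          = ennreal (s * t powr (s - 1 - 1)) * (ennreal t * emeasure N {x. ennreal t < maximal N h x})"
          using s True by (simp add: ennreal_mult mult.assoc)
        also have "\<dots> \<le> ennreal (s * t powr (s - 1 - 1)) * (2 * K * H t)"
          by (intro mult_left_mono level True) simp
        also have "\<dots> = (ennreal (s * t powr (s - 1 - 1)) * ennreal 2) * K * H t" by (simp add: mult_ac)
        also have "ennreal (s * t powr (s - 1 - 1)) * ennreal 2 = ennreal (2 * s / (s - 1)) * ennreal ((s - 1) * t powr (s - 1 - 1))"
          using s by (simp flip: ennreal_mult del: ennreal_numeral)
        finally show ?thesis using True by (simp add: mult_ac)
      qed simp
    qed
    also have "\<dots> = (ennreal (2 * s / (s - 1)) * K) * (\<integral>\<^sup>+t. ennreal ((s - 1) * t powr (s - 1 - 1)) * indicator {0<..} t * H t \<partial>lborel)"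
    proof (rule nn_integral_cmult)
      have "(\<lambda>t. H t) \<in> borel_measurable lborel"
      proof -
        interpret N: sigma_finite_measure N by (rule sf)
        have "(\<lambda>z. h (snd z) * (if ennreal (fst z) < 2 * h (snd z) then 1 else 0)) \<in> borel_measurable (lborel \<Otimes>\<^sub>M N)"
          by measurable
        then have "(\<lambda>t. \<integral>\<^sup>+x. (\<lambda>z. h (snd z) * (if ennreal (fst z) < 2 * h (snd z) then 1 else 0)) (t, x) \<partial>N) \<in> borel_measurable lborel"
          by (rule N.borel_measurable_nn_integral_fst)
        then show ?thesis by (simp add: H_def indicator_def)
      qed
      then show "(\<lambda>t. ennreal ((s - 1) * t powr (s - 1 - 1)) * indicator {0<..} t * H t) \<in> borel_measurable lborel" by measurable
    qed
    \<comment> \<open>The layer cake formula is read backwards, with exponent \<open>s - 1\<close>,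
      density \<open>h\<close> and function \<open>2 * h\<close>.\<close>
    also have "(\<integral>\<^sup>+t. ennreal ((s - 1) * t powr (s - 1 - 1)) * indicator {0<..} t * H t \<partial>lborel)
        = (\<integral>\<^sup>+x. h x * enn_powr (2 * h x) (s - 1) \<partial>N)"
      unfolding H_def using s by (subst layer_cake[OF sf]) auto
    also have "\<dots> = (\<integral>\<^sup>+x. ennreal (2 powr (s - 1)) * enn_powr (h x) s \<partial>N)"
    proof (rule nn_integral_cong)
      fix x
      have "enn_powr (h x) (1 + (s - 1)) = h x * enn_powr (h x) (s - 1)"
        using s by (subst enn_powr_add) auto
      moreover have "enn_powr 2 (s - 1) = ennreal (2 powr (s - 1))"
        using enn_powr_ennreal[of 2 "s - 1"] s by simp
      ultimately show "h x * enn_powr (2 * h x) (s - 1) = ennreal (2 powr (s - 1)) * enn_powr (h x) s"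
        using s by (simp add: enn_powr_mult mult_ac)
    qed
    also have "\<dots> = ennreal (2 powr (s - 1)) * (\<integral>\<^sup>+x. enn_powr (h x) s \<partial>N)"
      by (rule nn_integral_cmult) measurable
    finally show ?thesis by (simp add: L_def mult.assoc)
  qed
  moreover have "L < top" using K by (simp add: L_def ennreal_mult_less_top)
  ultimately show ?thesis by (intro that)
qed

text \<open>The truncation level \<open>a\<close> is left free so that it can later be chosen to absorb a term.\<close>

lemma maximal_Kolmogorov:
  fixes N :: "'a::{metric_space,second_countable_topology} measure"
  assumes N: "doubling_measure N" and r: "1 < r"
  obtains K :: ennreal where "K < top"
    "\<And>h E a. h \<in> borel_measurable N \<Longrightarrow> E \<in> sets N \<Longrightarrow> 0 < a \<Longrightarrow>
      (\<integral>\<^sup>+x\<in>E. enn_powr (maximal N h x) (1 / r) \<partial>N) \<le>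
        ennreal a * emeasure N E + K * ennreal (a powr (1 - r)) * (\<integral>\<^sup>+x. h x \<partial>N)"
proof -
  obtain K :: ennreal where K: "K < top" and weak:
    "\<And>h l. h \<in> borel_measurable N \<Longrightarrow> l * emeasure N {x. l < maximal N h x} \<le> K * (\<integral>\<^sup>+x. h x \<partial>N)"
    using maximal_weak_type[OF N] by blast
  note sets = doubling_measure_sets[OF N] and sf = doubling_measure_sigma_finite[OF N]
  note [measurable] = borel_measurable_maximal[OF N]
  define L where "L = K * ennreal (1 / (r - 1))"
  have "(\<integral>\<^sup>+x\<in>E. enn_powr (maximal N h x) (1 / r) \<partial>N) \<le>
        ennreal a * emeasure N E + L * ennreal (a powr (1 - r)) * (\<integral>\<^sup>+x. h x \<partial>N)"
    if h: "h \<in> borel_measurable N" and E: "E \<in> sets N" and a: "0 < a" for h E a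
  proof -
    let ?g = "\<lambda>x. enn_powr (maximal N h x) (1 / r)" and ?I = "\<integral>\<^sup>+x. h x \<partial>N"
    have "(\<integral>\<^sup>+x\<in>E. ?g x \<partial>N) = (\<integral>\<^sup>+x\<in>E. enn_powr (?g x) 1 \<partial>N)"
      by simp
    also have "\<dots> = (\<integral>\<^sup>+t. ennreal (1 * t powr (1 - 1)) * indicator {0<..} t * emeasure N {x\<in>E. ennreal t < ?g x} \<partial>lborel)"
      by (rule layer_cake_emeasure[OF sf]) (use E in auto)
    \<comment> \<open>Up to level \<open>a\<close> the measure of \<open>E\<close> is taken as the
      bound; beyond it the weak type bound decays like t^(-r), which is integrable because r >
      1.\<close>
    also have "\<dots> \<le> (\<integral>\<^sup>+t. emeasure N E * indicator {0..a} t + (K * ?I) * (ennreal (t powr (- (r - 1) - 1)) * indicator {a..} t) \<partial>lborel)"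
    proof (rule nn_integral_mono)
      fix t :: real
      have "emeasure N {x\<in>E. ennreal t < ?g x} \<le> (K * ?I) * ennreal (t powr (- r))" if t: "0 < t"
      proof -
        have eq: "ennreal t < ?g x \<longleftrightarrow> ennreal (t powr r) < maximal N h x" for x
          using enn_powr_less_iff[of r "ennreal t" "?g x"] r t by (simp add: enn_powr_ennreal)
        have "emeasure N {x\<in>E. ennreal t < ?g x} \<le> emeasure N {x. ennreal (t powr r) < maximal N h x}"
          unfolding eq by (rule emeasure_mono) (auto simp: sets open_maximal_level_set)
        also have "\<dots> = ennreal (t powr (- r)) * (ennreal (t powr r) * emeasure N {x. ennreal (t powr r) < maximal N h x})"
          using t by (simp add: powr_minus flip: mult.assoc ennreal_mult)
        also have "\<dots> \<le> ennreal (t powr (- r)) * (K * ?I)" by (intro mult_left_mono weak h) simp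
        finally show ?thesis by (simp add: mult.commute)
      qed
      moreover have "emeasure N {x\<in>E. ennreal t < ?g x} \<le> emeasure N E" by (rule emeasure_mono) (use E in auto)
      ultimately show "ennreal (1 * t powr (1 - 1)) * indicator {0<..} t * emeasure N {x\<in>E. ennreal t < ?g x}
        \<le> emeasure N E * indicator {0..a} t + (K * ?I) * (ennreal (t powr (- (r - 1) - 1)) * indicator {a..} t)"
        using a by (auto split: split_indicator simp: add_increasing2)
    qed
    also have "\<dots> = emeasure N E * (\<integral>\<^sup>+t. indicator {0..a} t \<partial>lborel) +
        (K * ?I) * (\<integral>\<^sup>+t. ennreal (t powr (- (r - 1) - 1)) * indicator {a..} t \<partial>lborel)"
      by (subst nn_integral_add) (auto simp: nn_integral_cmult)
    also have "\<dots> = ennreal a * emeasure N E + (K * ?I) * ennreal (a powr (- (r - 1)) / (r - 1))"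
      using nn_integral_powr_ge[of "r - 1" a] a r by (simp add: mult.commute)
    also have "ennreal (a powr (- (r - 1)) / (r - 1)) = ennreal (1 / (r - 1)) * ennreal (a powr (1 - r))"
      using r by (simp flip: ennreal_mult)
    finally show ?thesis by (simp add: L_def mult_ac)
  qed
  moreover have "L < top" using K by (simp add: L_def ennreal_mult_less_top)
  ultimately show ?thesis by (intro that)
qed

section \<open>Almost everywhere domination by the maximal function\<close>

text \<open>Outer regularity is a statement about finite Borel measures on Polish spaces, so
  \<open>N\<close> is first restricted to a ball containing \<open>E\<close>. This is where
  completeness of the space enters.\<close>

lemma outer_open_ball:
  fixes N :: "'a::{second_countable_topology,complete_space} measure"
  assumes N: "doubling_measure N" and E: "E \<in> sets N" "E \<subseteq> ball x0 R" and e: "0 < e"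
  obtains U where "open U" "E \<subseteq> U" "emeasure N (U - E) \<le> ennreal e"
proof -
  note sets = doubling_measure_sets[OF N]
  have [measurable]: "ball x0 R \<in> sets N" by (simp add: sets)
  define N' where "N' = density N (indicator (ball x0 R))"
  have N': "emeasure N' A = emeasure N (A \<inter> ball x0 R)" if "A \<in> sets N" for A
    unfolding N'_def using that by (subst emeasure_restricted) (auto simp: Int_commute)
  have fin: "emeasure N E < top"
    using emeasure_mono[OF E(2), of N] doubling_measure_finite[OF N, of x0 R] by (simp add: le_less_trans)
  have "emeasure N' E = (INF U\<in>{U. E \<subseteq> U \<and> open U}. emeasure N' U)"
  proof (rule outer_regular)
    show "sets N' = sets borel" by (simp add: N'_def sets)
    have "space N' \<in> sets N" by (simp add: N'_def)
    then show "emeasure N' (space N') \<noteq> \<infinity>"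
      using doubling_measure_finite[OF N, of x0 R] emeasure_mono[of "space N' \<inter> ball x0 R" "ball x0 R" N]
      by (auto simp: N')
    show "E \<in> sets borel" using E by (simp add: sets)
  qed
  moreover have "emeasure N' E = emeasure N E" using E by (simp add: N' Int_absorb2)
  ultimately have "(INF U\<in>{U. E \<subseteq> U \<and> open U}. emeasure N' U) < emeasure N E + ennreal e"
    using fin e by (metis ennreal_add_left_cancel_less add.right_neutral ennreal_less_zero_iff infinity_ennreal_def less_irrefl)
  then obtain U where U: "E \<subseteq> U" "open U" "emeasure N' U < emeasure N E + ennreal e"
    unfolding INF_less_iff by auto
  let ?V = "U \<inter> ball x0 R"
  have V: "?V \<in> sets N" using U by (auto simp: sets)
  have "emeasure N (?V - E) = emeasure N ?V - emeasure N E"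
    using E U V fin by (intro emeasure_Diff) auto
  also have "\<dots> \<le> ennreal e"
    using U(2) less_imp_le[OF U(3)] fin by (auto simp: N' sets ennreal_minus_le_iff)
  finally show ?thesis using U E by (intro that[of ?V]) auto
qed

text \<open>If \<open>h > b\<close> on a set \<open>E\<close> where the maximal function is at most \<open>a < b\<close>, then every ball
  meeting \<open>E\<close> loses a fixed proportion of its mass outside \<open>E\<close>; covering \<open>E\<close> inside an open
  set of almost the same measure shows that \<open>E\<close> is null.\<close>

lemma AE_le_maximal:
  fixes N :: "'a::{second_countable_topology,complete_space} measure"
  assumes N: "doubling_measure N" and h[measurable]: "h \<in> borel_measurable N"
  shows "AE x in N. h x \<le> maximal N h x"
proof -
  obtain K :: ennreal where K: "K < top" and cover:
    "\<And>F Y. (\<And>i. i \<in> F \<Longrightarrow> 0 < snd i) \<Longrightarrow>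
      (\<And>J. finite J \<Longrightarrow> J \<subseteq> F \<Longrightarrow> disjoint_family_on pball J \<Longrightarrow>
        (\<Sum>i\<in>J. emeasure N (pball i)) \<le> Y) \<Longrightarrow>
      emeasure N (\<Union>i\<in>F. pball i) \<le> K * Y"
    using doubling_measure_covering[OF N] by blast
  note sets = doubling_measure_sets[OF N] and space = doubling_measure_space[OF N]
  note [measurable] = borel_measurable_maximal[OF N]
  have [measurable]: "ball x R \<in> sets N" for x R by (simp add: sets)
  have null: "emeasure N {x\<in>ball x0 R. maximal N h x \<le> ennreal a \<and> ennreal b < h x} = 0"
    (is "emeasure N ?E = 0") if ab: "0 \<le> a" "a < b" for a b R and x0 :: 'a
  proof -
    have E: "?E \<in> sets N"
    proof -
      have "{x\<in>space N. x \<in> ball x0 R \<and> maximal N h x \<le> ennreal a \<and> ennreal b < h x} \<in> sets N"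
        by measurable
      then show ?thesis by (simp add: space)
    qed
    have bound: "emeasure N ?E \<le> K * ennreal (b / (b - a)) * ennreal e" if e: "0 < e" for e
    proof -
      obtain U where U: "open U" "?E \<subseteq> U" "emeasure N (U - ?E) \<le> ennreal e"
      proof (rule outer_open_ball[OF N E _ e])
        show "?E \<subseteq> ball x0 R" by auto
      qed
      have Us: "U \<in> sets N" using U by (simp add: sets)
      \<comment> \<open>The centres lie in \<open>?E\<close>, so the averages over these balls are
        at most \<open>a\<close>; the balls stay in \<open>U\<close>, so their parts outside
        \<open>?E\<close> share the small measure of \<open>U - ?E\<close>.\<close>
      define F where "F = {i. 0 < snd i \<and> pball i \<subseteq> U \<and> fst i \<in> ?E}"
      have "emeasure N ?E \<le> emeasure N (\<Union>i\<in>F. pball i)"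
      proof (rule emeasure_mono)
        show "?E \<subseteq> (\<Union>i\<in>F. pball i)"
        proof
          fix x assume x: "x \<in> ?E"
          then obtain r where "0 < r" "ball x r \<subseteq> U" using U(1,2) openE by blast
          then have "(x, r) \<in> F" "x \<in> ball (fst (x, r)) (snd (x, r))" using x by (auto simp: F_def)
          then show "x \<in> (\<Union>i\<in>F. pball i)" by blast
        qed
      qed (auto simp: sets intro!: borel_open)
      also have "\<dots> \<le> K * (ennreal (b / (b - a)) * ennreal e)"
      proof (rule cover)
        fix J assume J: "finite J" "J \<subseteq> F" "disjoint_family_on pball J"
        have "emeasure N (pball i) \<le> ennreal (b / (b - a)) * emeasure N (pball i - ?E)" if "i \<in> J" for i
        proof -
          let ?B = "pball i"
          have i: "0 < snd i" "fst i \<in> ?E" "?B \<in> sets N" using J(2) that by (auto simp: F_def sets)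
          have fin: "emeasure N ?B < top" by (rule doubling_measure_finite[OF N])
          have fin2: "emeasure N (?B \<inter> ?E) < top" "emeasure N (?B - ?E) < top"
            using emeasure_mono[of "?B \<inter> ?E" ?B N] emeasure_mono[of "?B - ?E" ?B N] i(3) fin
            by (auto intro: le_less_trans)
          have "average N ?B h \<le> maximal N h (fst i)" using i by (intro average_le_maximal) auto
          also have "\<dots> \<le> ennreal a" using i by simp
          finally have "average N ?B h \<le> ennreal a" .
          have "ennreal b * emeasure N (?B \<inter> ?E) = (\<integral>\<^sup>+x. ennreal b * indicator (?B \<inter> ?E) x \<partial>N)"
            using i(3) E by (subst nn_integral_cmult_indicator) auto
          also have "\<dots> \<le> (\<integral>\<^sup>+x\<in>?B. h x \<partial>N)"
            by (intro nn_integral_mono) (auto split: split_indicator)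
          also have "\<dots> \<le> ennreal a * emeasure N ?B"
          proof (cases "emeasure N ?B = 0")
            case True
            then have "?B \<in> null_sets N" using i(3) by auto
            then have "(\<integral>\<^sup>+x\<in>?B. h x \<partial>N) = 0" by (rule nn_integral_null_set)
            then show ?thesis by simp
          next
            case False
            then have "(\<integral>\<^sup>+x\<in>?B. h x \<partial>N) = average N ?B h * emeasure N ?B"
              using fin by (simp add: average_def ennreal_divide_times less_top)
            also have "\<dots> \<le> ennreal a * emeasure N ?B" by (intro mult_right_mono) (fact, simp)
            finally show ?thesis .
          qed
          finally have 1: "ennreal b * emeasure N (?B \<inter> ?E) \<le> ennreal a * emeasure N ?B" .
          have "emeasure N ?B = emeasure N ((?B \<inter> ?E) \<union> (?B - ?E))" by (rule arg_cong[where f = "emeasure N"]) blast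
          also have "\<dots> = emeasure N (?B \<inter> ?E) + emeasure N (?B - ?E)"
            using i(3) E by (intro plus_emeasure[symmetric]) auto
          finally have 2: "emeasure N ?B = emeasure N (?B \<inter> ?E) + emeasure N (?B - ?E)" .
          obtain u v where uv: "0 \<le> u" "0 \<le> v" "emeasure N (?B \<inter> ?E) = ennreal u" "emeasure N (?B - ?E) = ennreal v"
            using fin2 by (meson less_top_ennreal)
          \<comment> \<open>Here \<open>u\<close> is the mass of the ball inside \<open>?E\<close>
            and \<open>v\<close> the mass outside; solving for \<open>u + v\<close> yields the
            factor b/(b-a).\<close>
          have "b * u \<le> a * (u + v)"
            using 1 2 uv ab by (simp flip: ennreal_plus ennreal_mult)
          then have "(u + v) * (b - a) \<le> b * v" by (simp add: algebra_simps)
          then have "u + v \<le> b / (b - a) * v" using ab by (simp add: pos_le_divide_eq)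
          then show ?thesis using 2 uv ab by (simp flip: ennreal_plus ennreal_mult)
        qed
        then have "(\<Sum>i\<in>J. emeasure N (pball i)) \<le>
            ennreal (b / (b - a)) * (\<Sum>i\<in>J. emeasure N (pball i - ?E))"
          unfolding sum_distrib_left by (rule sum_mono)
        also have "(\<Sum>i\<in>J. emeasure N (pball i - ?E)) = emeasure N (\<Union>i\<in>J. pball i - ?E)"
        proof (rule sum_emeasure)
          show "disjoint_family_on (\<lambda>i. pball i - ?E) J"
            using J(3) unfolding disjoint_family_on_def by blast
        qed (use J(1) E in \<open>auto intro!: sets.Diff\<close>)
        also have "\<dots> \<le> emeasure N (U - ?E)"
          using J(2) by (intro emeasure_mono sets.Diff E Us) (unfold F_def, blast)
        also note U(3)
        finally show "(\<Sum>i\<in>J. emeasure N (pball i)) \<le> ennreal (b / (b - a)) * ennreal e"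
          by (simp add: mult_left_mono)
      qed (auto simp: F_def)
      finally show ?thesis by (simp add: mult.assoc)
    qed
    have "K * ennreal (b / (b - a)) < top" using K by (simp add: ennreal_mult_less_top)
    then obtain c where c: "0 \<le> c" "K * ennreal (b / (b - a)) = ennreal c" by (auto simp: less_top_ennreal)
    have le: "emeasure N ?E \<le> ennreal (c * e)" if "0 < e" for e
      using bound[OF that] that unfolding c(2) by (simp add: ennreal_mult c(1))
    have "emeasure N ?E \<le> 0"
    proof (rule ennreal_le_epsilon)
      fix e :: real assume "0 < e"
      \<comment> \<open>Dividing by \<open>c + 1\<close> rather than by \<open>c\<close> keeps the
        choice valid when \<open>c = 0\<close>.\<close>
      then have "emeasure N ?E \<le> ennreal (c * (e / (c + 1)))" using c by (intro le) auto
      also have "c * (e / (c + 1)) \<le> e" using c \<open>0 < e\<close> by (simp add: field_simps)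
      finally show "emeasure N ?E \<le> 0 + ennreal e" by (simp add: ennreal_leI)
    qed
    then show ?thesis by simp
  qed
  \<comment> \<open>Countably many null sets suffice: a gap between the two functions contains two
    rationals, and balls of integer radius exhaust the space.\<close>
  have "AE x in N. \<forall>n::nat. \<forall>a\<in>\<rat>. \<forall>b\<in>\<rat>. 0 \<le> a \<longrightarrow> a < b \<longrightarrow>
      \<not> (x \<in> ball undefined (real n) \<and> maximal N h x \<le> ennreal a \<and> ennreal b < h x)"
  proof (intro AE_all_countable[THEN iffD2] AE_ball_countable'[OF _ countable_rat] allI)
    fix n :: nat and a b :: real
    show "AE x in N. 0 \<le> a \<longrightarrow> a < b \<longrightarrow>
      \<not> (x \<in> ball undefined (real n) \<and> maximal N h x \<le> ennreal a \<and> ennreal b < h x)"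
    proof (cases "0 \<le> a \<and> a < b")
      case True
      then have "emeasure N {x\<in>ball undefined (real n). maximal N h x \<le> ennreal a \<and> ennreal b < h x} = 0"
        by (intro null) auto
      moreover have "{x\<in>space N. x \<in> ball undefined (real n) \<and> maximal N h x \<le> ennreal a \<and> ennreal b < h x} \<in> sets N"
        by measurable
      ultimately show ?thesis
        by (intro AE_I[where N = "{x\<in>ball undefined (real n). maximal N h x \<le> ennreal a \<and> ennreal b < h x}"])
          (auto simp: space)
    qed auto
  qed
  then show ?thesis
  proof eventually_elim
    case (elim x)
    show ?case
    proof (rule ccontr)
      assume "\<not> h x \<le> maximal N h x"
      then have "maximal N h x < h x" by simp
      then obtain a where a: "a \<in> \<rat>" "maximal N h x < ennreal a" "ennreal a < h x"
        using ennreal_rat_dense[of "maximal N h x" "h x"] by (auto simp: Rats_def)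
      obtain b where b: "b \<in> \<rat>" "ennreal a < ennreal b" "ennreal b < h x"
        using ennreal_rat_dense[of "ennreal a" "h x"] a by (auto simp: Rats_def)
      have "0 < a" using a(2) by (metis ennreal_less_zero_iff le_less_trans zero_le)
      then have "a < b" using b(2) by (simp add: ennreal_less_iff)
      obtain n :: nat where "dist undefined x < real n" using reals_Archimedean2 by blast
      then show False using elim a b \<open>0 < a\<close> \<open>a < b\<close> less_imp_le[OF a(2)] by auto
    qed
  qed
qed

section \<open>Muckenhoupt weights\<close>

lemma sets_wmeasure [simp]: "sets (wmeasure M w) = sets M"
  by (simp add: wmeasure_def)

lemma weight_measurable: "weight M w \<Longrightarrow> w \<in> borel_measurable M"
  by (simp add: weight_def)

lemma emeasure_wmeasure:
  assumes "weight M w" "E \<in> sets M"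
  shows "emeasure (wmeasure M w) E = (\<integral>\<^sup>+x\<in>E. ennreal (w x) \<partial>M)"
  unfolding wmeasure_def by (rule emeasure_density) (use assms in \<open>auto dest: weight_measurable\<close>)

lemma nn_integral_wmeasure:
  assumes "weight M w" "f \<in> borel_measurable M"
  shows "(\<integral>\<^sup>+x. f x \<partial>wmeasure M w) = (\<integral>\<^sup>+x. ennreal (w x) * f x \<partial>M)"
  unfolding wmeasure_def by (rule nn_integral_density) (use assms in \<open>auto dest: weight_measurable\<close>)

lemma average_weight:
  "weight M w \<Longrightarrow> ball x r \<in> sets M \<Longrightarrow>
    average M (ball x r) (\<lambda>z. ennreal (w z)) = emeasure (wmeasure M w) (ball x r) / emeasure M (ball x r)"
  by (simp add: average_def emeasure_wmeasure)

lemma AE_wmeasure: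
  assumes "weight M w" "AE x in M. P x"
  shows "AE x in wmeasure M w. P x"
  unfolding wmeasure_def by (subst AE_density) (use assms in \<open>auto dest: weight_measurable\<close>)

lemma nn_integral_average:
  assumes "emeasure M B \<noteq> 0" "emeasure M B < top"
  shows "(\<integral>\<^sup>+x\<in>B. f x \<partial>M) = average M B f * emeasure M B"
  using assms by (simp add: average_def ennreal_divide_times less_top)

text \<open>Lerner's argument: with \<open>\<sigma> = w\<^bsup>-1/(t-1)\<^esup>\<close>, the maximal function satisfies
  \<open>(M h)\<^bsup>t-1\<^esup> \<le> C M\<^bsub>w\<^esub>((M\<^bsub>\<sigma>\<^esub>(h/\<sigma>))\<^bsup>t-1\<^esup> / w)\<close> pointwise, and \<open>M\<^bsub>w\<^esub>\<close>, \<open>M\<^bsub>\<sigma>\<^esub>\<close> are bounded since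
  \<open>w\<close> and \<open>\<sigma>\<close> are doubling. No self-improvement of the \<open>A\<^sub>t\<close> condition is involved.\<close>

theorem Muckenhoupt:
  fixes M :: "'a::{metric_space,second_countable_topology} measure"
  assumes M: "doubling_measure M" and N: "doubling_measure (wmeasure M w)"
    and A: "w \<in> A_class M t" and t: "1 < t"
    and pos: "\<And>x r. 0 < r \<Longrightarrow> 0 < emeasure (wmeasure M w) (ball x r)"
  obtains K :: ennreal where "K < top"
    "\<And>h. h \<in> borel_measurable M \<Longrightarrow>
      (\<integral>\<^sup>+x. enn_powr (maximal M h x) t \<partial>wmeasure M w) \<le> K * (\<integral>\<^sup>+x. enn_powr (h x) t \<partial>wmeasure M w)"
proof -
  define N where "N = wmeasure M w"
  note NN = N[folded N_def]
  define e where "e = 1 / (t - 1)"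
  have e: "0 < e" "e * (t - 1) = 1" "1 - t / (t - 1) = - e" using t by (auto simp: e_def field_simps)
  have w: "weight M w" using A by (simp add: A_class_def)
  note [measurable] = weight_measurable[OF w]
  have w0: "0 \<le> w x" for x using w by (simp add: weight_def)
  note sets = doubling_measure_sets[OF M]
  have [measurable]: "ball x r \<in> sets M" for x r by (simp add: sets)
  have finM: "emeasure M (ball x r) < top" for x r by (rule doubling_measure_finite[OF M])
  have finN: "emeasure N (ball x r) < top" for x r by (rule doubling_measure_finite[OF NN])
  have posN: "0 < emeasure N (ball x r)" if "0 < r" for x r using pos[OF that] by (simp add: N_def)
  have posM: "0 < emeasure M (ball x r)" if "0 < r" for x r
  proof (rule ccontr)
    assume "\<not> 0 < emeasure M (ball x r)"
    then have "ball x r \<in> null_sets M" by auto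
    then have "emeasure N (ball x r) = 0" by (simp add: N_def emeasure_wmeasure w nn_integral_null_set)
    then show False using posN[OF that, of x] by simp
  qed
  obtain C :: real where "\<forall>x r. 0 < r \<longrightarrow> average M (ball x r) (\<lambda>z. ennreal (w z)) *
      enn_powr (average M (ball x r) (\<lambda>z. enn_powr (ennreal (w z)) (1 - t / (t - 1)))) (t - 1) \<le> ennreal C"
    using A t unfolding A_class_def by force
  then have C: "emeasure N (ball x r) / emeasure M (ball x r) *
      enn_powr (average M (ball x r) (\<lambda>z. enn_powr (ennreal (w z)) (- e))) (t - 1) \<le> ennreal C"
    if "0 < r" for x r using that by (simp add: e average_weight[OF w] N_def)
  \<comment> \<open>The A_t bound controls a product whose first factor is the average of
    \<open>w\<close>. That factor is positive because balls have positive w-measure, so the second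
    factor is finite.\<close>
  have int_fin: "(\<integral>\<^sup>+z\<in>ball x r. enn_powr (ennreal (w z)) (- e) \<partial>M) < top" if r: "0 < r" for x r
  proof -
    have "emeasure N (ball x r) / emeasure M (ball x r) \<noteq> 0"
      using posN[OF r, of x] less_imp_neq[OF finM[of x r]] by simp
    moreover have "emeasure N (ball x r) / emeasure M (ball x r) *
      enn_powr (average M (ball x r) (\<lambda>z. enn_powr (ennreal (w z)) (- e))) (t - 1) < top"
      using C[OF r, of x] by (rule le_less_trans) simp
    ultimately have "enn_powr (average M (ball x r) (\<lambda>z. enn_powr (ennreal (w z)) (- e))) (t - 1) < top"
      unfolding ennreal_mult_less_top by auto
    then have "average M (ball x r) (\<lambda>z. enn_powr (ennreal (w z)) (- e)) < top"
      using t by (simp add: enn_powr_less_top_iff)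
    then show ?thesis
      using nn_integral_average[of M "ball x r"] posM[OF r, of x] finM[of x r]
      by (simp add: ennreal_mult_less_top)
  qed
  \<comment> \<open>Here it matters that \<open>enn_powr\<close> sends 0 to infinity under a
    negative exponent: a finite integral of w^(-e) then excludes zeros of \<open>w\<close> on a set
    of positive measure.\<close>
  have wpos: "AE x in M. 0 < w x"
  proof -
    have "AE x in M. x \<in> ball undefined (real n) \<longrightarrow> 0 < w x" if "0 < n" for n :: nat
    proof -
      have "AE x in M. enn_powr (ennreal (w x)) (- e) * indicator (ball undefined (real n)) x \<noteq> \<infinity>"
      proof (rule nn_integral_PInf_AE)
        have "(\<lambda>x. enn_powr (ennreal (w x)) (- e)) \<in> borel_measurable M" by measurable
        then show "(\<lambda>x. enn_powr (ennreal (w x)) (- e) * indicator (ball undefined (real n)) x) \<in> borel_measurable M"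
          by measurable
      qed (use int_fin[of "real n" undefined] that in auto)
      then show ?thesis
      proof eventually_elim
        case (elim x)
        show ?case
        proof
          assume "x \<in> ball undefined (real n)"
          then have "enn_powr (ennreal (w x)) (- e) \<noteq> top" using elim by simp
          then show "0 < w x" using w0[of x] e(1) by (cases "w x = 0") (auto simp: enn_powr_def)
        qed
      qed
    qed
    then have "AE x in M. \<forall>n::nat. 0 < n \<longrightarrow> x \<in> ball undefined (real n) \<longrightarrow> 0 < w x"
      by (simp add: AE_all_countable)
    then show ?thesis
    proof eventually_elim
      case (elim x)
      obtain n :: nat where "dist undefined x < real n" using reals_Archimedean2 by blast
      moreover from this have "0 < n" using zero_le_dist[of undefined x] by (cases n) (auto simp: not_less)
      ultimately show ?case using elim by simp
    qed
  qed
  \<comment> \<open>Since \<open>w\<close> is positive almost everywhere, the real power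
    \<open>powr\<close> may replace \<open>enn_powr\<close> in the dual weight.\<close>
  define S where "S = density M (\<lambda>x. ennreal (w x powr - e))"
  have Sint: "(\<integral>\<^sup>+x. f x \<partial>S) = (\<integral>\<^sup>+x. ennreal (w x powr - e) * f x \<partial>M)" if "f \<in> borel_measurable M" for f
    unfolding S_def using that by (subst nn_integral_density) auto
  have Nint: "(\<integral>\<^sup>+x. f x \<partial>N) = (\<integral>\<^sup>+x. ennreal (w x) * f x \<partial>M)" if "f \<in> borel_measurable M" for f
    unfolding N_def by (rule nn_integral_wmeasure[OF w that])
  have Sball: "emeasure S (ball x r) = (\<integral>\<^sup>+z\<in>ball x r. enn_powr (ennreal (w z)) (- e) \<partial>M)" for x r
    unfolding S_def using wpos
    by (subst emeasure_density) (auto intro!: nn_integral_cong_AE simp: enn_powr_def)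
  have finS: "emeasure S (ball x r) < top" if "0 < r" for x r using int_fin[OF that] by (simp add: Sball)
  have upper: "(emeasure N (ball x r) / emeasure M (ball x r)) *
      enn_powr (emeasure S (ball x r) / emeasure M (ball x r)) (t - 1) \<le> ennreal C" if "0 < r" for x r
    using C[OF that, of x] by (simp add: average_def Sball)
  \<comment> \<open>Hoelder's inequality applied to 1 = w^(1/t) w^(-1/t). This is a converse to the
    A_t inequality, and the two together make \<open>S\<close> doubling.\<close>
  have lower: "enn_powr (emeasure M (ball x r)) t \<le>
      emeasure N (ball x r) * enn_powr (emeasure S (ball x r)) (t - 1)" for x r
  proof -
    let ?B = "ball x r"
    have "emeasure M ?B = (\<integral>\<^sup>+z. indicator ?B z \<partial>M)" by simp
    also have "\<dots> = (\<integral>\<^sup>+z. ennreal (w z powr (1 / t) * indicator ?B z) * ennreal (w z powr (- (1 / t)) * indicator ?B z) \<partial>M)"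
      using wpos by (intro nn_integral_cong_AE)
        (auto elim!: AE_mp simp: powr_minus simp flip: ennreal_mult split: split_indicator)
    also have "\<dots> \<le> enn_powr (\<integral>\<^sup>+z. enn_powr (ennreal (w z powr (1 / t) * indicator ?B z)) t \<partial>M) (1 / t) *
      enn_powr (\<integral>\<^sup>+z. enn_powr (ennreal (w z powr (- (1 / t)) * indicator ?B z)) (t / (t - 1)) \<partial>M) (1 / (t / (t - 1)))"
      using t by (intro Holder_nn_integral) (auto simp: field_simps)
    also have "(\<integral>\<^sup>+z. enn_powr (ennreal (w z powr (1 / t) * indicator ?B z)) t \<partial>M) = emeasure N ?B"
      unfolding N_def using t w0
      by (subst emeasure_wmeasure[OF w]) (auto intro!: nn_integral_cong simp: enn_powr_ennreal powr_powr split: split_indicator)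
    also have "(\<integral>\<^sup>+z. enn_powr (ennreal (w z powr (- (1 / t)) * indicator ?B z)) (t / (t - 1)) \<partial>M) = emeasure S ?B"
      unfolding S_def using t w0
      by (subst emeasure_density) (auto intro!: nn_integral_cong simp: e_def enn_powr_ennreal powr_powr split: split_indicator)
    finally have "enn_powr (emeasure M ?B) t \<le> enn_powr (enn_powr (emeasure N ?B) (1 / t) * enn_powr (emeasure S ?B) (1 / (t / (t - 1)))) t"
      using t by (intro enn_powr_mono) auto
    also have "\<dots> = emeasure N ?B * enn_powr (emeasure S ?B) (t - 1)"
      using t by (simp add: enn_powr_mult enn_powr_powr)
    finally show ?thesis .
  qed
  have posS: "0 < emeasure S (ball x r)" if "0 < r" for x r
  proof (rule ccontr)
    assume "\<not> 0 < emeasure S (ball x r)"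
    then have "enn_powr (emeasure M (ball x r)) t \<le> 0" using lower[of x r] t by simp
    then show False using posM[OF that, of x] t by (simp add: enn_powr_eq_0_iff)
  qed
  \<comment> \<open>\<open>upper\<close> is used on the doubled ball and \<open>lower\<close> on the
    ball itself. After N(B) is enlarged to N(2B), this common factor is positive and finite and
    cancels.\<close>
  have S: "doubling_measure S"
  proof -
    obtain D :: real where D: "\<And>x r. 0 < r \<Longrightarrow> emeasure M (ball x (2 * r)) \<le> ennreal D * emeasure M (ball x r)"
      using M unfolding doubling_measure_def by blast
    define L where "L = enn_powr (ennreal C * enn_powr (ennreal D) t) e"
    have L: "L < top" using e t by (simp add: L_def enn_powr_less_top_iff ennreal_mult_less_top)
    have "emeasure S (ball x (2 * r)) \<le> L * emeasure S (ball x r)" if r: "0 < r" for x r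
    proof -
      let ?B = "ball x r" and ?B2 = "ball x (2 * r)"
      have r2: "0 < 2 * r" using r by simp
      let ?m = "emeasure M ?B2"
      have m: "?m \<noteq> 0" "?m < top" using posM[OF r2, of x] finM[of x "2 * r"] by auto
      have "emeasure N ?B2 * enn_powr (emeasure S ?B2) (t - 1) =
        (emeasure N ?B2 / ?m * enn_powr (emeasure S ?B2 / ?m) (t - 1)) * enn_powr ?m t"
      proof -
        have p: "enn_powr ?m t = ?m * enn_powr ?m (t - 1)" using enn_powr_add[of 1 "t - 1" ?m] t by simp
        have m': "enn_powr ?m (t - 1) \<noteq> 0" "enn_powr ?m (t - 1) < top"
          using m t by (auto simp: enn_powr_eq_0_iff enn_powr_less_top_iff)
        have "(emeasure N ?B2 / ?m * enn_powr (emeasure S ?B2 / ?m) (t - 1)) * enn_powr ?m t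
          = (emeasure N ?B2 / ?m * ?m) * (enn_powr (emeasure S ?B2) (t - 1) / enn_powr ?m (t - 1) * enn_powr ?m (t - 1))"
          unfolding p enn_powr_divide[of "t - 1", simplified, OF t] by (simp only: mult_ac)
        then show ?thesis using m m' by (simp add: ennreal_divide_times less_top)
      qed
      also have "\<dots> \<le> ennreal C * enn_powr ?m t" by (intro mult_right_mono upper r2) simp
      also have "\<dots> \<le> ennreal C * enn_powr (ennreal D * emeasure M ?B) t"
        using t by (intro mult_left_mono enn_powr_mono D r) auto
      also have "\<dots> = (ennreal C * enn_powr (ennreal D) t) * enn_powr (emeasure M ?B) t"
        using t by (simp add: enn_powr_mult mult.assoc)
      also have "\<dots> \<le> (ennreal C * enn_powr (ennreal D) t) * (emeasure N ?B * enn_powr (emeasure S ?B) (t - 1))"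
        by (intro mult_left_mono lower) simp
      also have "\<dots> \<le> (ennreal C * enn_powr (ennreal D) t) * (emeasure N ?B2 * enn_powr (emeasure S ?B) (t - 1))"
        using r by (intro mult_left_mono mult_right_mono emeasure_mono) (auto simp: N_def)
      finally have "emeasure N ?B2 * enn_powr (emeasure S ?B2) (t - 1) \<le>
         emeasure N ?B2 * ((ennreal C * enn_powr (ennreal D) t) * enn_powr (emeasure S ?B) (t - 1))"
        by (simp add: mult_ac)
      then have "enn_powr (emeasure S ?B2) (t - 1) \<le> (ennreal C * enn_powr (ennreal D) t) * enn_powr (emeasure S ?B) (t - 1)"
        using posN[OF r2, of x] finN[of x "2 * r"] by (subst (asm) ennreal_mult_le_mult_iff) auto
      from enn_powr_mono[OF e(1) this] show ?thesis
        using e t by (simp add: enn_powr_mult enn_powr_powr L_def mult.commute[of _ e])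
    qed
    then have "emeasure S (ball x (2 * r)) \<le> ennreal (enn2real L) * emeasure S (ball x r) \<and> emeasure S (ball x r) < \<infinity>"
      if "0 < r" for x r using that L finS[OF that] by simp
    then show ?thesis unfolding doubling_measure_def by (auto simp: S_def sets)
  qed
  define t' where "t' = t / (t - 1)"
  have t': "1 < t'" "(t - 1) * t' = t" using t by (auto simp: t'_def)
  obtain KN :: ennreal where KN: "KN < top"
    "\<And>h. h \<in> borel_measurable N \<Longrightarrow> (\<integral>\<^sup>+x. enn_powr (maximal N h x) t' \<partial>N) \<le> KN * (\<integral>\<^sup>+x. enn_powr (h x) t' \<partial>N)"
    using maximal_strong_type[OF NN t'(1)] by blast
  obtain KS :: ennreal where KS: "KS < top"
    "\<And>h. h \<in> borel_measurable S \<Longrightarrow> (\<integral>\<^sup>+x. enn_powr (maximal S h x) t \<partial>S) \<le> KS * (\<integral>\<^sup>+x. enn_powr (h x) t \<partial>S)"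
    using maximal_strong_type[OF S t] by blast
  define K where "K = enn_powr (ennreal C) t' * KN * KS"
  note [measurable] = borel_measurable_maximal[OF M]
  have mN: "f \<in> borel_measurable N \<longleftrightarrow> f \<in> borel_measurable M" for f :: "'a \<Rightarrow> ennreal"
    by (simp add: N_def wmeasure_def)
  have mS: "f \<in> borel_measurable S \<longleftrightarrow> f \<in> borel_measurable M" for f :: "'a \<Rightarrow> ennreal"
    by (simp add: S_def)
  have "(\<integral>\<^sup>+x. enn_powr (maximal M h x) t \<partial>N) \<le> K * (\<integral>\<^sup>+x. enn_powr (h x) t \<partial>N)"
    if h[measurable]: "h \<in> borel_measurable M" for h
  proof -
    \<comment> \<open>This is h/\<sigma>, so that integrals of \<open>h\<close> against
      \<open>M\<close> become integrals of \<open>k\<close> against \<open>S\<close>.\<close>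
    define k where "k x = h x * ennreal (w x powr e)" for x
    have k[measurable]: "k \<in> borel_measurable M" unfolding k_def by measurable
    define g where "g = maximal S k"
    have g[measurable]: "g \<in> borel_measurable M" unfolding g_def by measurable
    \<comment> \<open>Dividing by \<open>w\<close> turns integrals of g^(t-1) against
      \<open>M\<close> into integrals of \<open>m\<close> against \<open>N\<close>. Raising to the
      power t' later gives back g^t times \<sigma>, because w (1/w)^t' = w^(-e).\<close>
    define m where "m x = enn_powr (g x) (t - 1) * ennreal (1 / w x)" for x
    have m[measurable]: "m \<in> borel_measurable M" unfolding m_def by measurable
    have "maximal M h y \<le> enn_powr (ennreal C * maximal N m y) e" for y
    proof (rule maximal_leI)
      fix x and r :: real assume r: "0 < r" "y \<in> ball x r"
      let ?B = "ball x r"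
      let ?X = "average S ?B k" and ?Y = "maximal N m y"
      note ne = posM[OF r(1), of x] posN[OF r(1), of x] posS[OF r(1), of x]
        finM[of x r] finN[of x r] finS[OF r(1), of x]
      have "(\<integral>\<^sup>+z\<in>?B. h z \<partial>M) = (\<integral>\<^sup>+z\<in>?B. k z \<partial>S)"
        using wpos by (subst Sint) (auto intro!: nn_integral_cong_AE elim!: AE_mp
          simp: k_def powr_minus mult_ac simp flip: ennreal_mult split: split_indicator)
      also have "\<dots> = ?X * emeasure S ?B" using ne by (intro nn_integral_average) auto
      finally have avg: "average M ?B h = ?X * (emeasure S ?B / emeasure M ?B)"
        by (simp add: average_def ennreal_times_divide)
      \<comment> \<open>The S-average of \<open>k\<close> over the ball is at most \<open>g\<close>
        at every point of the ball, so its power can be averaged over the ball once more.\<close>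
      have "enn_powr ?X (t - 1) * emeasure M ?B = (\<integral>\<^sup>+z\<in>?B. enn_powr ?X (t - 1) \<partial>M)"
        by (simp add: nn_integral_cmult_indicator)
      also have "\<dots> \<le> (\<integral>\<^sup>+z\<in>?B. enn_powr (g z) (t - 1) \<partial>M)"
        using t r(1) by (intro nn_integral_mono)
          (auto simp: g_def split: split_indicator intro!: enn_powr_mono average_le_maximal)
      also have "\<dots> = (\<integral>\<^sup>+z\<in>?B. m z \<partial>N)"
      proof (subst Nint)
        show "(\<lambda>z. m z * indicator ?B z) \<in> borel_measurable M" by measurable
        show "(\<integral>\<^sup>+z\<in>?B. enn_powr (g z) (t - 1) \<partial>M) = (\<integral>\<^sup>+z. ennreal (w z) * (m z * indicator ?B z) \<partial>M)"
        proof (rule nn_integral_cong_AE, use wpos in eventually_elim)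
          case (elim z)
          then have "ennreal (w z) * ennreal (1 / w z) = 1" by (simp flip: ennreal_mult)
          then show ?case by (simp add: m_def mult_ac) (metis mult.left_commute mult.right_neutral)
        qed
      qed
      also have "\<dots> = average N ?B m * emeasure N ?B" using ne by (intro nn_integral_average) auto
      also have "\<dots> \<le> ?Y * emeasure N ?B" using r by (intro mult_right_mono average_le_maximal) auto
      finally have "enn_powr ?X (t - 1) * emeasure M ?B / emeasure M ?B \<le> ?Y * emeasure N ?B / emeasure M ?B"
        by (rule divide_right_mono_ennreal)
      then have X: "enn_powr ?X (t - 1) \<le> ?Y * (emeasure N ?B / emeasure M ?B)"
        using ne by (simp add: ennreal_mult_divide_eq less_top ennreal_times_divide)
      have "enn_powr (average M ?B h) (t - 1) = enn_powr ?X (t - 1) * enn_powr (emeasure S ?B / emeasure M ?B) (t - 1)"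
        unfolding avg using t by (simp add: enn_powr_mult)
      also have "\<dots> \<le> ?Y * (emeasure N ?B / emeasure M ?B) * enn_powr (emeasure S ?B / emeasure M ?B) (t - 1)"
        by (intro mult_right_mono X) simp
      also have "\<dots> \<le> ?Y * ennreal C"
        unfolding mult.assoc by (intro mult_left_mono upper r(1)) simp
      finally have "enn_powr (enn_powr (average M ?B h) (t - 1)) e \<le> enn_powr (?Y * ennreal C) e"
        using e by (intro enn_powr_mono) auto
      then show "average M ?B h \<le> enn_powr (ennreal C * ?Y) e"
        using e t by (simp add: enn_powr_powr mult.commute)
    qed
    then have "(\<integral>\<^sup>+x. enn_powr (maximal M h x) t \<partial>N) \<le> (\<integral>\<^sup>+x. enn_powr (enn_powr (ennreal C * maximal N m x) e) t \<partial>N)"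
      using t by (intro nn_integral_mono enn_powr_mono) auto
    also have "\<dots> = (\<integral>\<^sup>+x. enn_powr (ennreal C) t' * enn_powr (maximal N m x) t' \<partial>N)"
      using e t t' by (intro nn_integral_cong) (simp add: enn_powr_powr enn_powr_mult, simp add: e_def t'_def)
    also have "\<dots> = enn_powr (ennreal C) t' * (\<integral>\<^sup>+x. enn_powr (maximal N m x) t' \<partial>N)"
      by (rule nn_integral_cmult) (simp add: mN)
    also have "\<dots> \<le> enn_powr (ennreal C) t' * (KN * (\<integral>\<^sup>+x. enn_powr (m x) t' \<partial>N))"
      by (intro mult_left_mono KN) (auto simp: mN)
    also have "(\<integral>\<^sup>+x. enn_powr (m x) t' \<partial>N) = (\<integral>\<^sup>+x. enn_powr (g x) t \<partial>S)"
    proof (subst Nint, measurable, subst Sint, measurable)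
      show "(\<integral>\<^sup>+x. ennreal (w x) * enn_powr (m x) t' \<partial>M) = (\<integral>\<^sup>+x. ennreal (w x powr - e) * enn_powr (g x) t \<partial>M)"
      proof (rule nn_integral_cong_AE, use wpos in eventually_elim)
        case (elim x)
        have "t' = e + 1" using t by (simp add: t'_def e_def field_simps)
        then have "w x * (1 / w x) powr t' = w x powr - e"
          using elim by (simp add: powr_divide powr_add powr_minus field_simps)
        then have "ennreal (w x) * enn_powr (ennreal (1 / w x)) t' = ennreal (w x powr - e)"
          using elim t' by (simp add: enn_powr_ennreal flip: ennreal_mult)
        moreover have "enn_powr (enn_powr (g x) (t - 1)) t' = enn_powr (g x) t"
          using t t' by (simp add: enn_powr_powr)
        ultimately show ?case
          using t' by (simp add: m_def enn_powr_mult mult_ac) (metis mult.commute mult.left_commute)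
      qed
    qed
    also have "\<dots> \<le> KS * (\<integral>\<^sup>+x. enn_powr (k x) t \<partial>S)"
      unfolding g_def by (intro KS) (simp add: mS)
    also have "(\<integral>\<^sup>+x. enn_powr (k x) t \<partial>S) = (\<integral>\<^sup>+x. enn_powr (h x) t \<partial>N)"
    proof (subst Nint, measurable, subst Sint, measurable)
      show "(\<integral>\<^sup>+x. ennreal (w x powr - e) * enn_powr (k x) t \<partial>M) = (\<integral>\<^sup>+x. ennreal (w x) * enn_powr (h x) t \<partial>M)"
      proof (rule nn_integral_cong_AE, use wpos in eventually_elim)
        case (elim x)
        have "e * t - e = 1" using e by (simp add: algebra_simps)
        then have "w x powr - e * (w x powr e) powr t = w x"
          using elim by (simp add: powr_powr flip: powr_add)
        then have "ennreal (w x powr - e) * enn_powr (ennreal (w x powr e)) t = ennreal (w x)"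
          using elim t by (simp add: enn_powr_ennreal flip: ennreal_mult)
        then show ?case
          using t by (simp add: k_def enn_powr_mult mult_ac)
      qed
    qed
    finally show ?thesis by (simp add: K_def mult_left_mono mult.assoc)
  qed
  moreover have "K < top" using KN KS t' by (simp add: K_def ennreal_mult_less_top enn_powr_less_top_iff)
  ultimately show ?thesis by (intro that) (auto simp: N_def)
qed

section \<open>Reverse Hoelder classes\<close>

text \<open>Normalisation is compatible with Hoelder's inequality because 1/p + 1/p' = 1 splits the
  mass of the ball between the two factors.\<close>

lemma Holder_average:
  assumes p: "1 < p" "1 / p + 1 / p' = 1"
    and B[measurable]: "B \<in> sets M" "emeasure M B \<noteq> 0" "emeasure M B < top"
    and [measurable]: "f \<in> borel_measurable M" "g \<in> borel_measurable M"
  shows "average M B (\<lambda>x. f x * g x) \<le>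
    enn_powr (average M B (\<lambda>x. enn_powr (f x) p)) (1 / p) * enn_powr (average M B (\<lambda>x. enn_powr (g x) p')) (1 / p')"
proof -
  have p': "0 < p'" using conjugate_gt_1[OF p] by simp
  let ?m = "emeasure M B"
  let ?F = "\<integral>\<^sup>+x\<in>B. enn_powr (f x) p \<partial>M" and ?G = "\<integral>\<^sup>+x\<in>B. enn_powr (g x) p' \<partial>M"
  have m: "?m = enn_powr ?m (1 / p) * enn_powr ?m (1 / p')"
    using p p' by (simp flip: enn_powr_add)
  have mt: "enn_powr ?m (1 / p) < top" "enn_powr ?m (1 / p') < top"
    using p p' B by (auto simp: enn_powr_less_top_iff)
  have "(\<integral>\<^sup>+x\<in>B. f x * g x \<partial>M) = (\<integral>\<^sup>+x. (f x * indicator B x) * (g x * indicator B x) \<partial>M)"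
    by (intro nn_integral_cong) (auto split: split_indicator)
  also have "\<dots> \<le> enn_powr (\<integral>\<^sup>+x. enn_powr (f x * indicator B x) p \<partial>M) (1 / p) *
      enn_powr (\<integral>\<^sup>+x. enn_powr (g x * indicator B x) p' \<partial>M) (1 / p')"
    by (rule Holder_nn_integral[OF p]) auto
  also have "\<dots> = enn_powr ?F (1 / p) * enn_powr ?G (1 / p')"
    using p p' by (simp add: enn_powr_indicator)
  finally have "average M B (\<lambda>x. f x * g x) \<le> enn_powr ?F (1 / p) * enn_powr ?G (1 / p') / ?m"
    unfolding average_def by (rule divide_right_mono_ennreal)
  also have "\<dots> = (enn_powr ?F (1 / p) / enn_powr ?m (1 / p)) * (enn_powr ?G (1 / p') / enn_powr ?m (1 / p'))"
    by (subst m) (simp add: divide_ennreal_def ennreal_inverse_mult mt mult_ac)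
  also have "\<dots> = enn_powr (?F / ?m) (1 / p) * enn_powr (?G / ?m) (1 / p')"
    using p p' by (simp add: enn_powr_divide)
  finally show ?thesis by (simp add: average_def)
qed

lemma average_mono_AE:
  assumes "AE x in M. x \<in> B \<longrightarrow> f x \<le> g x"
  shows "average M B f \<le> average M B g"
  unfolding average_def
proof (intro divide_right_mono_ennreal nn_integral_mono_AE)
  show "AE x in M. f x * indicator B x \<le> g x * indicator B x"
    using assms by eventually_elim (simp split: split_indicator)
qed

lemma average_const:
  assumes "B \<in> sets M" "emeasure M B \<noteq> 0" "emeasure M B < top"
  shows "average M B (\<lambda>x. c) = c"
  using assms by (simp add: average_def nn_integral_cmult_indicator ennreal_mult_divide_eq)

text \<open>Hoelder's inequality against the constant 1, with exponent b/a.\<close>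

lemma average_power_mean:
  assumes ab: "0 < a" "a \<le> b"
    and B: "B \<in> sets M" "emeasure M B \<noteq> 0" "emeasure M B < top"
    and [measurable]: "f \<in> borel_measurable M"
  shows "enn_powr (average M B (\<lambda>x. enn_powr (f x) a)) (1 / a) \<le>
    enn_powr (average M B (\<lambda>x. enn_powr (f x) b)) (1 / b)"
proof (cases "a = b")
  case False
  then have "a < b" using ab by simp
  then have p: "1 < b / a" "1 / (b / a) + 1 / (b / (b - a)) = 1" "0 < b / (b - a)"
    using ab by (auto simp: field_simps)
  have "average M B (\<lambda>x. enn_powr (f x) a) = average M B (\<lambda>x. enn_powr (f x) a * 1)" by simp
  also have "\<dots> \<le> enn_powr (average M B (\<lambda>x. enn_powr (enn_powr (f x) a) (b / a))) (1 / (b / a)) *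
     enn_powr (average M B (\<lambda>x. enn_powr 1 (b / (b - a)))) (1 / (b / (b - a)))"
    by (rule Holder_average[OF p(1,2) B]) auto
  also have "\<dots> = enn_powr (average M B (\<lambda>x. enn_powr (f x) b)) (a / b)"
    using p ab \<open>a < b\<close> by (simp add: enn_powr_powr average_const[OF B])
  finally have "enn_powr (average M B (\<lambda>x. enn_powr (f x) a)) (1 / a) \<le>
      enn_powr (enn_powr (average M B (\<lambda>x. enn_powr (f x) b)) (a / b)) (1 / a)"
    using ab by (intro enn_powr_mono) auto
  then show ?thesis using ab by (simp add: enn_powr_powr)
qed simp

text \<open>Power means over a ball increase with the exponent; for \<open>s = top\<close> the
  essential bound is averaged instead.\<close>

lemma RH_class_mono:
  assumes w: "w \<in> RH_class M s" and s: "1 \<le> s'" "s' \<le> s"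
    and balls: "\<And>x r. 0 < r \<Longrightarrow> ball x r \<in> sets M" "\<And>x r. 0 < r \<Longrightarrow> 0 < emeasure M (ball x r)"
      "\<And>x r. emeasure M (ball x r) < top"
  shows "w \<in> RH_class M s'"
proof (cases "s' = top")
  case True
  then show ?thesis using w s by (simp add: top_unique)
next
  case False
  then obtain a where a: "s' = ennreal a" "0 \<le> a" by (cases s') auto
  then have a1: "1 \<le> a" using s by simp
  have wt: "weight M w" using w by (simp add: RH_class_def)
  note [measurable] = weight_measurable[OF wt]
  have w0: "0 \<le> w x" for x using wt by (simp add: weight_def)
  have "\<exists>C::real. \<forall>x r. 0 < r \<longrightarrow>
         enn_powr (average M (ball x r) (\<lambda>z. enn_powr (ennreal (w z)) a)) (1 / a)
           \<le> ennreal C * average M (ball x r) (\<lambda>z. ennreal (w z))"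
  proof (cases "s = top")
    case True
    then obtain C :: real where C: "\<And>x r. 0 < r \<Longrightarrow> AE y in M. y \<in> ball x r \<longrightarrow>
            ennreal (w y) \<le> ennreal C * average M (ball x r) (\<lambda>z. ennreal (w z))"
      using w by (auto simp: RH_class_def)
    have "enn_powr (average M (ball x r) (\<lambda>z. enn_powr (ennreal (w z)) a)) (1 / a)
           \<le> ennreal C * average M (ball x r) (\<lambda>z. ennreal (w z))" if r: "0 < r" for x r
    proof -
      let ?c = "ennreal C * average M (ball x r) (\<lambda>z. ennreal (w z))"
      have "average M (ball x r) (\<lambda>z. enn_powr (ennreal (w z)) a) \<le> average M (ball x r) (\<lambda>z. enn_powr ?c a)"
      proof (rule average_mono_AE)
        show "AE y in M. y \<in> ball x r \<longrightarrow> enn_powr (ennreal (w y)) a \<le> enn_powr ?c a"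
          using C[OF r, of x] by eventually_elim (use a1 in \<open>auto intro!: enn_powr_mono\<close>)
      qed
      also have "\<dots> = enn_powr ?c a"
        using balls(1,2)[OF r, of x] balls(3) by (intro average_const) auto
      finally have "enn_powr (average M (ball x r) (\<lambda>z. enn_powr (ennreal (w z)) a)) (1 / a) \<le> enn_powr (enn_powr ?c a) (1 / a)"
        using a1 by (intro enn_powr_mono) auto
      then show ?thesis using a1 by simp
    qed
    then show ?thesis by blast
  next
    case False
    then obtain b where b: "s = ennreal b" "0 \<le> b" by (cases s) auto
    then have ab: "a \<le> b" using s a by simp
    obtain C :: real where C: "\<And>x r. 0 < r \<Longrightarrow>
         enn_powr (average M (ball x r) (\<lambda>z. enn_powr (ennreal (w z)) b)) (1 / b)
           \<le> ennreal C * average M (ball x r) (\<lambda>z. ennreal (w z))"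
      using w b by (auto simp: RH_class_def)
    have "enn_powr (average M (ball x r) (\<lambda>z. enn_powr (ennreal (w z)) a)) (1 / a)
           \<le> ennreal C * average M (ball x r) (\<lambda>z. ennreal (w z))" if r: "0 < r" for x r
    proof -
      have "enn_powr (average M (ball x r) (\<lambda>z. enn_powr (ennreal (w z)) a)) (1 / a)
        \<le> enn_powr (average M (ball x r) (\<lambda>z. enn_powr (ennreal (w z)) b)) (1 / b)"
        using balls(1,2)[OF r, of x] balls(3) a1 ab by (intro average_power_mean) auto
      also note C[OF r]
      finally show ?thesis .
    qed
    then show ?thesis by blast
  qed
  then show ?thesis using wt s a False by (simp add: RH_class_def)
qed

section \<open>Conjugate exponents and the reverse Hoelder class attached to \<beta>\<close>

lemma conj_exponent_ennreal:
  assumes "1 < a"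
  shows "conj_exponent (ennreal a) = ennreal (a / (a - 1))"
proof -
  have "1 - inverse (ennreal a) = ennreal 1 - ennreal (1 / a)"
    using assms by (simp add: inverse_ennreal inverse_eq_divide)
  also have "\<dots> = ennreal (1 - 1 / a)"
    using assms by (intro ennreal_minus) simp
  finally have "1 - inverse (ennreal a) = ennreal (1 - 1 / a)" .
  moreover have "inverse (1 - 1 / a) = a / (a - 1)" "0 < 1 - 1 / a" using assms by (auto simp: field_simps)
  ultimately show ?thesis by (simp add: conj_exponent_def inverse_ennreal)
qed

lemma conj_exponent_top [simp]: "conj_exponent top = 1"
  by (simp add: conj_exponent_def)

lemma ennreal_inverse_less: "x < y \<Longrightarrow> inverse y < inverse (x::ennreal)"
proof (cases x; cases y)
  fix r s :: real assume "x < y" "0 \<le> r" "x = ennreal r" "0 \<le> s" "y = ennreal s"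
  then show ?thesis
    by (cases "r = 0") (auto simp: ennreal_less_iff inverse_ennreal less_top[symmetric])
qed (auto simp: ennreal_inverse_positive)

lemma ennreal_inverse_le: "x \<le> y \<Longrightarrow> inverse y \<le> inverse (x::ennreal)"
  using ennreal_inverse_less[of x y] by (auto simp: le_less)

lemma one_le_conj_exponent: "1 \<le> conj_exponent p"
proof -
  have "1 - inverse p \<le> 1" by simp
  from ennreal_inverse_le[OF this] show ?thesis by (simp add: conj_exponent_def)
qed

text \<open>The condition amounts to 1/\<beta> + 1/s_w < 1, which is symmetric in the two exponents.
  Solved the other way it says \<beta>' < s_w, so the set under the supremum has a member above
  \<beta>'. Working with reciprocals covers infinite values.\<close>

lemma RH_class_conj_exponent:
  assumes lt: "conj_exponent (RH_sup M w) < \<beta>"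
    and balls: "\<And>x r. 0 < r \<Longrightarrow> ball x r \<in> sets M" "\<And>x r. 0 < r \<Longrightarrow> 0 < emeasure M (ball x r)"
      "\<And>x r. emeasure M (ball x r) < top"
  shows "w \<in> RH_class M (conj_exponent \<beta>)" "1 < \<beta>"
proof -
  show \<beta>: "1 < \<beta>" using one_le_conj_exponent lt by (rule le_less_trans)
  let ?S = "RH_sup M w"
  have [simp]: "inverse (inverse x) = x" for x :: ennreal
    using one_divide_one_divide_ennreal[of x] by (simp add: divide_ennreal_def)
  have "inverse \<beta> < 1 - inverse ?S"
    using ennreal_inverse_less[OF lt] by (simp add: conj_exponent_def)
  then have "inverse \<beta> + inverse ?S < 1" by (subst (asm) less_diff_eq_ennreal) auto
  then have "inverse ?S < 1 - inverse \<beta>" by (subst less_diff_eq_ennreal) (auto simp: add.commute)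
  then have "conj_exponent \<beta> < ?S"
    using ennreal_inverse_less[of "inverse ?S" "1 - inverse \<beta>"] by (simp add: conj_exponent_def)
  then obtain s where s: "w \<in> RH_class M s" "conj_exponent \<beta> < s"
    unfolding RH_sup_def less_Sup_iff by auto
  show "w \<in> RH_class M (conj_exponent \<beta>)"
    by (rule RH_class_mono[OF s(1) one_le_conj_exponent less_imp_le[OF s(2)] balls])
qed

text \<open>Hoelder's inequality for |h|^k times w, with exponents s/k and its conjugate; the
  reverse Hoelder class then returns the mean of w. It trades unweighted L^s averages for weighted
  integrals of k-th powers. For infinite s the essential bound carries over to the weighted measure
  by absolute continuity.\<close>

lemma RH_Holder:
  assumes w: "w \<in> RH_class M (conj_exponent (s / ennreal k))" and k: "1 \<le> k" "ennreal k < s"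
    and balls: "\<And>x r. 0 < r \<Longrightarrow> ball x r \<in> sets M" "\<And>x r. 0 < r \<Longrightarrow> 0 < emeasure M (ball x r)"
      "\<And>x r. emeasure M (ball x r) < top"
  obtains K :: ennreal where "K < top"
    "\<And>x r E h. 0 < r \<Longrightarrow> E \<in> sets M \<Longrightarrow> E \<subseteq> ball x r \<Longrightarrow> h \<in> borel_measurable M \<Longrightarrow>
      (\<integral>\<^sup>+y\<in>E. norm_powr (h y) k \<partial>wmeasure M w) \<le>
        K * emeasure (wmeasure M w) (ball x r) * enn_powr (Lp_average s M (ball x r) E h) k"
proof -
  have wt: "weight M w" using w by (simp add: RH_class_def)
  note [measurable] = weight_measurable[OF wt]
  have w0: "0 \<le> w x" for x using wt by (simp add: weight_def)
  show thesis
  proof (cases "s = top")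
    case True
    show thesis
    proof (rule that[of 1])
      fix x and r :: real and E and h :: "'a \<Rightarrow> complex"
      assume r: "0 < r" and E[measurable]: "E \<in> sets M" and EB: "E \<subseteq> ball x r" and h[measurable]: "h \<in> borel_measurable M"
      have [measurable]: "ball x r \<in> sets M" by (rule balls) fact
      let ?L = "Lp_average s M (ball x r) E h"
      have "AE y in M. ennreal (norm (h y)) * indicator E y \<le> ?L"
        using esssup_AE[of "\<lambda>y. ennreal (norm (h y)) * indicator E y" M] True by (simp add: Lp_average_def)
      then have "AE y in wmeasure M w. ennreal (norm (h y)) * indicator E y \<le> ?L"
        by (rule AE_wmeasure[OF wt])
      then have "(\<integral>\<^sup>+y\<in>E. norm_powr (h y) k \<partial>wmeasure M w) \<le>
          (\<integral>\<^sup>+y. enn_powr ?L k * indicator (ball x r) y \<partial>wmeasure M w)"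
      proof (intro nn_integral_mono_AE, eventually_elim)
        case (elim y)
        then show ?case
          using k subsetD[OF EB, of y] by (cases "y \<in> E") (auto intro!: enn_powr_mono)
      qed
      also have "\<dots> = enn_powr ?L k * emeasure (wmeasure M w) (ball x r)"
        by (rule nn_integral_cmult_indicator) simp
      finally show "(\<integral>\<^sup>+y\<in>E. norm_powr (h y) k \<partial>wmeasure M w) \<le>
        1 * emeasure (wmeasure M w) (ball x r) * enn_powr ?L k" by (simp add: mult.commute)
    qed simp
  next
    case False
    then obtain s' where s: "s = ennreal s'" "0 \<le> s'" by (cases s) auto
    define a where "a = s' / k"
    have ks: "k < s'" using k s by (simp add: ennreal_less_iff)
    have a: "1 < a" "s' = k * a" using k ks by (auto simp: a_def)
    define a' where "a' = a / (a - 1)"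
    have a': "1 < a'" "1 / a + 1 / a' = 1" using a(1) by (auto simp: a'_def field_simps)
    have "conj_exponent (s / ennreal k) = ennreal a'"
      using k s conj_exponent_ennreal[OF a(1)] by (simp add: a'_def a_def divide_ennreal)
    then obtain C :: real where C: "\<And>x r. 0 < r \<Longrightarrow>
         enn_powr (average M (ball x r) (\<lambda>z. enn_powr (ennreal (w z)) a')) (1 / a')
           \<le> ennreal C * average M (ball x r) (\<lambda>z. ennreal (w z))"
      using w a' by (auto simp: RH_class_def)
    show thesis
    proof (rule that[of "ennreal C"])
      fix x and r :: real and E and h :: "'a \<Rightarrow> complex"
      assume r: "0 < r" and E[measurable]: "E \<in> sets M" and EB: "E \<subseteq> ball x r" and h[measurable]: "h \<in> borel_measurable M"
      let ?B = "ball x r"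
      have B[measurable]: "?B \<in> sets M" by (rule balls) fact
      have m: "emeasure M ?B \<noteq> 0" "emeasure M ?B < top" using balls(2)[OF r, of x] balls(3) by auto
      let ?N = "emeasure (wmeasure M w) ?B"
      let ?f = "\<lambda>y. norm_powr (h y) k * indicator E y"
      have P: "enn_powr (average M ?B (\<lambda>y. enn_powr (?f y) a)) (1 / a) = enn_powr (Lp_average s M ?B E h) k"
      proof -
        have "(\<integral>\<^sup>+y\<in>?B. enn_powr (?f y) a \<partial>M) = (\<integral>\<^sup>+y\<in>E. norm_powr (h y) s' \<partial>M)"
          using EB k a by (intro nn_integral_cong) (auto simp: enn_powr_powr split: split_indicator)
        moreover have "k / s' = 1 / a" using k a by auto
        ultimately show ?thesis
          using s k a False by (simp add: Lp_average_def average_def enn_powr_powr)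
      qed
      have "(\<integral>\<^sup>+y\<in>E. norm_powr (h y) k \<partial>wmeasure M w) = (\<integral>\<^sup>+y\<in>?B. ?f y * ennreal (w y) \<partial>M)"
        using EB by (subst nn_integral_wmeasure[OF wt]) (auto intro!: nn_integral_cong simp: mult_ac split: split_indicator)
      also have "\<dots> = average M ?B (\<lambda>y. ?f y * ennreal (w y)) * emeasure M ?B"
        using m by (rule nn_integral_average)
      also have "\<dots> \<le> enn_powr (average M ?B (\<lambda>y. enn_powr (?f y) a)) (1 / a) *
          enn_powr (average M ?B (\<lambda>y. enn_powr (ennreal (w y)) a')) (1 / a') * emeasure M ?B"
        by (intro mult_right_mono Holder_average a a' m B) auto
      also have "\<dots> \<le> enn_powr (Lp_average s M ?B E h) k * (ennreal C * average M ?B (\<lambda>z. ennreal (w z))) * emeasure M ?B"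
        unfolding P by (intro mult_right_mono mult_left_mono C r) auto
      also have "\<dots> = ennreal C * (average M ?B (\<lambda>z. ennreal (w z)) * emeasure M ?B) * enn_powr (Lp_average s M ?B E h) k"
        by (simp add: mult_ac)
      also have "average M ?B (\<lambda>z. ennreal (w z)) * emeasure M ?B = ?N"
        using m by (simp add: average_weight[OF wt B] ennreal_divide_times less_top)
      finally show "(\<integral>\<^sup>+y\<in>E. norm_powr (h y) k \<partial>wmeasure M w) \<le>
        ennreal C * ?N * enn_powr (Lp_average s M ?B E h) k" .
    qed simp
  qed
qed

section \<open>Sums of functions with off-diagonal decay\<close>

lemma annulus_subset: "1 \<le> j \<Longrightarrow> 0 < r \<Longrightarrow> annulus j x r \<subseteq> ball x (2 ^ (j + 1) * r)"
  by (auto simp: annulus_def)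

lemma annulus_borel [measurable, simp]: "annulus j x r \<in> sets borel"
  by (auto simp: annulus_def)

text \<open>C_1 is the whole ball 4B. A point outside it lies in C_(k-1), where k is least with
  distance below 2^k r; this k is at least 3.\<close>

lemma annuli_cover_outside:
  assumes "0 < r"
  shows "- ball x (4 * r) \<subseteq> (\<Union>j. annulus (j + 2) x r)"
proof
  fix y assume y: "y \<in> - ball x (4 * r)"
  obtain n where "dist x y / r < 2 ^ n" using real_arch_pow[of 2 "dist x y / r"] by auto
  then have n: "dist x y < 2 ^ n * r" using assms by (simp add: field_simps)
  define k where "k = (LEAST n. dist x y < 2 ^ n * r)"
  have k: "dist x y < 2 ^ k * r" unfolding k_def by (rule LeastI) (rule n)
  have k2: "2 < k"
  proof (rule ccontr)
    assume "\<not> 2 < k"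
    then have "(2::real) ^ k \<le> 2 ^ 2" by (intro power_increasing) auto
    then have "2 ^ k * r \<le> 4 * r" using assms by (intro mult_right_mono) auto
    then show False using k y by simp
  qed
  have "\<not> dist x y < 2 ^ (k - 1) * r"
    unfolding k_def by (rule not_less_Least) (use k2 in \<open>simp add: k_def\<close>)
  then have "y \<in> annulus (k - 1) x r" using k k2 by (auto simp: annulus_def)
  moreover have "k - 1 = (k - 3) + 2" using k2 by simp
  ultimately show "y \<in> (\<Union>j. annulus (j + 2) x r)" by (metis UN_I UNIV_I)
qed

lemma annuli_cover:
  assumes "0 < r"
  shows "(\<Union>j. annulus (j + 1) x r) = UNIV"
proof -
  have "y \<in> (\<Union>j. annulus (j + 1) x r)" for y
  proof (cases "y \<in> ball x (4 * r)")
    case True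
    then have "y \<in> annulus (0 + 1) x r" by (simp add: annulus_def)
    then show ?thesis by blast
  next
    case False
    then obtain j where "y \<in> annulus (j + 2) x r" using annuli_cover_outside[OF assms, of x] by blast
    then have "y \<in> annulus (Suc j + 1) x r" by simp
    then show ?thesis by blast
  qed
  then show ?thesis by blast
qed

lemma nn_integral_countable_cover_le:
  fixes A :: "nat \<Rightarrow> 'a set"
  assumes "\<And>j. A j \<in> sets N" "E \<in> sets N" "E \<subseteq> (\<Union>j. A j)" and [measurable]: "f \<in> borel_measurable N"
  shows "(\<integral>\<^sup>+x\<in>E. f x \<partial>N) \<le> (\<Sum>j. \<integral>\<^sup>+x\<in>A j. f x \<partial>N)"
proof -
  have "(\<integral>\<^sup>+x\<in>E. f x \<partial>N) = emeasure (density N f) E"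
    using assms by (simp add: emeasure_density)
  also have "\<dots> \<le> emeasure (density N f) (\<Union>j. A j)"
    using assms by (intro emeasure_mono) auto
  also have "\<dots> \<le> (\<Sum>j. emeasure (density N f) (A j))"
    using assms by (intro emeasure_subadditive_countably) auto
  also have "\<dots> = (\<Sum>j. \<integral>\<^sup>+x\<in>A j. f x \<partial>N)"
    using assms by (simp add: emeasure_density)
  finally show ?thesis .
qed

text \<open>The coefficients are known to be nonnegative only from index \<open>k\<close> on (1 for
  (b), 2 for (c)), hence the shift.\<close>

lemma suminf_less_top_shift:
  fixes b :: "nat \<Rightarrow> real"
  assumes "summable b" "\<And>j. k \<le> j \<Longrightarrow> 0 \<le> b j"
  shows "(\<Sum>j. ennreal (b (j + k))) < top"
proof -
  have "(\<Sum>j. ennreal (b (j + k))) \<noteq> top"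
    by (rule ennreal_suminf_neq_top) (use assms in \<open>auto simp: summable_iff_shift\<close>)
  then show ?thesis by (simp add: less_top)
qed

text \<open>The comparison is with a third of the ball because only the thirds will be disjoint.
  Since 2^(j+1) r = (6 * 2^j)(r/3), the factor 6^D goes into the constant.\<close>

lemma doubling_order_dilation:
  assumes "doubling_order M w D"
  obtains C :: ennreal where "C < top" "\<And>x r j. 0 < r \<Longrightarrow>
    emeasure (wmeasure M w) (ball x (2 ^ (j + 1) * r)) \<le>
      C * ennreal (2 powr (D * real j)) * emeasure (wmeasure M w) (ball x (r / 3))"
proof -
  obtain C :: real where C: "\<And>x r l. 0 < r \<Longrightarrow> 1 \<le> l \<Longrightarrow> emeasure (wmeasure M w) (ball x (l * r))
         \<le> ennreal (C * l powr D) * emeasure (wmeasure M w) (ball x r)"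
    using assms unfolding doubling_order_def by blast
  have "emeasure (wmeasure M w) (ball x (2 ^ (j + 1) * r)) \<le>
      ennreal (C * 6 powr D) * ennreal (2 powr (D * real j)) * emeasure (wmeasure M w) (ball x (r / 3))"
    if r: "0 < r" for x r j
  proof -
    have "(1::real) \<le> 2 ^ j" by (rule one_le_power) simp
    then have one: "(1::real) \<le> 6 * 2 ^ j" by linarith
    have "((6 * 2 ^ j) powr D :: real) = 6 powr D * 2 powr (D * real j)"
      by (simp add: powr_mult powr_powr mult.commute flip: powr_realpow)
    then have const: "ennreal (C * (6 * 2 ^ j) powr D) = ennreal (C * 6 powr D) * ennreal (2 powr (D * real j))"
      by (subst ennreal_mult''[symmetric]) (auto simp: mult.assoc)
    have "2 ^ (j + 1) * r = (6 * 2 ^ j) * (r / 3)" by simp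
    then have "emeasure (wmeasure M w) (ball x (2 ^ (j + 1) * r)) =
        emeasure (wmeasure M w) (ball x ((6 * 2 ^ j) * (r / 3)))" by (simp only:)
    also have "\<dots> \<le> ennreal (C * (6 * 2 ^ j) powr D) * emeasure (wmeasure M w) (ball x (r / 3))"
      by (rule C[OF _ one]) (use r in simp)
    finally show ?thesis unfolding const .
  qed
  then show ?thesis by (intro that[of "ennreal (C * 6 powr D)"]) auto
qed

section \<open>Separated families of balls and sums with off-diagonal decay\<close>

abbreviation core :: "'a::metric_space \<times> real \<Rightarrow> 'a set" where
  "core i \<equiv> ball (fst i) (snd i / 3)"

text \<open>Vitali's lemma leaves disjointness only before tripling, so disjointness and containment
  in \<open>E\<close> are demanded of the thirds. Their total mass is then at most that of
  \<open>E\<close>, while the balls themselves may overlap and leave \<open>E\<close>.\<close>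

definition separated_balls :: "'a::metric_space set \<Rightarrow> ('a \<times> real) set \<Rightarrow> bool" where
  "separated_balls E J \<longleftrightarrow> finite J \<and> (\<forall>i\<in>J. 0 < snd i) \<and> disjoint_family_on core J \<and> (\<forall>i\<in>J. core i \<subseteq> E)"

lemma sum_core_le:
  assumes "separated_balls E J" "E \<in> sets N" "sets N = sets borel"
  shows "(\<Sum>i\<in>J. emeasure N (ball (fst i) (snd i / 3))) \<le> emeasure N E"
  using sum_nn_integral_disjoint_le[of J core N E "\<lambda>_. 1"] assms by (simp add: separated_balls_def)

text \<open>On the union of the fourfold dilates nothing is known about the functions, but its
  measure is controlled by the cores. Outside it only annuli with j >= 2 occur, and Chebyshev's
  inequality applies to the summed L^1 bounds.\<close>

lemma off_diagonal_sum_weak_bound: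
  fixes N :: "'a::metric_space measure"
  assumes sets: "sets N = sets borel"
    and Cd: "Cd < top" and dil: "\<And>x r j. 0 < r \<Longrightarrow> emeasure N (ball x (2 ^ (j + 1) * r)) \<le>
      Cd * ennreal (2 powr (D * real j)) * emeasure N (ball x (r / 3))"
    and K: "K < top" and a: "\<And>j. 2 \<le> j \<Longrightarrow> 0 \<le> a j" "summable (\<lambda>j. a j * 2 powr (D * real j))"
  obtains C :: ennreal where "C < top"
    "\<And>J E g. separated_balls E J \<Longrightarrow> E \<in> sets N \<Longrightarrow>
      (\<And>i. i \<in> J \<Longrightarrow> g i \<in> borel_measurable N) \<Longrightarrow>
      (\<And>i j. i \<in> J \<Longrightarrow> 2 \<le> j \<Longrightarrow> (\<integral>\<^sup>+x\<in>annulus j (fst i) (snd i). g i x \<partial>N) \<le>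
        K * ennreal (a j) * emeasure N (ball (fst i) (2 ^ (j + 1) * snd i))) \<Longrightarrow>
      emeasure N {x. 1 < (\<Sum>i\<in>J. g i x)} \<le> C * emeasure N E"
proof -
  define A where "A = (\<Sum>j. ennreal (a (j + 2) * 2 powr (D * real (j + 2))))"
  have A: "A < top" unfolding A_def by (rule suminf_less_top_shift[OF a(2)]) (use a(1) in simp)
  \<comment> \<open>The dilation bound at \<open>j = 1\<close>: its ball is 4B, the region on which
    (c) gives no information.\<close>
  define C1 where "C1 = Cd * ennreal (2 powr (D * real 1))"
  define C2 where "C2 = K * Cd * A"
  show thesis
  proof (rule that[of "C1 + C2"])
    show "C1 + C2 < top" using A Cd K by (simp add: C1_def C2_def ennreal_mult_less_top)
    fix J :: "('a \<times> real) set" and E :: "'a set" and g :: "'a \<times> real \<Rightarrow> 'a \<Rightarrow> ennreal"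
    assume sep: "separated_balls E J" and E: "E \<in> sets N"
      and g: "\<And>i. i \<in> J \<Longrightarrow> g i \<in> borel_measurable N"
      and decay: "\<And>i j. i \<in> J \<Longrightarrow> 2 \<le> j \<Longrightarrow> (\<integral>\<^sup>+x\<in>annulus j (fst i) (snd i). g i x \<partial>N) \<le>
        K * ennreal (a j) * emeasure N (ball (fst i) (2 ^ (j + 1) * snd i))"
    note J = sep[unfolded separated_balls_def, THEN conjunct1]
    have pos: "0 < snd i" if "i \<in> J" for i using sep that by (simp add: separated_balls_def)
    let ?core = "\<lambda>i. emeasure N (core i)"
    have core: "(\<Sum>i\<in>J. ?core i) \<le> emeasure N E" by (rule sum_core_le[OF sep E sets])
    define U where "U = (\<Union>i\<in>J. ball (fst i) (4 * snd i))"
    have "open U" by (auto simp: U_def)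
    then have U: "U \<in> sets N" by (simp add: sets)
    have meas: "(\<lambda>x. \<Sum>i\<in>J. g i x) \<in> borel_measurable N" using g by (rule borel_measurable_sum)
    have space: "space N = UNIV" using sets_eq_imp_space_eq[OF sets] by simp
    have lev: "{x. 1 < (\<Sum>i\<in>J. g i x)} \<in> sets N"
      using borel_measurable_less[OF measurable_const meas, of "1"] by (simp add: space pred_def)
    have NU: "emeasure N U \<le> C1 * emeasure N E"
    proof -
      have "emeasure N U \<le> (\<Sum>i\<in>J. emeasure N (ball (fst i) (4 * snd i)))"
        unfolding U_def using J by (intro emeasure_subadditive_finite) (auto simp: sets)
      also have "\<dots> \<le> (\<Sum>i\<in>J. C1 * ?core i)"
      proof (rule sum_mono)
        fix i assume "i \<in> J"
        from dil[OF pos[OF this], of "fst i" 1]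
        show "emeasure N (ball (fst i) (4 * snd i)) \<le> C1 * ?core i" by (simp add: C1_def)
      qed
      also have "\<dots> \<le> C1 * emeasure N E"
        unfolding sum_distrib_left[symmetric] by (intro mult_left_mono core) simp
      finally show ?thesis .
    qed
    have out: "(\<integral>\<^sup>+x\<in>- U. g i x \<partial>N) \<le> C2 * ?core i" if i: "i \<in> J" for i
    proof -
      have "- U \<subseteq> (\<Union>j. annulus (j + 2) (fst i) (snd i))"
        using annuli_cover_outside[OF pos[OF i], of "fst i"] i unfolding U_def by blast
      then have "(\<integral>\<^sup>+x\<in>- U. g i x \<partial>N) \<le> (\<Sum>j. \<integral>\<^sup>+x\<in>annulus (j + 2) (fst i) (snd i). g i x \<partial>N)"
        using U space g[OF i] sets.compl_sets[OF U]
        by (intro nn_integral_countable_cover_le) (auto simp: sets Compl_eq_Diff_UNIV)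
      also have "\<dots> \<le> (\<Sum>j. (K * Cd * ?core i) * ennreal (a (j + 2) * 2 powr (D * real (j + 2))))"
      proof (intro suminf_le summableI)
        fix j
        have "(\<integral>\<^sup>+x\<in>annulus (j + 2) (fst i) (snd i). g i x \<partial>N) \<le>
          K * ennreal (a (j + 2)) * emeasure N (ball (fst i) (2 ^ (j + 2 + 1) * snd i))"
          by (rule decay[OF i]) simp
        also have "\<dots> \<le> K * ennreal (a (j + 2)) * (Cd * ennreal (2 powr (D * real (j + 2))) * ?core i)"
          by (intro mult_left_mono dil pos i) simp
        also have "\<dots> = (K * Cd * ?core i) * (ennreal (a (j + 2)) * ennreal (2 powr (D * real (j + 2))))"
          by (simp only: mult_ac)
        also have "ennreal (a (j + 2)) * ennreal (2 powr (D * real (j + 2))) = ennreal (a (j + 2) * 2 powr (D * real (j + 2)))"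
          by (simp add: ennreal_mult'')
        finally show "(\<integral>\<^sup>+x\<in>annulus (j + 2) (fst i) (snd i). g i x \<partial>N) \<le>
          (K * Cd * ?core i) * ennreal (a (j + 2) * 2 powr (D * real (j + 2)))" .
      qed
      also have "\<dots> = C2 * ?core i"
        by (simp only: ennreal_suminf_cmult A_def[symmetric] C2_def mult_ac)
      finally show ?thesis .
    qed
    have "emeasure N {x. 1 < (\<Sum>i\<in>J. g i x)} \<le> emeasure N (U \<union> ({x. 1 < (\<Sum>i\<in>J. g i x)} - U))"
      using U lev by (intro emeasure_mono) auto
    also have "\<dots> \<le> emeasure N U + emeasure N ({x. 1 < (\<Sum>i\<in>J. g i x)} - U)"
      using U lev by (intro emeasure_subadditive) auto
    also have "emeasure N ({x. 1 < (\<Sum>i\<in>J. g i x)} - U) = (\<integral>\<^sup>+x. indicator ({x. 1 < (\<Sum>i\<in>J. g i x)} - U) x \<partial>N)"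
      using lev U by (intro nn_integral_indicator[symmetric]) auto
    also have "\<dots> \<le> (\<integral>\<^sup>+x. (\<Sum>i\<in>J. g i x * indicator (- U) x) \<partial>N)"
      by (intro nn_integral_mono) (auto split: split_indicator)
    also have "\<dots> = (\<Sum>i\<in>J. \<integral>\<^sup>+x\<in>- U. g i x \<partial>N)"
      using g sets.compl_sets[OF U] space by (intro nn_integral_sum) (auto simp: Compl_eq_Diff_UNIV)
    also have "\<dots> \<le> (\<Sum>i\<in>J. C2 * ?core i)" by (intro sum_mono out)
    also have "\<dots> \<le> C2 * emeasure N E"
      unfolding sum_distrib_left[symmetric] by (intro mult_left_mono core) simp
    finally show "emeasure N {x. 1 < (\<Sum>i\<in>J. g i x)} \<le> (C1 + C2) * emeasure N E"
      using NU by (simp add: distrib_right) (meson add_mono order_trans order_refl)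
  qed
qed

text \<open>Cutting off both in height and in space makes power integrals finite for a measure that
  is finite on balls, and the cut-offs still exhaust \<open>G\<close>.\<close>

lemma SUP_truncation:
  fixes G :: "'a::metric_space \<Rightarrow> ennreal"
  shows "(SUP n::nat. min (G x) (of_nat n) * indicator (ball x0 (real n)) x) = G x"
proof (rule antisym)
  show "G x \<le> (SUP n::nat. min (G x) (of_nat n) * indicator (ball x0 (real n)) x)"
    unfolding le_SUP_iff
  proof (intro allI impI)
    fix l assume l: "l < G x"
    then have "l < top" using less_le_trans top_greatest by blast
    then obtain k :: nat where k: "l < of_nat k" using ennreal_Ex_less_of_nat by blast
    obtain m :: nat where m: "dist x0 x < real m" using reals_Archimedean2 by blast
    have "(of_nat k :: ennreal) \<le> of_nat (max k m)" by simp
    then have "l < of_nat (max k m)" using k by (rule less_le_trans[rotated])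
    moreover have "dist x0 x < real (max k m)" using m by simp
    ultimately show "\<exists>n\<in>UNIV. l < min (G x) (of_nat n) * indicator (ball x0 (real n)) x"
      using l by (intro bexI[of _ "max k m"]) auto
  qed
qed (auto intro!: SUP_least split: split_indicator)

text \<open>The \<open>q\<close>-th power of the sum is tested against \<open>u = G\<^bsup>q-1\<^esup>\<close> with \<open>G\<close> a truncation of the sum, so
  that Kolmogorov's inequality reproduces the (finite) integral of \<open>G\<^sup>q\<close> with a factor \<open>1/2\<close>.\<close>

lemma off_diagonal_sum_Lq_bound:
  fixes N :: "'a::{metric_space,second_countable_topology} measure"
  assumes N: "doubling_measure N" and posN: "\<And>x r. 0 < r \<Longrightarrow> 0 < emeasure N (ball x r)"
    and Cd: "Cd < top" and dil: "\<And>x r j. 0 < r \<Longrightarrow> emeasure N (ball x (2 ^ (j + 1) * r)) \<le>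
      Cd * ennreal (2 powr (D * real j)) * emeasure N (ball x (r / 3))"
    and q: "1 < q"
    and K: "K < top" and a: "\<And>j. 1 \<le> j \<Longrightarrow> 0 \<le> a j" "summable (\<lambda>j. a j * 2 powr (D * real j))"
  obtains C :: ennreal where "C < top"
    "\<And>J E g. separated_balls E J \<Longrightarrow> E \<in> sets N \<Longrightarrow>
      (\<And>i. i \<in> J \<Longrightarrow> g i \<in> borel_measurable N) \<Longrightarrow>
      (\<And>i j. i \<in> J \<Longrightarrow> 1 \<le> j \<Longrightarrow> (\<integral>\<^sup>+x\<in>annulus j (fst i) (snd i). enn_powr (g i x) q \<partial>N) \<le>
        K * ennreal (a j powr q) * emeasure N (ball (fst i) (2 ^ (j + 1) * snd i))) \<Longrightarrow>
      (\<integral>\<^sup>+x. enn_powr (\<Sum>i\<in>J. g i x) q \<partial>N) \<le> C * emeasure N E"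
proof -
  note sets = doubling_measure_sets[OF N] and space = doubling_measure_space[OF N]
  have [measurable]: "ball x r \<in> sets N" "annulus j x r \<in> sets N" for x r j by (auto simp: sets)
  have finN: "emeasure N (ball x r) < top" for x r by (rule doubling_measure_finite[OF N])
  define q' where "q' = q / (q - 1)"
  have q': "1 < q'" "1 / q + 1 / q' = 1" "(q - 1) * q' = q" using q by (auto simp: q'_def field_simps)
  have iq: "0 < 1 / q" "0 < 1 / q'" using q q' by auto
  obtain KK :: ennreal where KK: "KK < top"
    "\<And>h E s. h \<in> borel_measurable N \<Longrightarrow> E \<in> sets N \<Longrightarrow> 0 < s \<Longrightarrow>
      (\<integral>\<^sup>+x\<in>E. enn_powr (maximal N h x) (1 / q') \<partial>N) \<le>
        ennreal s * emeasure N E + KK * ennreal (s powr (1 - q')) * (\<integral>\<^sup>+x. h x \<partial>N)"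
    using maximal_Kolmogorov[OF N q'(1)] by blast
  define A where "A = (\<Sum>j. ennreal (a (j + 1) * 2 powr (D * real (j + 1))))"
  have A: "A < top" unfolding A_def by (rule suminf_less_top_shift[OF a(2)]) (use a(1) in simp)
  define L where "L = enn_powr K (1 / q) * Cd * A"
  have L: "L < top" using A Cd K q by (simp add: L_def ennreal_mult_less_top enn_powr_less_top_iff)
  define c where "c = enn2real (L * KK)"
  have c: "0 \<le> c" "L * KK = ennreal c" using L KK by (auto simp: c_def ennreal_mult_less_top)
  \<comment> \<open>Chosen so that s^(1-q') = 1/(2c+1), whence c s^(1-q') <= 1/2; the added 1 keeps
    \<open>s\<close> positive when \<open>c = 0\<close>.\<close>
  define s where "s = (2 * c + 1) powr (1 / (q' - 1))"
  have s: "0 < s" "s powr (1 - q') = 1 / (2 * c + 1)"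
  proof -
    show "0 < s" using c by (simp add: s_def)
    have "1 / (q' - 1) * (1 - q') = - 1" using q' by (simp add: field_simps)
    then show "s powr (1 - q') = 1 / (2 * c + 1)"
      unfolding s_def powr_powr using c by (simp add: powr_minus divide_inverse)
  qed
  have half: "L * KK * ennreal (s powr (1 - q')) \<le> ennreal (1 / 2)"
    unfolding c(2) s(2) using c(1) by (subst ennreal_mult[symmetric]) (auto simp: field_simps simp del: ennreal_half intro!: ennreal_leI)
  show thesis
  proof (rule that[of "2 * (L * ennreal s)"])
    show "2 * (L * ennreal s) < top" using L by (simp add: ennreal_mult_less_top)
    fix J :: "('a \<times> real) set" and E :: "'a set" and g :: "'a \<times> real \<Rightarrow> 'a \<Rightarrow> ennreal"
    assume sep: "separated_balls E J" and E: "E \<in> sets N"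
      and g: "\<And>i. i \<in> J \<Longrightarrow> g i \<in> borel_measurable N"
      and decay: "\<And>i j. i \<in> J \<Longrightarrow> 1 \<le> j \<Longrightarrow> (\<integral>\<^sup>+x\<in>annulus j (fst i) (snd i). enn_powr (g i x) q \<partial>N) \<le>
        K * ennreal (a j powr q) * emeasure N (ball (fst i) (2 ^ (j + 1) * snd i))"
    have J: "finite J" and disj: "disjoint_family_on core J"
      using sep by (simp_all add: separated_balls_def)
    have pos: "0 < snd i" and sub: "core i \<subseteq> E" if "i \<in> J" for i
      using sep that by (simp_all add: separated_balls_def)
    have mm: "(\<lambda>x. enn_powr (maximal N h x) (1 / q')) \<in> borel_measurable N" for h
    using borel_measurable_maximal[OF N] by measurable
    \<comment> \<open>Hoelder on each annulus leaves an average of u^q' over a dilated ball that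
      contains \<open>y\<close>, hence a maximal function at \<open>y\<close>. The bound holds at
      every \<open>y\<close> in the core, so it can be averaged over the core, and the disjoint
      cores add up to an integral over \<open>E\<close>.\<close>
    have ptw: "(\<integral>\<^sup>+x. g i x * u x \<partial>N) \<le> (L * enn_powr (maximal N (\<lambda>x. enn_powr (u x) q') y) (1 / q')) * emeasure N (core i)"
      if i: "i \<in> J" and u[measurable]: "u \<in> borel_measurable N" and y: "y \<in> core i" for i u y
    proof -
      note [measurable] = g[OF i]
      let ?h = "\<lambda>x. enn_powr (u x) q'"
      let ?m = "enn_powr (maximal N ?h y) (1 / q')"
      have "(\<integral>\<^sup>+x. g i x * u x \<partial>N) = (\<integral>\<^sup>+x\<in>UNIV. g i x * u x \<partial>N)" by simp
      also have "\<dots> \<le> (\<Sum>j. \<integral>\<^sup>+x\<in>annulus (j + 1) (fst i) (snd i). g i x * u x \<partial>N)"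
        using annuli_cover[OF pos[OF i], of "fst i"] sets.top[of N]
        by (intro nn_integral_countable_cover_le) (auto simp: space)
      also have "\<dots> \<le> (\<Sum>j. (enn_powr K (1 / q) * Cd * ?m * emeasure N (core i)) * ennreal (a (j + 1) * 2 powr (D * real (j + 1))))"
      proof (intro suminf_le summableI)
        fix j
        let ?A = "annulus (j + 1) (fst i) (snd i)" and ?V = "ball (fst i) (2 ^ (j + 1 + 1) * snd i)"
        let ?a = "a (j + 1)"
        have AV: "?A \<subseteq> ?V" using annulus_subset[of "j + 1" "snd i" "fst i"] pos[OF i] by simp
        have rV: "0 < 2 ^ (j + 1 + 1) * snd i" using pos[OF i] by simp
        have V: "0 < emeasure N ?V" "emeasure N ?V < top" using posN[OF rV] finN by auto
        have "(1::real) \<le> 2 ^ (j + 1 + 1)" by (rule one_le_power) simp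
        then have "1 / 3 * snd i \<le> 2 ^ (j + 1 + 1) * snd i" using pos[OF i] by (intro mult_right_mono) auto
        then have yV: "y \<in> ?V" using y by simp
        have aq: "enn_powr (ennreal (?a powr q)) (1 / q) = ennreal ?a"
          using q a(1)[of "j + 1"] by (simp add: enn_powr_ennreal powr_powr)
        have "(\<integral>\<^sup>+x\<in>?A. g i x * u x \<partial>N) = (\<integral>\<^sup>+x. (g i x * indicator ?A x) * (u x * indicator ?V x) \<partial>N)"
          using AV by (intro nn_integral_cong) (auto split: split_indicator)
        also have "\<dots> \<le> enn_powr (\<integral>\<^sup>+x. enn_powr (g i x * indicator ?A x) q \<partial>N) (1 / q) *
            enn_powr (\<integral>\<^sup>+x. enn_powr (u x * indicator ?V x) q' \<partial>N) (1 / q')"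
          by (rule Holder_nn_integral[OF q q'(2)]) measurable
        also have "\<dots> = enn_powr (\<integral>\<^sup>+x\<in>?A. enn_powr (g i x) q \<partial>N) (1 / q) * enn_powr (\<integral>\<^sup>+x\<in>?V. ?h x \<partial>N) (1 / q')"
          using q q' by (simp add: enn_powr_indicator)
        also have "(\<integral>\<^sup>+x\<in>?V. ?h x \<partial>N) = average N ?V ?h * emeasure N ?V"
          using V by (intro nn_integral_average) auto
        also have "enn_powr (\<integral>\<^sup>+x\<in>?A. enn_powr (g i x) q \<partial>N) (1 / q) * enn_powr (average N ?V ?h * emeasure N ?V) (1 / q') \<le>
           enn_powr (K * ennreal (?a powr q) * emeasure N ?V) (1 / q) * enn_powr (maximal N ?h y * emeasure N ?V) (1 / q')"
          using q q' by (intro mult_mono enn_powr_mono mult_right_mono average_le_maximal rV yV decay[OF i]) auto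
        also have "\<dots> = (enn_powr K (1 / q) * ennreal ?a * ?m) * (enn_powr (emeasure N ?V) (1 / q) * enn_powr (emeasure N ?V) (1 / q'))"
          by (simp only: enn_powr_mult[OF iq(1)] enn_powr_mult[OF iq(2)] aq mult_ac)
        also have "enn_powr (emeasure N ?V) (1 / q) * enn_powr (emeasure N ?V) (1 / q') = emeasure N ?V"
          using q q' by (simp flip: enn_powr_add)
        also have "(enn_powr K (1 / q) * ennreal ?a * ?m) * emeasure N ?V \<le>
            (enn_powr K (1 / q) * ennreal ?a * ?m) * (Cd * ennreal (2 powr (D * real (j + 1))) * emeasure N (core i))"
          by (intro mult_left_mono dil pos i) simp
        also have "\<dots> = (enn_powr K (1 / q) * Cd * ?m * emeasure N (core i)) * (ennreal ?a * ennreal (2 powr (D * real (j + 1))))"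
          by (simp only: mult_ac)
        also have "ennreal ?a * ennreal (2 powr (D * real (j + 1))) = ennreal (?a * 2 powr (D * real (j + 1)))"
          by (simp add: ennreal_mult'')
        finally show "(\<integral>\<^sup>+x\<in>?A. g i x * u x \<partial>N) \<le>
          (enn_powr K (1 / q) * Cd * ?m * emeasure N (core i)) * ennreal (?a * 2 powr (D * real (j + 1)))" .
      qed
      also have "\<dots> = (L * ?m) * emeasure N (core i)"
        by (simp only: ennreal_suminf_cmult A_def[symmetric] L_def mult_ac)
      finally show ?thesis .
    qed
    have dual: "(\<integral>\<^sup>+x. (\<Sum>i\<in>J. g i x) * u x \<partial>N) \<le>
        L * (\<integral>\<^sup>+x\<in>E. enn_powr (maximal N (\<lambda>x. enn_powr (u x) q') x) (1 / q') \<partial>N)"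
      if u[measurable]: "u \<in> borel_measurable N" for u
    proof -
      let ?m = "\<lambda>y. enn_powr (maximal N (\<lambda>x. enn_powr (u x) q') y) (1 / q')"
      have one: "(\<integral>\<^sup>+x. g i x * u x \<partial>N) \<le> (\<integral>\<^sup>+y\<in>core i. L * ?m y \<partial>N)" if i: "i \<in> J" for i
      proof -
        let ?I = "\<integral>\<^sup>+x. g i x * u x \<partial>N" and ?n = "emeasure N (core i)"
        have n: "0 < ?n" "?n < top" using posN[of "snd i / 3" "fst i"] pos[OF i] finN by auto
        have "?I / ?n * ?n = ?I" using n by (simp add: ennreal_divide_times less_top)
        then have "?I = (\<integral>\<^sup>+y\<in>core i. ?I / ?n \<partial>N)" by (simp add: nn_integral_cmult_indicator)
        also have "\<dots> \<le> (\<integral>\<^sup>+y\<in>core i. L * ?m y \<partial>N)"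
          using ptw[OF i u] by (intro nn_integral_mono) (auto split: split_indicator intro!: ennreal_divide_leI)
        finally show ?thesis .
      qed
      have "(\<integral>\<^sup>+x. (\<Sum>i\<in>J. g i x) * u x \<partial>N) = (\<Sum>i\<in>J. \<integral>\<^sup>+x. g i x * u x \<partial>N)"
        unfolding sum_distrib_right using g by (intro nn_integral_sum) auto
      also have "\<dots> \<le> (\<Sum>i\<in>J. \<integral>\<^sup>+y\<in>core i. L * ?m y \<partial>N)" by (intro sum_mono one)
      also have "\<dots> \<le> (\<integral>\<^sup>+y\<in>E. L * ?m y \<partial>N)"
        by (rule sum_nn_integral_disjoint_le[OF J disj _ sub E]) (auto intro!: borel_measurable_times_ennreal mm)
      also have "\<dots> = L * (\<integral>\<^sup>+y\<in>E. ?m y \<partial>N)"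
        unfolding mult.assoc using E mm by (intro nn_integral_cmult borel_measurable_times_ennreal) auto
      finally show ?thesis .
    qed
    define G where "G x = (\<Sum>i\<in>J. g i x)" for x
    have G[measurable]: "G \<in> borel_measurable N" unfolding G_def using g by (rule borel_measurable_sum)
    define Gn where "Gn n x = min (G x) (of_nat n) * indicator (ball undefined (real n)) x" for n :: nat and x
    have Gn[measurable]: "Gn n \<in> borel_measurable N" for n unfolding Gn_def by measurable
    have trunc: "(\<integral>\<^sup>+x. enn_powr (Gn n x) q \<partial>N) \<le> 2 * (L * ennreal s) * emeasure N E" for n
    proof -
      let ?H = "\<integral>\<^sup>+x. enn_powr (Gn n x) q \<partial>N"
      let ?u = "\<lambda>x. enn_powr (Gn n x) (q - 1)"
      \<comment> \<open>Half of \<open>?H\<close> is absorbed below, which is legitimate only for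
        finite \<open>?H\<close>; the cut-off in height and support provides this.\<close>
      have fin: "?H < top"
      proof -
        have "?H \<le> (\<integral>\<^sup>+x. enn_powr (of_nat n) q * indicator (ball undefined (real n)) x \<partial>N)"
          using q by (intro nn_integral_mono) (auto simp: Gn_def split: split_indicator intro!: enn_powr_mono)
        also have "\<dots> = enn_powr (of_nat n) q * emeasure N (ball undefined (real n))"
          by (rule nn_integral_cmult_indicator) simp
        also have "\<dots> < top"
          using finN[of undefined "real n"] q by (simp add: ennreal_mult_less_top enn_powr_less_top_iff of_nat_less_top)
        finally show ?thesis .
      qed
      have uq: "(\<lambda>x. enn_powr (?u x) q') = (\<lambda>x. enn_powr (Gn n x) q)" using q q' by (simp add: enn_powr_powr)
      have "?H \<le> (\<integral>\<^sup>+x. (\<Sum>i\<in>J. g i x) * ?u x \<partial>N)"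
      proof (rule nn_integral_mono)
        fix x
        have "enn_powr (Gn n x) (1 + (q - 1)) = Gn n x * ?u x" using q by (subst enn_powr_add) auto
        also have "\<dots> \<le> (\<Sum>i\<in>J. g i x) * ?u x"
          by (intro mult_right_mono) (auto simp: Gn_def G_def split: split_indicator)
        finally show "enn_powr (Gn n x) q \<le> (\<Sum>i\<in>J. g i x) * ?u x" by simp
      qed
      also have "\<dots> \<le> L * (\<integral>\<^sup>+x\<in>E. enn_powr (maximal N (\<lambda>x. enn_powr (?u x) q') x) (1 / q') \<partial>N)"
        by (rule dual) measurable
      also have "\<dots> \<le> L * (ennreal s * emeasure N E + KK * ennreal (s powr (1 - q')) * ?H)"
        unfolding uq by (intro mult_left_mono KK(2) E s) auto
      also have "\<dots> = L * ennreal s * emeasure N E + (L * KK * ennreal (s powr (1 - q'))) * ?H"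
        by (simp add: distrib_left mult_ac)
      also have "\<dots> \<le> L * ennreal s * emeasure N E + ennreal (1 / 2) * ?H"
        by (intro add_left_mono mult_right_mono half) simp
      finally have le: "?H \<le> L * ennreal s * emeasure N E + ennreal (1 / 2) * ?H" .
      have absorb: "x \<le> 2 * y" if "x \<le> y + ennreal (1 / 2) * x" "x < top" for x y :: ennreal
      proof (cases x; cases y)
        fix r t assume *: "0 \<le> r" "x = ennreal r" "0 \<le> t" "y = ennreal t"
        then have "ennreal r \<le> ennreal (t + 1 / 2 * r)"
          using that(1) by (simp only: ennreal_plus ennreal_mult)
        then have "r \<le> t + 1 / 2 * r" using * by (subst (asm) ennreal_le_iff) auto
        then have "r \<le> 2 * t" by simp
        then show ?thesis using * by (simp add: ennreal_leI numeral_mult_ennreal)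
      qed (use that in auto)
      show ?thesis using absorb[OF le fin] by (simp add: mult.assoc)
    qed
    have "(\<integral>\<^sup>+x. enn_powr (\<Sum>i\<in>J. g i x) q \<partial>N) = (\<integral>\<^sup>+x. (SUP n. enn_powr (Gn n x) q) \<partial>N)"
    proof (rule nn_integral_cong)
      fix x
      have "(\<Sum>i\<in>J. g i x) = (SUP n. Gn n x)"
        unfolding Gn_def SUP_truncation by (simp add: G_def)
      then show "enn_powr (\<Sum>i\<in>J. g i x) q = (SUP n. enn_powr (Gn n x) q)"
        using q by (simp add: enn_powr_SUP)
    qed
    also have "\<dots> = (SUP n. \<integral>\<^sup>+x. enn_powr (Gn n x) q \<partial>N)"
    proof (rule nn_integral_monotone_convergence_SUP)
      show "incseq (\<lambda>n x. enn_powr (Gn n x) q)"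
        using q unfolding incseq_def le_fun_def
        by (auto simp: Gn_def split: split_indicator intro!: enn_powr_mono min.mono)
    qed measurable
    also have "\<dots> \<le> 2 * (L * ennreal s) * emeasure N E" by (intro SUP_least trunc)
    finally show "(\<integral>\<^sup>+x. enn_powr (\<Sum>i\<in>J. g i x) q \<partial>N) \<le> 2 * (L * ennreal s) * emeasure N E" .
  qed
qed

section \<open>The level set estimate\<close>

text \<open>Radii are proportional to the distance from the complement. Vitali's lemma is applied to
  small balls inside \<open>E\<close>, which become the cores of the tripled balls in
  \<open>J\<close>. Finitely many balls are treated at a time, and the sets \<open>U n\<close>
  exhaust \<open>E\<close>.\<close>

lemma Whitney_balls:
  fixes E :: "'a::{metric_space,second_countable_topology} set"
  assumes E: "open E" "E \<noteq> UNIV"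
  obtains U :: "nat \<Rightarrow> 'a set" and J :: "nat \<Rightarrow> ('a \<times> real) set"
  where "incseq U" "(\<Union>n. U n) = E" "\<And>n. open (U n)" "\<And>n. separated_balls E (J n)"
    "\<And>n i. i \<in> J n \<Longrightarrow> \<not> ball (fst i) (4 * snd i) \<subseteq> E"
    "\<And>n. U n \<subseteq> (\<Union>i\<in>J n. pball i)"
proof -
  define d where "d x = infdist x (- E)" for x
  have ne: "- E \<noteq> {}" using E by blast
  have d: "0 < d x" if "x \<in> E" for x
    unfolding d_def using E that ne by (intro infdist_pos_not_in_closed) auto
  have far: "\<not> ball x (2 * d x) \<subseteq> E" if "x \<in> E" for x
  proof -
    have "(INF a\<in>- E. dist x a) < 2 * d x" using d[OF that] ne by (simp add: d_def infdist_notempty)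
    then obtain a where "a \<in> - E" "dist x a < 2 * d x"
      using ne by (subst (asm) cINF_less_iff) (auto intro: bdd_belowI2[where m = 0])
    then show ?thesis by auto
  qed
  \<comment> \<open>The 6 is dictated by the dilations: tripling gives d/2, the radius of the balls
    in \<open>J\<close>, and four times that is 2d, which surpasses the distance to the
    complement.\<close>
  define F where "F = (\<lambda>x. (x, d x / 6)) ` E"
  obtain S where S: "incseq S" "\<And>n. finite (S n)" "\<And>n. S n \<subseteq> F"
      "(\<Union>n::nat. \<Union>i\<in>S n. pball i) = (\<Union>i\<in>F. pball i)"
    by (rule countable_ball_cover[of F]) blast
  have sub: "ball x (d x / 6) \<subseteq> E" if "x \<in> E" for x
  proof
    fix y assume y: "y \<in> ball x (d x / 6)"
    show "y \<in> E"
    proof (rule ccontr)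
      assume "y \<notin> E"
      then have "d x \<le> dist x y" unfolding d_def by (intro infdist_le) simp
      then show False using y d[OF that] by simp
    qed
  qed
  have cover: "(\<Union>i\<in>F. pball i) = E"
  proof
    show "(\<Union>i\<in>F. pball i) \<subseteq> E"
      unfolding F_def UN_simps fst_conv snd_conv by (intro UN_least sub)
    show "E \<subseteq> (\<Union>i\<in>F. pball i)"
    proof
      fix x assume "x \<in> E"
      then have "(x, d x / 6) \<in> F" "x \<in> ball (fst (x, d x / 6)) (snd (x, d x / 6))"
        using d by (auto simp: F_def)
      then show "x \<in> (\<Union>i\<in>F. pball i)" by (rule UN_I)
    qed
  qed
  have "\<exists>J'. \<forall>n. J' n \<subseteq> S n \<and> disjoint_family_on pball (J' n) \<and>
      (\<Union>i\<in>S n. pball i) \<subseteq> (\<Union>i\<in>J' n. ball (fst i) (3 * snd i))"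
    by (intro choice allI finite_Vitali S(2))
  then obtain J' where J': "\<And>n. J' n \<subseteq> S n" "\<And>n. disjoint_family_on pball (J' n)"
    "\<And>n. (\<Union>i\<in>S n. pball i) \<subseteq> (\<Union>i\<in>J' n. ball (fst i) (3 * snd i))"
    by blast
  define J where "J n = (\<lambda>i. (fst i, 3 * snd i)) ` J' n" for n
  have JE: "\<exists>x\<in>E. i = (x, d x / 2)" if i: "i \<in> J n" for i n
  proof -
    obtain k where "k \<in> J' n" "i = (fst k, 3 * snd k)" using i by (auto simp: J_def)
    moreover from this obtain x where "x \<in> E" "k = (x, d x / 6)"
      using J'(1)[of n] S(3)[of n] unfolding F_def by blast
    ultimately show ?thesis by simp
  qed
  show thesis
  proof (rule that[of "\<lambda>n. \<Union>i\<in>S n. pball i" J])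
    show "incseq (\<lambda>n. \<Union>i\<in>S n. pball i)" using S(1) unfolding incseq_def by blast
    show "(\<Union>n. \<Union>i\<in>S n. pball i) = E" using S(4) cover by simp
    have "finite (J n)" for n using S(2) J'(1) finite_subset unfolding J_def by blast
    moreover have "disjoint_family_on core (J n)" for n
    proof (unfold disjoint_family_on_def, intro ballI impI)
      fix i j assume "i \<in> J n" "j \<in> J n" and ij: "i \<noteq> j"
      then obtain k l where k: "k \<in> J' n" "i = (fst k, 3 * snd k)" and l: "l \<in> J' n" "j = (fst l, 3 * snd l)"
        by (auto simp: J_def)
      have "k \<noteq> l" using ij k l by blast
      then have "ball (fst k) (snd k) \<inter> ball (fst l) (snd l) = {}"
        using disjoint_family_onD[OF J'(2) k(1) l(1)] by blast
      then show "core i \<inter> core j = {}" using k(2) l(2) by simp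
    qed
    moreover have "0 < snd i" if i: "i \<in> J n" for n i
    proof -
      obtain x where "x \<in> E" "i = (x, d x / 2)" using JE[OF i] by blast
      then show ?thesis using d[of x] by simp
    qed
    moreover have "core i \<subseteq> E" if i: "i \<in> J n" for n i
    proof -
      obtain x where "x \<in> E" "i = (x, d x / 2)" using JE[OF i] by blast
      then show ?thesis using sub[of x] by simp
    qed
    ultimately show "separated_balls E (J n)" for n by (simp add: separated_balls_def)
    show "\<not> ball (fst i) (4 * snd i) \<subseteq> E" if i: "i \<in> J n" for n i
    proof -
      obtain x where "x \<in> E" "i = (x, d x / 2)" using JE[OF i] by blast
      then show ?thesis using far[of x] by simp
    qed
    show "(\<Union>i\<in>S n. pball i) \<subseteq> (\<Union>i\<in>J n. pball i)" for n
      using J'(3)[of n] by (simp add: J_def)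
  qed auto
qed

text \<open>Each ball in turn takes what is left of \<open>U\<close> inside it; the induction
  hypothesis is applied to \<open>U - B k\<close>.\<close>

lemma finite_disjoint_refinement:
  assumes "finite J" "\<And>i. i \<in> J \<Longrightarrow> B i \<in> sets M" "U \<in> sets M" "U \<subseteq> (\<Union>i\<in>J. B i)"
  shows "\<exists>P. (\<forall>i\<in>J. P i \<in> sets M \<and> P i \<subseteq> B i) \<and> disjoint_family_on P J \<and> (\<Union>i\<in>J. P i) = U"
  using assms
proof (induction arbitrary: U)
  case empty
  then show ?case by (auto simp: disjoint_family_on_def)
next
  case (insert k J)
  have "\<exists>P. (\<forall>i\<in>J. P i \<in> sets M \<and> P i \<subseteq> B i) \<and> disjoint_family_on P J \<and> (\<Union>i\<in>J. P i) = U - B k"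
    by (rule insert.IH) (use insert.prems in auto)
  then obtain P where P: "\<forall>i\<in>J. P i \<in> sets M \<and> P i \<subseteq> B i" "disjoint_family_on P J" "(\<Union>i\<in>J. P i) = U - B k"
    by blast
  define P' where "P' = P(k := U \<inter> B k)"
  have "\<forall>i\<in>insert k J. P' i \<in> sets M \<and> P' i \<subseteq> B i"
    using P(1) insert.prems by (auto simp: P'_def)
  moreover have "disjoint_family_on P' (insert k J)"
    using P(2,3) insert.hyps unfolding disjoint_family_on_def by (auto simp: P'_def)
  moreover have "(\<Union>i\<in>insert k J. P' i) = U"
    using P(3) insert.hyps by (auto simp: P'_def split: if_splits)
  ultimately show ?case by blast
qed

section \<open>Finite sums in the operator domains\<close>

lemma function_subspace_sum:
  assumes D: "function_subspace D" and "finite J" "\<And>i. i \<in> J \<Longrightarrow> h i \<in> D"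
  shows "(\<lambda>x. \<Sum>i\<in>J. h i x) \<in> D"
  using assms(2,3)
proof (induction rule: finite_induct)
  case empty
  then show ?case using D by (simp add: function_subspace_def)
next
  case (insert k J)
  then have "h k \<in> D" "(\<lambda>x. \<Sum>i\<in>J. h i x) \<in> D" by auto
  then show ?case using D insert.hyps by (simp add: function_subspace_def)
qed

lemma function_subspace_diff:
  assumes D: "function_subspace D" and "f \<in> D" "g \<in> D"
  shows "(\<lambda>x. f x - g x) \<in> D"
proof -
  have add: "(\<lambda>x. h x + k x) \<in> D" if "h \<in> D" "k \<in> D" for h k
    using D that unfolding function_subspace_def by blast
  have "(\<lambda>x. - 1 * g x) \<in> D" using assms unfolding function_subspace_def by blast
  from add[OF \<open>f \<in> D\<close> this] show ?thesis by simp
qed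

text \<open>The separate summand \<open>f\<close> lets the induction start from \<open>T f\<close>
  itself rather than from the value of \<open>T\<close> at the zero function.\<close>

lemma sublinear_operator_sum:
  assumes T: "sublinear_operator M D T" and D: "function_subspace D"
    and J: "finite J" "\<And>i. i \<in> J \<Longrightarrow> h i \<in> D" and f: "f \<in> D"
  shows "AE x in M. norm (T (\<lambda>y. f y + (\<Sum>i\<in>J. h i y)) x) \<le> norm (T f x) + (\<Sum>i\<in>J. norm (T (h i) x))"
  using J
proof (induction rule: finite_induct)
  case empty
  then show ?case by simp
next
  case (insert k J)
  let ?g = "\<lambda>y. f y + (\<Sum>i\<in>J. h i y)"
  have g: "?g \<in> D"
    using D f function_subspace_sum[OF D insert.hyps(1), of h] insert.prems by (simp add: function_subspace_def)
  then have "AE x in M. norm (T (\<lambda>y. h k y + ?g y) x) \<le> norm (T (h k) x) + norm (T ?g x)"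
    using T insert.prems by (simp add: sublinear_operator_def)
  moreover have "(\<lambda>y. h k y + ?g y) = (\<lambda>y. f y + (\<Sum>i\<in>insert k J. h i y))"
    using insert.hyps by (simp add: algebra_simps)
  moreover have "AE x in M. norm (T ?g x) \<le> norm (T f x) + (\<Sum>i\<in>J. norm (T (h i) x))"
    by (rule insert.IH) (use insert.prems in auto)
  ultimately show ?case
    using insert.hyps by (auto elim!: AE_mp)
qed

text \<open>Continuity from above for the measure with density \<open>f\<close>, which is finite by
  the last assumption.\<close>

lemma tendsto_set_nn_integral_decseq:
  assumes "decseq A" "\<And>n::nat. A n \<in> sets N" and [measurable]: "f \<in> borel_measurable N"
    and "(\<integral>\<^sup>+x. f x \<partial>N) < top"
  shows "(\<lambda>n. \<integral>\<^sup>+x\<in>A n. f x \<partial>N) \<longlonglongrightarrow> (\<integral>\<^sup>+x\<in>(\<Inter>n. A n). f x \<partial>N)"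
proof -
  have fin: "emeasure (density N f) (A n) \<noteq> \<infinity>" for n
  proof -
    have "emeasure (density N f) (A n) = (\<integral>\<^sup>+x\<in>A n. f x \<partial>N)" using assms(2) by (simp add: emeasure_density)
    also have "\<dots> \<le> (\<integral>\<^sup>+x. f x \<partial>N)" by (intro nn_integral_mono) (auto split: split_indicator)
    finally show ?thesis using assms(4) by auto
  qed
  have "(\<lambda>n. emeasure (density N f) (A n)) \<longlonglongrightarrow> emeasure (density N f) (\<Inter>n. A n)"
    using assms(1,2) fin by (intro Lim_emeasure_decseq) auto
  moreover have "(\<Inter>n. A n) \<in> sets N" using assms(2) by auto
  ultimately show ?thesis using assms(2) by (simp add: emeasure_density)
qed

text \<open>Only truncations of \<open>f\<close> are available, so the decomposition at height \<open>1\<close> uses the pieces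
  \<open>f 1\<^bsub>P i\<^esub>\<close> without mean value correction, and only finitely many of them: the part of \<open>f\<close> on
  the remainder of the level set disappears in the limit because \<open>f \<in> L\<^sup>q(w)\<close>.\<close>

lemma level_set_estimate:
  fixes M :: "'a::{metric_space,second_countable_topology} measure"
  assumes M: "doubling_measure M" and wt: "weight M w" and N: "doubling_measure (wmeasure M w)"
    and posN: "\<And>x r. 0 < r \<Longrightarrow> 0 < emeasure (wmeasure M w) (ball x r)"
    and Cd: "Cd < top" and dil: "\<And>x r j. 0 < r \<Longrightarrow> emeasure (wmeasure M w) (ball x (2 ^ (j + 1) * r)) \<le>
      Cd * ennreal (2 powr (D * real j)) * emeasure (wmeasure M w) (ball x (r / 3))"
    and p0: "1 \<le> p0" and q: "1 < q"
    and D: "function_subspace D1" "function_subspace D2" "D1 \<subseteq> D2" "D2 \<subseteq> borel_measurable M"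
    and trunc: "truncation_stable M D1"
    and T: "sublinear_operator M D2 T" and A: "\<And>r f. 0 < r \<Longrightarrow> f \<in> D1 \<Longrightarrow> A r f \<in> D2"
    and Cw: "Cw < top" and weak: "\<And>f. f \<in> D2 \<Longrightarrow>
      power_integral (wmeasure M w) q f < top \<Longrightarrow>
      emeasure (wmeasure M w) {x. 1 < norm (T f x)} \<le> Cw * power_integral (wmeasure M w) q f"
    and \<alpha>: "\<And>j. 1 \<le> j \<Longrightarrow> 0 \<le> \<alpha> j" "summable (\<lambda>j. \<alpha> j * 2 powr (D * real j))"
    and Kb: "Kb < top" and b: "\<And>j x r f. 1 \<le> j \<Longrightarrow> 0 < r \<Longrightarrow> f \<in> D1 \<Longrightarrow> (\<And>y. y \<notin> ball x r \<Longrightarrow> f y = 0) \<Longrightarrow>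
      (\<integral>\<^sup>+y\<in>annulus j x r. enn_powr (ennreal (norm (A r f y))) q \<partial>wmeasure M w) \<le>
        Kb * emeasure (wmeasure M w) (ball x (2 ^ (j + 1) * r)) *
        enn_powr (ennreal (\<alpha> j) * Lp_average (ennreal p0) M (ball x r) (ball x r) f) q"
    and \<gamma>: "\<And>j. 2 \<le> j \<Longrightarrow> 0 \<le> \<gamma> j" "summable (\<lambda>j. \<gamma> j * 2 powr (D * real j))"
    and Kc: "Kc < top" and c: "\<And>j x r f. 2 \<le> j \<Longrightarrow> 0 < r \<Longrightarrow> f \<in> D1 \<Longrightarrow> (\<And>y. y \<notin> ball x r \<Longrightarrow> f y = 0) \<Longrightarrow>
      (\<integral>\<^sup>+y\<in>annulus j x r. ennreal (norm (T (\<lambda>y. f y - A r f y) y)) \<partial>wmeasure M w) \<le>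
        Kc * emeasure (wmeasure M w) (ball x (2 ^ (j + 1) * r)) *
        (ennreal (\<gamma> j) * Lp_average (ennreal p0) M (ball x r) (ball x r) f)"
  obtains C :: ennreal where "C < top" "\<And>f. f \<in> D1 \<Longrightarrow>
    power_integral (wmeasure M w) q f < top \<Longrightarrow>
    emeasure (wmeasure M w) {x. 3 < norm (T f x)} \<le>
      C * (emeasure (wmeasure M w) {x. 1 < maximal M (\<lambda>x. norm_powr (f x) p0) x} +
        (\<integral>\<^sup>+x\<in>{x. maximal M (\<lambda>x. norm_powr (f x) p0) x \<le> 1}. norm_powr (f x) q \<partial>wmeasure M w))"
proof -
  define N where "N = wmeasure M w"
  note N = N[folded N_def] and posN = posN[folded N_def] and dil = dil[folded N_def]
    and weak = weak[folded N_def] and b = b[folded N_def] and c = c[folded N_def]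
  note setsM = doubling_measure_sets[OF M] and spaceM = doubling_measure_space[OF M]
  have sets: "sets N = sets M" by (simp add: N_def)
  have setsN: "sets N = sets borel" by (simp add: sets setsM)
  have space: "space N = UNIV" by (rule doubling_measure_space[OF N])
  have meas: "f \<in> borel_measurable N \<longleftrightarrow> f \<in> borel_measurable M" for f :: "'a \<Rightarrow> 'b::topological_space"
    using measurable_cong_sets[OF sets refl] by blast
  have balls: "ball x r \<in> sets M" for x r by (simp add: setsM)
  have finM: "emeasure M (ball x r) < top" for x r by (rule doubling_measure_finite[OF M])
  obtain C4 where C4: "C4 < top" "\<And>x r. 0 < r \<Longrightarrow> emeasure M (ball x (4 * r)) \<le> C4 * emeasure M (ball x r)"
    using doubling_measure_four[OF M] by blast
  \<comment> \<open>Four times a Whitney ball contains a point outside \<open>E\<close>, where the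
    maximal function is at most 1. Doubling bounds the mean of |b_i|^p0 over the ball by
    \<open>C4\<close>, hence its L^p0 average by \<open>c0\<close>.\<close>
  define c0 where "c0 = enn_powr C4 (1 / p0)"
  have c0: "c0 < top" using C4 p0 by (simp add: c0_def enn_powr_less_top_iff)
  have "Kb * enn_powr c0 q < top" using Kb c0 q by (simp add: ennreal_mult_less_top enn_powr_less_top_iff)
  then obtain C1 :: ennreal where C1: "C1 < top"
    "\<And>J E g. separated_balls E J \<Longrightarrow> E \<in> sets N \<Longrightarrow>
      (\<And>i. i \<in> J \<Longrightarrow> g i \<in> borel_measurable N) \<Longrightarrow>
      (\<And>i j. i \<in> J \<Longrightarrow> 1 \<le> j \<Longrightarrow> (\<integral>\<^sup>+x\<in>annulus j (fst i) (snd i). enn_powr (g i x) q \<partial>N) \<le>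
        (Kb * enn_powr c0 q) * ennreal (\<alpha> j powr q) * emeasure N (ball (fst i) (2 ^ (j + 1) * snd i))) \<Longrightarrow>
      (\<integral>\<^sup>+x. enn_powr (\<Sum>i\<in>J. g i x) q \<partial>N) \<le> C1 * emeasure N E"
    using off_diagonal_sum_Lq_bound[OF N posN Cd dil q _ \<alpha>] by blast
  have "Kc * c0 < top" using Kc c0 by (simp add: ennreal_mult_less_top)
  then obtain C2 :: ennreal where C2: "C2 < top"
    "\<And>J E g. separated_balls E J \<Longrightarrow> E \<in> sets N \<Longrightarrow>
      (\<And>i. i \<in> J \<Longrightarrow> g i \<in> borel_measurable N) \<Longrightarrow>
      (\<And>i j. i \<in> J \<Longrightarrow> 2 \<le> j \<Longrightarrow> (\<integral>\<^sup>+x\<in>annulus j (fst i) (snd i). g i x \<partial>N) \<le>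
        (Kc * c0) * ennreal (\<gamma> j) * emeasure N (ball (fst i) (2 ^ (j + 1) * snd i))) \<Longrightarrow>
      emeasure N {x. 1 < (\<Sum>i\<in>J. g i x)} \<le> C2 * emeasure N E"
    using off_diagonal_sum_weak_bound[OF setsN Cd dil _ \<gamma>] by blast
  define C where "C = 1 + Cw + Cw * C1 + C2"
  have "emeasure N {x. 3 < norm (T f x)} \<le> C * (emeasure N {x. 1 < maximal M (\<lambda>x. norm_powr (f x) p0) x} +
        (\<integral>\<^sup>+x\<in>{x. maximal M (\<lambda>x. norm_powr (f x) p0) x \<le> 1}. norm_powr (f x) q \<partial>N))"
    if f: "f \<in> D1" and fq: "power_integral N q f < top" for f
  proof -
    have Tm [measurable]: "T g \<in> borel_measurable M" if "g \<in> D2" for g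
      using T that by (simp add: sublinear_operator_def)
    have fm [measurable]: "f \<in> borel_measurable M" using f D by blast
    let ?h = "\<lambda>x. norm_powr (f x) p0" and ?fq = "\<lambda>x. norm_powr (f x) q"
    have fqm: "?fq \<in> borel_measurable N" unfolding meas by measurable
    define E where "E = {x. 1 < maximal M ?h x}"
    have oE: "open E" unfolding E_def by (rule open_maximal_level_set)
    then have sE: "E \<in> sets N" by (simp add: setsN)
    have cE: "{x. maximal M ?h x \<le> 1} = - E" by (auto simp: E_def)
    have "emeasure N {x. 3 < norm (T f x)} \<le> C * (emeasure N E + (\<integral>\<^sup>+x\<in>- E. ?fq x \<partial>N))"
    \<comment> \<open>In these cases the bound is immediate from \<open>C >= 1\<close>. Otherwise
      the complement is nonempty, as Whitney balls require, and finite measure of \<open>E\<close>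
      puts \<open>f2\<close> into L^q(w), where the weak type bound applies.\<close>
    proof (cases "E = UNIV \<or> emeasure N E = top")
      case True
      have "emeasure N {x. 3 < norm (T f x)} \<le> emeasure N E"
      proof (cases "E = UNIV")
        case True
        then show ?thesis using emeasure_space[of N] by (simp add: space)
      next
        case False
        then show ?thesis using True by simp
      qed
      also have "\<dots> \<le> C * (emeasure N E + (\<integral>\<^sup>+x\<in>- E. ?fq x \<partial>N))"
      proof -
        have "1 \<le> C" by (simp add: C_def add.assoc)
        then have "1 * (emeasure N E + 0) \<le> C * (emeasure N E + (\<integral>\<^sup>+x\<in>- E. ?fq x \<partial>N))"
          by (intro mult_mono add_left_mono) auto
        then show ?thesis by simp
      qed
      finally show ?thesis .
    next
      case False
      then have E: "E \<noteq> UNIV" "emeasure N E < top" by (auto simp: less_top)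
      obtain U :: "nat \<Rightarrow> 'a set" and J :: "nat \<Rightarrow> ('a \<times> real) set"
        where U: "incseq U" "(\<Union>n. U n) = E" "\<And>n. open (U n)" and sep: "\<And>n. separated_balls E (J n)"
          and J5: "\<And>n i. i \<in> J n \<Longrightarrow> \<not> ball (fst i) (4 * snd i) \<subseteq> E"
          "\<And>n. U n \<subseteq> (\<Union>i\<in>J n. pball i)"
        by (rule Whitney_balls[OF oE E(1)]) blast
      have J: "finite (J n)" for n using sep by (simp add: separated_balls_def)
      have pos: "0 < snd i" if "i \<in> J n" for n i using sep that by (auto simp: separated_balls_def)
      have step: "emeasure N {x. 3 < norm (T f x)} \<le> Cw * (\<integral>\<^sup>+x\<in>- U n. ?fq x \<partial>N) + (Cw * C1 + C2) * emeasure N E" for n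
      proof -
        have sU: "U n \<in> sets M" "- U n \<in> sets M" using U(3)[of n] by (auto simp: setsM)
        have "\<exists>P. (\<forall>i\<in>J n. P i \<in> sets M \<and> P i \<subseteq> pball i) \<and>
            disjoint_family_on P (J n) \<and> (\<Union>i\<in>J n. P i) = U n"
          by (rule finite_disjoint_refinement[OF J balls sU(1) J5(2)])
        then obtain P where P: "\<And>i. i \<in> J n \<Longrightarrow> P i \<in> sets M" "\<And>i. i \<in> J n \<Longrightarrow> P i \<subseteq> pball i"
          "disjoint_family_on P (J n)" "(\<Union>i\<in>J n. P i) = U n"
          by blast
        define bb where "bb i y = indicator (P i) y * f y" for i y
        have bD: "bb i \<in> D1" if "i \<in> J n" for i
          using trunc f P(1)[OF that] unfolding truncation_stable_def bb_def by blast
        have bsupp: "bb i y = 0" if "i \<in> J n" "y \<notin> pball i" for i y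
          using P(2)[OF that(1)] that(2) by (auto simp: bb_def split: split_indicator)
        have bavg: "Lp_average (ennreal p0) M (pball i) (pball i) (bb i) \<le> c0" if i: "i \<in> J n" for i
        proof -
          let ?B = "pball i" and ?B4 = "ball (fst i) (4 * snd i)"
          obtain z where z: "z \<in> ?B4" "z \<notin> E" using J5(1)[OF i] by blast
          have r: "0 < 4 * snd i" using pos[OF i] by simp
          have "average M ?B4 ?h \<le> maximal M ?h z" by (rule average_le_maximal[OF r z(1)])
          also have "\<dots> \<le> 1" using z(2) by (simp add: E_def)
          finally have avg: "average M ?B4 ?h \<le> 1" .
          have "(\<integral>\<^sup>+x\<in>?B. norm_powr (bb i x) p0 \<partial>M) \<le> (\<integral>\<^sup>+x\<in>?B4. ?h x \<partial>M)"
            using p0 pos[OF i] by (intro nn_integral_mono) (auto simp: bb_def split: split_indicator)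
          also have "\<dots> \<le> emeasure M ?B4"
          proof (cases "emeasure M ?B4 = 0")
            case True
            then have "?B4 \<in> null_sets M" using balls by auto
            then show ?thesis by (simp add: nn_integral_null_set)
          next
            case False
            have "(\<integral>\<^sup>+x\<in>?B4. ?h x \<partial>M) = average M ?B4 ?h * emeasure M ?B4"
              by (rule nn_integral_average[OF False finM])
            also have "\<dots> \<le> 1 * emeasure M ?B4" by (intro mult_right_mono avg) simp
            finally show ?thesis by simp
          qed
          also have "\<dots> \<le> C4 * emeasure M ?B" by (rule C4(2)[OF pos[OF i]])
          finally have "(\<integral>\<^sup>+x\<in>?B. norm_powr (bb i x) p0 \<partial>M) / emeasure M ?B \<le> C4"
            by (rule ennreal_divide_leI)
          then show ?thesis
            using p0 by (simp add: Lp_average_def c0_def enn_powr_mono)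
        qed
        define AA where "AA i = A (snd i) (bb i)" for i
        have AD: "AA i \<in> D2" if "i \<in> J n" for i unfolding AA_def by (rule A[OF pos[OF that] bD[OF that]])
        have dD: "(\<lambda>y. bb i y - AA i y) \<in> D2" if "i \<in> J n" for i
          using bD[OF that] AD[OF that] D(3) by (intro function_subspace_diff[OF D(2)]) auto
        define f1 where "f1 y = indicator (- U n) y * f y" for y
        define f2 where "f2 y = (\<Sum>i\<in>J n. AA i y)" for y
        have f1D: "f1 \<in> D2"
          using trunc f sU D(3) unfolding truncation_stable_def f1_def by blast
        have f2D: "f2 \<in> D2" unfolding f2_def by (rule function_subspace_sum[OF D(2) J AD])
        let ?S = "\<lambda>y. \<Sum>i\<in>J n. bb i y - AA i y"
        have SD: "?S \<in> D2" by (rule function_subspace_sum[OF D(2) J dD])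
        have f2SD: "(\<lambda>y. f2 y + ?S y) \<in> D2" using D(2) f2D SD by (simp add: function_subspace_def)
        \<comment> \<open>An identity at every point, since it is substituted inside
          \<open>T\<close>, whose arguments are functions and not classes.\<close>
        have dec: "f = (\<lambda>y. f1 y + (f2 y + ?S y))"
        proof
          fix y
          have "(\<Sum>i\<in>J n. bb i y) = (\<Sum>i\<in>J n. indicator (P i) y) * f y" by (simp add: bb_def sum_distrib_right)
          also have "(\<Sum>i\<in>J n. indicator (P i) y) = (indicator (U n) y :: complex)"
            unfolding P(4)[symmetric] by (rule indicator_UN_disjoint[OF J P(3), symmetric])
          finally have "(\<Sum>i\<in>J n. bb i y) = indicator (U n) y * f y" .
          then show "f y = f1 y + (f2 y + ?S y)"
            by (simp add: f1_def f2_def sum_subtractf split: split_indicator)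
        qed
        have "AE x in M. norm (T (\<lambda>y. f1 y + (f2 y + ?S y)) x) \<le> norm (T f1 x) + norm (T (\<lambda>y. f2 y + ?S y) x)"
          using T f1D f2SD by (simp add: sublinear_operator_def)
        then have ae1: "AE x in M. norm (T f x) \<le> norm (T f1 x) + norm (T (\<lambda>y. f2 y + ?S y) x)"
          by (simp only: dec[symmetric])
        have ae2: "AE x in M. norm (T (\<lambda>y. f2 y + ?S y) x) \<le> norm (T f2 x) + (\<Sum>i\<in>J n. norm (T (\<lambda>y. bb i y - AA i y) x))"
          by (rule sublinear_operator_sum[OF T D(2) J dD f2D])
        let ?R = "\<lambda>x. \<Sum>i\<in>J n. norm (T (\<lambda>y. bb i y - AA i y) x)"
        have ae: "AE x in M. norm (T f x) \<le> norm (T f1 x) + (norm (T f2 x) + ?R x)"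
          using ae1 ae2 by eventually_elim linarith
        have lev1: "{x. 1 < norm (T f1 x)} \<in> sets N" and lev2: "{x. 1 < norm (T f2 x)} \<in> sets N"
          and lev3: "{x. 1 < ?R x} \<in> sets N"
        proof -
          have "{x\<in>space M. 1 < norm (T f1 x)} \<in> sets M" using Tm[OF f1D] by measurable
          then show "{x. 1 < norm (T f1 x)} \<in> sets N" by (simp add: spaceM sets)
          have "{x\<in>space M. 1 < norm (T f2 x)} \<in> sets M" using Tm[OF f2D] by measurable
          then show "{x. 1 < norm (T f2 x)} \<in> sets N" by (simp add: spaceM sets)
          have "?R \<in> borel_measurable M"
          proof (rule borel_measurable_sum)
            fix i assume "i \<in> J n"
            from Tm[OF dD[OF this]] show "(\<lambda>x. norm (T (\<lambda>y. bb i y - AA i y) x)) \<in> borel_measurable M"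
              by measurable
          qed
          then have "{x\<in>space M. 1 < ?R x} \<in> sets M" by measurable
          then show "{x. 1 < ?R x} \<in> sets N" by (simp add: spaceM sets)
        qed
        \<comment> \<open>If a sum of three terms exceeds 3, one of the terms exceeds 1.\<close>
        have "emeasure N {x. 3 < norm (T f x)} \<le> emeasure N ({x. 1 < norm (T f1 x)} \<union> ({x. 1 < norm (T f2 x)} \<union> {x. 1 < ?R x}))"
        proof (rule emeasure_mono_AE)
          have "AE x in M. x \<in> {x. 3 < norm (T f x)} \<longrightarrow> x \<in> {x. 1 < norm (T f1 x)} \<union> ({x. 1 < norm (T f2 x)} \<union> {x. 1 < ?R x})"
            using ae by eventually_elim auto
          then show "AE x in N. x \<in> {x. 3 < norm (T f x)} \<longrightarrow> x \<in> {x. 1 < norm (T f1 x)} \<union> ({x. 1 < norm (T f2 x)} \<union> {x. 1 < ?R x})"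
            unfolding N_def by (rule AE_wmeasure[OF wt])
        qed (intro sets.Un lev1 lev2 lev3)
        also have "\<dots> \<le> emeasure N {x. 1 < norm (T f1 x)} + emeasure N ({x. 1 < norm (T f2 x)} \<union> {x. 1 < ?R x})"
          by (intro emeasure_subadditive sets.Un lev1 lev2 lev3)
        also have "\<dots> \<le> emeasure N {x. 1 < norm (T f1 x)} + (emeasure N {x. 1 < norm (T f2 x)} + emeasure N {x. 1 < ?R x})"
          by (intro add_left_mono emeasure_subadditive lev2 lev3)
        also have "\<dots> \<le> Cw * (\<integral>\<^sup>+x\<in>- U n. ?fq x \<partial>N) + (Cw * (C1 * emeasure N E) + C2 * emeasure N E)"
        proof (intro add_mono)
          have eq: "power_integral N q f1 = (\<integral>\<^sup>+x\<in>- U n. ?fq x \<partial>N)"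
            using q by (intro nn_integral_cong) (auto simp: f1_def split: split_indicator)
          have "(\<integral>\<^sup>+x\<in>- U n. ?fq x \<partial>N) \<le> (\<integral>\<^sup>+x. ?fq x \<partial>N)"
            by (intro nn_integral_mono) (auto split: split_indicator)
          then show "emeasure N {x. 1 < norm (T f1 x)} \<le> Cw * (\<integral>\<^sup>+x\<in>- U n. ?fq x \<partial>N)"
            using weak[OF f1D] fq unfolding eq by (meson le_less_trans)
          have "power_integral N q f2 \<le> (\<integral>\<^sup>+x. enn_powr (\<Sum>i\<in>J n. ennreal (norm (AA i x))) q \<partial>N)"
            using q by (intro nn_integral_mono enn_powr_mono) (auto simp: f2_def intro!: ennreal_leI norm_sum)
          also have "\<dots> \<le> C1 * emeasure N E"
          proof (rule C1(2)[OF sep sE])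
            show "(\<lambda>x. ennreal (norm (AA i x))) \<in> borel_measurable N" if "i \<in> J n" for i
            proof -
              have [measurable]: "AA i \<in> borel_measurable M" using AD[OF that] D(4) by blast
              show ?thesis unfolding meas by measurable
            qed
            fix i and j :: nat assume i: "i \<in> J n" and j: "1 \<le> j"
            let ?V = "emeasure N (ball (fst i) (2 ^ (j + 1) * snd i))"
            have "(\<integral>\<^sup>+x\<in>annulus j (fst i) (snd i). norm_powr (AA i x) q \<partial>N) \<le>
              Kb * ?V * enn_powr (ennreal (\<alpha> j) * Lp_average (ennreal p0) M (pball i) (pball i) (bb i)) q"
              unfolding AA_def by (rule b[OF j pos[OF i] bD[OF i] bsupp[OF i]])
            also have "\<dots> \<le> Kb * ?V * enn_powr (ennreal (\<alpha> j) * c0) q"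
              using q by (intro mult_left_mono enn_powr_mono bavg i) auto
            also have "\<dots> = (Kb * enn_powr c0 q) * ennreal (\<alpha> j powr q) * ?V"
            proof -
              have "enn_powr (ennreal (\<alpha> j) * c0) q = ennreal (\<alpha> j powr q) * enn_powr c0 q"
                using q \<alpha>(1)[OF j] by (simp add: enn_powr_mult enn_powr_ennreal)
              then show ?thesis by (simp only: mult_ac)
            qed
            finally show "(\<integral>\<^sup>+x\<in>annulus j (fst i) (snd i). norm_powr (AA i x) q \<partial>N) \<le>
              (Kb * enn_powr c0 q) * ennreal (\<alpha> j powr q) * ?V" .
          qed
          finally have f2q: "power_integral N q f2 \<le> C1 * emeasure N E" .
          also have "\<dots> < top" using C1(1) E(2) by (simp add: ennreal_mult_less_top)
          finally have "emeasure N {x. 1 < norm (T f2 x)} \<le> Cw * power_integral N q f2"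
            by (rule weak[OF f2D])
          also have "\<dots> \<le> Cw * (C1 * emeasure N E)" by (intro mult_left_mono f2q) simp
          finally show "emeasure N {x. 1 < norm (T f2 x)} \<le> Cw * (C1 * emeasure N E)" .
          have "{x. 1 < ?R x} = {x. 1 < (\<Sum>i\<in>J n. ennreal (norm (T (\<lambda>y. bb i y - AA i y) x)))}"
            by (simp add: one_less_ennreal)
          also have "emeasure N \<dots> \<le> C2 * emeasure N E"
          proof (rule C2(2)[OF sep sE])
            show "(\<lambda>x. ennreal (norm (T (\<lambda>y. bb i y - AA i y) x))) \<in> borel_measurable N" if "i \<in> J n" for i
              unfolding meas using Tm[OF dD[OF that]] by measurable
            fix i and j :: nat assume i: "i \<in> J n" and j: "2 \<le> j"
            let ?V = "emeasure N (ball (fst i) (2 ^ (j + 1) * snd i))"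
            have "(\<integral>\<^sup>+x\<in>annulus j (fst i) (snd i). ennreal (norm (T (\<lambda>y. bb i y - AA i y) x)) \<partial>N) \<le>
              Kc * ?V * (ennreal (\<gamma> j) * Lp_average (ennreal p0) M (pball i) (pball i) (bb i))"
              unfolding AA_def by (rule c[OF j pos[OF i] bD[OF i] bsupp[OF i]])
            also have "\<dots> \<le> Kc * ?V * (ennreal (\<gamma> j) * c0)"
              by (intro mult_left_mono bavg i) auto
            also have "\<dots> = (Kc * c0) * ennreal (\<gamma> j) * ?V" by (simp only: mult_ac)
            finally show "(\<integral>\<^sup>+x\<in>annulus j (fst i) (snd i). ennreal (norm (T (\<lambda>y. bb i y - AA i y) x)) \<partial>N) \<le>
              (Kc * c0) * ennreal (\<gamma> j) * ?V" .
          qed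
          finally show "emeasure N {x. 1 < ?R x} \<le> C2 * emeasure N E" .
        qed
        also have "\<dots> = Cw * (\<integral>\<^sup>+x\<in>- U n. ?fq x \<partial>N) + (Cw * C1 + C2) * emeasure N E"
          by (simp add: distrib_right mult.assoc)
        finally show ?thesis .
      qed
      \<comment> \<open>The constants in \<open>step\<close> do not depend on \<open>n\<close>, so
        only this integral has to be followed to the limit; \<open>fq\<close> gives the finiteness
        that continuity from above requires.\<close>
      have lim: "(\<lambda>n. \<integral>\<^sup>+x\<in>- U n. ?fq x \<partial>N) \<longlonglongrightarrow> (\<integral>\<^sup>+x\<in>- E. ?fq x \<partial>N)"
      proof -
        have "(\<lambda>n. \<integral>\<^sup>+x\<in>- U n. ?fq x \<partial>N) \<longlonglongrightarrow> (\<integral>\<^sup>+x\<in>(\<Inter>n. - U n). ?fq x \<partial>N)"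
        proof (rule tendsto_set_nn_integral_decseq[OF _ _ fqm fq])
          show "decseq (\<lambda>n. - U n)" using U(1) unfolding incseq_def decseq_def by blast
          show "- U n \<in> sets N" for n using U(3)[of n] by (auto simp: setsN)
        qed
        moreover have "(\<Inter>n. - U n) = - E" using U(2) by blast
        ultimately show ?thesis by simp
      qed
      have "(\<lambda>n. Cw * (\<integral>\<^sup>+x\<in>- U n. ?fq x \<partial>N) + (Cw * C1 + C2) * emeasure N E) \<longlonglongrightarrow>
          Cw * (\<integral>\<^sup>+x\<in>- E. ?fq x \<partial>N) + (Cw * C1 + C2) * emeasure N E"
        by (intro tendsto_add ennreal_tendsto_cmult lim Cw tendsto_const)
      then have "emeasure N {x. 3 < norm (T f x)} \<le> Cw * (\<integral>\<^sup>+x\<in>- E. ?fq x \<partial>N) + (Cw * C1 + C2) * emeasure N E"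
        by (rule LIMSEQ_le_const) (use step in blast)
      also have "\<dots> \<le> C * (\<integral>\<^sup>+x\<in>- E. ?fq x \<partial>N) + C * emeasure N E"
        by (intro add_mono mult_right_mono) (simp_all add: C_def add_increasing add_increasing2 add.assoc)
      finally show ?thesis by (simp add: distrib_left add.commute)
    qed
    then show ?thesis unfolding cE by (simp add: E_def)
  qed
  moreover have "C < top" using Cw C1 C2 by (simp add: C_def ennreal_mult_less_top)
  ultimately show thesis by (intro that) (auto simp: N_def)
qed

section \<open>Integration over the levels\<close>

lemma maximal_cmult:
  assumes M: "doubling_measure M" and [measurable]: "h \<in> borel_measurable M"
  shows "maximal M (\<lambda>x. c * h x) y = c * maximal M h y"
proof -
  have "average M (ball x r) (\<lambda>x. c * h x) = c * average M (ball x r) h" for x r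
  proof -
    have [measurable]: "ball x r \<in> sets M" by (simp add: doubling_measure_sets[OF M])
    show ?thesis by (simp add: average_def mult.assoc nn_integral_cmult ennreal_times_divide)
  qed
  then show ?thesis by (simp add: maximal_def SUP_mult_left_ennreal)
qed

text \<open>By Tonelli, for fixed x the integral over t is p \<phi>^q times that of t^(p-q-1) over t
  >= \<phi>, finite because p < q; the powers of \<phi> recombine to \<phi>^p.\<close>

lemma tail_integral:
  assumes N: "sigma_finite_measure N" and pq: "0 < p" "p < q"
    and [measurable]: "\<phi> \<in> borel_measurable N" and pos: "\<And>x. 0 \<le> \<phi> x"
  shows "(\<integral>\<^sup>+t. ennreal (p * t powr (p - 1)) * indicator {0<..} t *
      (\<integral>\<^sup>+x. (if \<phi> x \<le> t then ennreal ((\<phi> x / t) powr q) else 0) \<partial>N) \<partial>lborel) \<le>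
    ennreal (p / (q - p)) * (\<integral>\<^sup>+x. ennreal (\<phi> x powr p) \<partial>N)"
proof -
  interpret pair_sigma_finite lborel N
    using N by (simp add: pair_sigma_finite_def lborel.sigma_finite_measure_axioms)
  let ?f = "\<lambda>t x. ennreal (p * t powr (p - 1)) * indicator {0<..} t * (if \<phi> x \<le> t then ennreal ((\<phi> x / t) powr q) else 0)"
  have "(\<integral>\<^sup>+t. ennreal (p * t powr (p - 1)) * indicator {0<..} t *
      (\<integral>\<^sup>+x. (if \<phi> x \<le> t then ennreal ((\<phi> x / t) powr q) else 0) \<partial>N) \<partial>lborel) = (\<integral>\<^sup>+t. \<integral>\<^sup>+x. ?f t x \<partial>N \<partial>lborel)"
    by (intro nn_integral_cong nn_integral_cmult[symmetric]) measurable
  also have "\<dots> = (\<integral>\<^sup>+x. \<integral>\<^sup>+t. ?f t x \<partial>lborel \<partial>N)"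
    by (rule Fubini'[symmetric]) measurable
  also have "\<dots> \<le> (\<integral>\<^sup>+x. ennreal (p / (q - p)) * ennreal (\<phi> x powr p) \<partial>N)"
  proof (rule nn_integral_mono)
    fix x
    show "(\<integral>\<^sup>+t. ?f t x \<partial>lborel) \<le> ennreal (p / (q - p)) * ennreal (\<phi> x powr p)"
    proof (cases "\<phi> x = 0")
      case True
      then have zero: "?f t x = 0" for t by (cases "\<phi> x \<le> t") auto
      show ?thesis unfolding zero by simp
    next
      case False
      then have fx: "0 < \<phi> x" using pos[of x] by simp
      have "(\<integral>\<^sup>+t. ?f t x \<partial>lborel) = (\<integral>\<^sup>+t. ennreal (p * \<phi> x powr q) * (ennreal (t powr (- (q - p) - 1)) * indicator {\<phi> x..} t) \<partial>lborel)"
      proof (rule nn_integral_cong)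
        fix t :: real
        show "?f t x = ennreal (p * \<phi> x powr q) * (ennreal (t powr (- (q - p) - 1)) * indicator {\<phi> x..} t)"
        proof (cases "\<phi> x \<le> t")
          case True
          then have t: "0 < t" using fx by simp
          have "t powr (p - 1) * (\<phi> x / t) powr q = \<phi> x powr q * t powr (- (q - p) - 1)"
          proof -
            have "- (q - p) - 1 = (p - 1) - q" by simp
            then have "t powr (- (q - p) - 1) = t powr (p - 1) / t powr q" by (simp only: powr_diff)
            then show ?thesis using t fx by (simp add: powr_divide)
          qed
          then have "p * t powr (p - 1) * (\<phi> x / t) powr q = p * \<phi> x powr q * t powr (- (q - p) - 1)"
            by simp
          then show ?thesis using True t pq by (simp flip: ennreal_mult')
        qed simp
      qed
      also have "\<dots> = ennreal (p * \<phi> x powr q) * ennreal (\<phi> x powr (- (q - p)) / (q - p))"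
        using pq fx by (subst nn_integral_cmult) (simp_all only: nn_integral_powr_ge diff_gt_0_iff_gt, measurable)
      also have "\<dots> = ennreal (p / (q - p)) * ennreal (\<phi> x powr p)"
      proof -
        have "\<phi> x powr q * \<phi> x powr (- (q - p)) = \<phi> x powr p" by (simp flip: powr_add)
        then have "p * \<phi> x powr q * (\<phi> x powr (- (q - p)) / (q - p)) = p / (q - p) * \<phi> x powr p" by simp
        then show ?thesis using pq by (simp flip: ennreal_mult del: times_divide_eq_right times_divide_eq_left)
      qed
      finally show ?thesis by simp
    qed
  qed
  also have "\<dots> = ennreal (p / (q - p)) * (\<integral>\<^sup>+x. ennreal (\<phi> x powr p) \<partial>N)"
    by (rule nn_integral_cmult) measurable
  finally show ?thesis .
qed

text \<open>Bridges the assumption f in L^p(w) and the level estimate, which presupposes f in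
  L^q(w). For infinite q0 the factor |f|^(q-p) is essentially bounded; otherwise |f|^q is at most
  |f|^p + |f|^q0. Only finiteness is wanted, so no sharp interpolation inequality is proved.\<close>

lemma nn_integral_interpolation:
  assumes f: "f \<in> Lp_space q0 N" and pq: "0 < p" "p < q" "ennreal q < q0"
    and fp: "power_integral N p f < top"
  shows "power_integral N q f < top"
proof -
  have [measurable]: "f \<in> borel_measurable N" and norm: "Lp_norm q0 N f < top"
    using f by (auto simp: Lp_space_def)
  show ?thesis
  proof (cases "q0 = top")
    case True
    define L where "L = esssup N (\<lambda>x. ennreal (norm (f x)))"
    have L: "L < top" using norm True by (simp add: L_def Lp_norm_def)
    have "AE x in N. ennreal (norm (f x)) \<le> L" unfolding L_def by (rule esssup_AE)
    then have "AE x in N. norm_powr (f x) q \<le> enn_powr L (q - p) * norm_powr (f x) p"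
    proof eventually_elim
      case (elim x)
      have "norm_powr (f x) ((q - p) + p) = norm_powr (f x) (q - p) * norm_powr (f x) p"
        by (rule enn_powr_add) (use pq in auto)
      also have "\<dots> \<le> enn_powr L (q - p) * norm_powr (f x) p"
        using elim pq by (intro mult_right_mono enn_powr_mono) auto
      finally show ?case by simp
    qed
    then have "power_integral N q f \<le> (\<integral>\<^sup>+x. enn_powr L (q - p) * norm_powr (f x) p \<partial>N)"
      by (rule nn_integral_mono_AE)
    also have "\<dots> = enn_powr L (q - p) * power_integral N p f"
      by (rule nn_integral_cmult) measurable
    also have "\<dots> < top" using L fp pq by (simp add: ennreal_mult_less_top enn_powr_less_top_iff)
    finally show ?thesis .
  next
    case False
    then obtain s where s: "q0 = ennreal s" "0 \<le> s" by (cases q0) auto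
    then have qs: "q < s" using pq by (simp add: ennreal_less_iff)
    have fs: "power_integral N s f < top"
      using norm s qs pq by (simp add: Lp_norm_def enn_powr_less_top_iff)
    have "power_integral N q f \<le>
      (\<integral>\<^sup>+x. norm_powr (f x) p + norm_powr (f x) s \<partial>N)"
    proof (rule nn_integral_mono)
      fix x
      have "norm (f x) powr q \<le> norm (f x) powr p + norm (f x) powr s"
      proof (cases "norm (f x) \<le> 1")
        case True
        then have "norm (f x) powr q \<le> norm (f x) powr p" using pq by (intro powr_mono') auto
        then show ?thesis by (simp add: add_increasing2)
      next
        case False
        then have "norm (f x) powr q \<le> norm (f x) powr s" using qs by (intro powr_mono) auto
        then show ?thesis by (simp add: add_increasing)
      qed
      then show "norm_powr (f x) q \<le> norm_powr (f x) p + norm_powr (f x) s"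
        using pq qs by (simp add: enn_powr_ennreal ennreal_leI flip: ennreal_plus)
    qed
    also have "\<dots> = power_integral N p f + power_integral N s f"
      by (rule nn_integral_add) measurable
    also have "\<dots> < top" using fp fs by simp
    finally show ?thesis .
  qed
qed

text \<open>Applied to f/t, the estimate at height 1 becomes one at height t by homogeneity of
  \<open>T\<close>. After integration against p t^(p-1), the first term is the integral of the
  maximal function to the power p/p0, which Muckenhoupt's theorem bounds, and the second is
  \<open>tail_integral\<close>.\<close>

lemma strong_type_of_level_estimate:
  fixes M :: "'a::{second_countable_topology,complete_space} measure"
  assumes M: "doubling_measure M" and N: "doubling_measure (wmeasure M w)"
    and posN: "\<And>x r. 0 < r \<Longrightarrow> 0 < emeasure (wmeasure M w) (ball x r)"
    and w: "w \<in> A_class M (p / p0)" and pq: "1 \<le> p0" "p0 < p" "p < q"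
    and D: "function_subspace D1" "D1 \<subseteq> D2" "D2 \<subseteq> borel_measurable M"
    and T: "sublinear_operator M D2 T"
    and C: "C < top" and level: "\<And>f. f \<in> D1 \<Longrightarrow>
      power_integral (wmeasure M w) q f < top \<Longrightarrow>
      emeasure (wmeasure M w) {x. 3 < norm (T f x)} \<le>
      C * (emeasure (wmeasure M w) {x. 1 < maximal M (\<lambda>x. norm_powr (f x) p0) x} +
        (\<integral>\<^sup>+x\<in>{x. maximal M (\<lambda>x. norm_powr (f x) p0) x \<le> 1}. norm_powr (f x) q \<partial>wmeasure M w))"
  obtains K :: ennreal where "K < top" "\<And>f. f \<in> D1 \<Longrightarrow>
      power_integral (wmeasure M w) q f < top \<Longrightarrow>
      power_integral (wmeasure M w) p (T f) \<le> K * power_integral (wmeasure M w) p f"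
proof -
  define N where "N = wmeasure M w"
  note N = N[folded N_def] and posN = posN[folded N_def] and level = level[folded N_def]
  have wt: "weight M w" using w by (simp add: A_class_def)
  note setsM = doubling_measure_sets[OF M] and spaceM = doubling_measure_space[OF M]
  have sets: "sets N = sets M" by (simp add: N_def)
  have space: "space N = UNIV" by (rule doubling_measure_space[OF N])
  have meas: "f \<in> borel_measurable N \<longleftrightarrow> f \<in> borel_measurable M" for f :: "'a \<Rightarrow> 'b::topological_space"
    using measurable_cong_sets[OF sets refl] by blast
  interpret N: sigma_finite_measure N by (rule doubling_measure_sigma_finite[OF N])
  have p: "0 < p" "0 < p0" "0 < q" using pq by auto
  obtain Km :: ennreal where Km: "Km < top"
    "\<And>h. h \<in> borel_measurable M \<Longrightarrow>
      (\<integral>\<^sup>+x. enn_powr (maximal M h x) (p / p0) \<partial>N) \<le> Km * (\<integral>\<^sup>+x. enn_powr (h x) (p / p0) \<partial>N)"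
    using Muckenhoupt[OF M N[unfolded N_def] w _ posN[unfolded N_def]] pq p unfolding N_def by (metis less_divide_eq_1_pos)
  define K where "K = ennreal (3 powr p) * C * (Km + ennreal (p / (q - p)))"
  have "power_integral N p (T f) \<le> K * power_integral N p f"
    if f: "f \<in> D1" and fq: "power_integral N q f < top" for f
  proof -
    have fm [measurable]: "f \<in> borel_measurable M" using f D by blast
    have Tm [measurable]: "T g \<in> borel_measurable M" if "g \<in> D1" for g
      using T that D by (auto simp: sublinear_operator_def)
    note Tfm [measurable] = Tm[OF f]
    let ?h = "\<lambda>x. norm_powr (f x) p0"
    have hm [measurable]: "?h \<in> borel_measurable M" by measurable
    define g where "g x = enn_powr (maximal M ?h x) (1 / p0)" for x
    have gm: "g \<in> borel_measurable N"
      using borel_measurable_maximal[OF M] unfolding meas g_def by measurable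
    have fg: "AE x in N. ennreal (norm (f x)) \<le> g x"
      unfolding N_def
    proof (rule AE_wmeasure[OF wt])
      show "AE x in M. ennreal (norm (f x)) \<le> g x"
        using AE_le_maximal[OF M hm]
      proof eventually_elim
        case (elim x)
        from enn_powr_mono[OF _ this, of "1 / p0"] show ?case using p by (simp add: g_def)
      qed
    qed
    let ?H = "\<lambda>t. \<integral>\<^sup>+x. (if norm (f x) \<le> t then ennreal ((norm (f x) / t) powr q) else 0) \<partial>N"
    have lev: "emeasure N {x. ennreal t < ennreal (norm (T f x) / 3)} \<le> C * (emeasure N {x. ennreal t < g x} + ?H t)"
      if t: "0 < t" for t :: real
    proof -
      define F where "F y = complex_of_real (1 / t) * f y" for y
      have F: "F \<in> D1" using D(1) f unfolding function_subspace_def F_def by blast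
      note TF [measurable] = Tm[OF F]
      have F_eq: "F = (\<lambda>y. complex_of_real (1 / t) * f y)" by (simp add: F_def fun_eq_iff)
      have nF: "norm (F y) = norm (f y) / t" for y using t by (simp add: F_def norm_mult norm_divide)
      have Fq: "norm_powr (F x) q = ennreal ((norm (f x) / t) powr q)" for x
        using p t by (simp add: nF enn_powr_ennreal)
      have "AE x in M. norm (T F x) = norm (complex_of_real (1 / t)) * norm (T f x)"
        using T f D(2) unfolding sublinear_operator_def F_eq by blast
      then have "AE x in M. norm (T F x) = norm (T f x) / t"
        using t by (simp add: norm_divide)
      then have "AE x in M. x \<in> {x. ennreal t < ennreal (norm (T f x) / 3)} \<longrightarrow> x \<in> {x. 3 < norm (T F x)}"
        by eventually_elim (use t in \<open>auto simp: ennreal_less_iff pos_less_divide_eq\<close>)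
      then have ae: "AE x in N. x \<in> {x. ennreal t < ennreal (norm (T f x) / 3)} \<longrightarrow> x \<in> {x. 3 < norm (T F x)}"
        unfolding N_def by (rule AE_wmeasure[OF wt])
      have "{x\<in>space M. 3 < norm (T F x)} \<in> sets M" by measurable
      then have "emeasure N {x. ennreal t < ennreal (norm (T f x) / 3)} \<le> emeasure N {x. 3 < norm (T F x)}"
        by (intro emeasure_mono_AE ae) (simp add: sets spaceM)
      also have "\<dots> \<le> C * (emeasure N {x. 1 < maximal M (\<lambda>x. norm_powr (F x) p0) x} +
        (\<integral>\<^sup>+x\<in>{x. maximal M (\<lambda>x. norm_powr (F x) p0) x \<le> 1}. norm_powr (F x) q \<partial>N))"
      proof (rule level[OF F])
        have "power_integral N q F = (\<integral>\<^sup>+x. ennreal ((1 / t) powr q) * norm_powr (f x) q \<partial>N)"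
          using t p by (intro nn_integral_cong) (simp add: Fq enn_powr_ennreal powr_divide flip: ennreal_mult)
        also have "\<dots> = ennreal ((1 / t) powr q) * power_integral N q f"
          by (intro nn_integral_cmult) (simp add: meas)
        also have "\<dots> < top" using fq by (simp add: ennreal_mult_less_top)
        finally show "power_integral N q F < top" .
      qed
      also have "\<dots> \<le> C * (emeasure N {x. ennreal t < g x} + ?H t)"
      proof -
        have mF: "maximal M (\<lambda>x. norm_powr (F x) p0) x = ennreal ((1 / t) powr p0) * maximal M ?h x" for x
        proof -
          have "(\<lambda>x. norm_powr (F x) p0) = (\<lambda>x. ennreal ((1 / t) powr p0) * ?h x)"
            using t p by (auto simp: nF enn_powr_ennreal powr_divide simp flip: ennreal_mult)
          then show ?thesis by (simp only: maximal_cmult[OF M hm])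
        qed
        have iff: "1 < maximal M (\<lambda>x. norm_powr (F x) p0) x \<longleftrightarrow> ennreal t < g x" for x
        proof -
          have "ennreal t < g x \<longleftrightarrow> ennreal (t powr p0) < maximal M ?h x"
            using enn_powr_less_iff[of p0 "ennreal t" "g x"] p t by (simp add: g_def enn_powr_ennreal)
          also have "\<dots> \<longleftrightarrow> 1 < ennreal ((1 / t) powr p0) * maximal M ?h x"
          proof (cases "maximal M ?h x")
            case (real r)
            then show ?thesis using t
              by (simp add: ennreal_less_iff powr_divide field_simps flip: ennreal_mult)
          next
            case top
            then show ?thesis using t by (simp add: ennreal_mult_top)
          qed
          finally show ?thesis unfolding mF by simp
        qed
        \<comment> \<open>Off the superlevel set \<open>g x\<close> is at most \<open>t\<close>, and
          \<open>fg\<close> carries this over to |f|: the domain of integration is enlarged to a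
          sublevel set of |f|, as \<open>tail_integral\<close> expects.\<close>
        have "(\<integral>\<^sup>+x\<in>{x. maximal M (\<lambda>x. norm_powr (F x) p0) x \<le> 1}. norm_powr (F x) q \<partial>N) \<le> ?H t"
        proof (rule nn_integral_mono_AE, use fg in eventually_elim)
          case (elim x)
          show ?case
          proof (cases "maximal M (\<lambda>x. norm_powr (F x) p0) x \<le> 1")
            case True
            then have "g x \<le> ennreal t" using iff[of x] by (simp add: not_less[symmetric])
            then have "ennreal (norm (f x)) \<le> ennreal t" using elim by (rule order_trans[rotated])
            then have "norm (f x) \<le> t" using t by simp
            then show ?thesis using True by (simp add: Fq)
          qed simp
        qed
        then show ?thesis unfolding iff by (intro mult_left_mono add_left_mono) auto
      qed
      finally show ?thesis .
    qed
    let ?I = "\<integral>\<^sup>+x. norm_powr (f x) p \<partial>N"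
    let ?k = "\<lambda>t. ennreal (p * t powr (p - 1)) * indicator {0<..} t"
    have "(\<integral>\<^sup>+x. enn_powr (ennreal (norm (T f x) / 3)) p \<partial>N) = (\<integral>\<^sup>+t. ?k t * emeasure N {x. ennreal t < ennreal (norm (T f x) / 3)} \<partial>lborel)"
      using layer_cake_emeasure[OF N.sigma_finite_measure_axioms p(1), of "\<lambda>x. ennreal (norm (T f x) / 3)" UNIV] sets.top[of N]
      by (simp add: space meas)
    also have "\<dots> \<le> (\<integral>\<^sup>+t. C * (?k t * emeasure N {x. ennreal t < g x} + ?k t * ?H t) \<partial>lborel)"
    proof (rule nn_integral_mono)
      fix t :: real
      show "?k t * emeasure N {x. ennreal t < ennreal (norm (T f x) / 3)} \<le> C * (?k t * emeasure N {x. ennreal t < g x} + ?k t * ?H t)"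
      proof (cases "0 < t")
        case True
        from mult_left_mono[OF lev[OF True], of "?k t"] show ?thesis
          by (simp add: distrib_left mult_ac)
      qed simp
    qed
    also have "\<dots> = C * ((\<integral>\<^sup>+t. ?k t * emeasure N {x. ennreal t < g x} \<partial>lborel) + (\<integral>\<^sup>+t. ?k t * ?H t \<partial>lborel))"
    proof -
      have "(\<lambda>t. ?k t * emeasure N {x. ennreal t < g x}) \<in> borel_measurable lborel"
      proof -
        have "emeasure N {x. ennreal t < g x} = (\<integral>\<^sup>+x. (if ennreal t < g x then 1 else 0) \<partial>N)" for t
        proof -
          have "{x\<in>space N. ennreal t < g x} \<in> sets N" using gm by measurable
          then have "{x. ennreal t < g x} \<in> sets N" by (simp add: space)
          from nn_integral_indicator[OF this] show ?thesis by (simp add: indicator_def of_bool_def)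
        qed
        moreover have "(\<lambda>t. \<integral>\<^sup>+x. (if ennreal t < g x then 1 else 0) \<partial>N) \<in> borel_measurable lborel"
          using gm by measurable
        ultimately show ?thesis by simp
      qed
      moreover have "(\<lambda>t. ?k t * ?H t) \<in> borel_measurable lborel"
      proof -
        have [measurable]: "f \<in> borel_measurable N" by (simp add: meas)
        show ?thesis by measurable
      qed
      ultimately show ?thesis by (simp add: nn_integral_cmult nn_integral_add)
    qed
    also have "\<dots> \<le> C * (Km * ?I + ennreal (p / (q - p)) * ?I)"
    proof (intro mult_left_mono add_mono)
      have "(\<integral>\<^sup>+t. ?k t * emeasure N {x. ennreal t < g x} \<partial>lborel) = (\<integral>\<^sup>+x. enn_powr (g x) p \<partial>N)"
        using layer_cake_emeasure[OF N.sigma_finite_measure_axioms p(1) gm, of UNIV] sets.top[of N] by (simp add: space)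
      also have "\<dots> = (\<integral>\<^sup>+x. enn_powr (maximal M ?h x) (p / p0) \<partial>N)"
        using p by (simp add: g_def enn_powr_powr)
      also have "\<dots> \<le> Km * (\<integral>\<^sup>+x. enn_powr (?h x) (p / p0) \<partial>N)" by (rule Km(2)[OF hm])
      also have "\<dots> = Km * ?I" using p by (simp add: enn_powr_powr)
      finally show "(\<integral>\<^sup>+t. ?k t * emeasure N {x. ennreal t < g x} \<partial>lborel) \<le> Km * ?I" .
      have "(\<integral>\<^sup>+t. ?k t * ?H t \<partial>lborel) \<le> ennreal (p / (q - p)) * (\<integral>\<^sup>+x. ennreal (norm (f x) powr p) \<partial>N)"
        by (rule tail_integral[OF N.sigma_finite_measure_axioms p(1) pq(3)]) (auto simp: meas)
      then show "(\<integral>\<^sup>+t. ?k t * ?H t \<partial>lborel) \<le> ennreal (p / (q - p)) * ?I"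
        using p by (simp add: enn_powr_ennreal)
    qed simp
    finally have le: "(\<integral>\<^sup>+x. enn_powr (ennreal (norm (T f x) / 3)) p \<partial>N) \<le> C * (Km * ?I + ennreal (p / (q - p)) * ?I)" .
    have "power_integral N p (T f) = (\<integral>\<^sup>+x. ennreal (3 powr p) * enn_powr (ennreal (norm (T f x) / 3)) p \<partial>N)"
      using p by (intro nn_integral_cong) (simp add: enn_powr_ennreal powr_divide flip: ennreal_mult)
    also have "\<dots> = ennreal (3 powr p) * (\<integral>\<^sup>+x. enn_powr (ennreal (norm (T f x) / 3)) p \<partial>N)"
      by (intro nn_integral_cmult) (simp add: meas)
    also have "\<dots> \<le> ennreal (3 powr p) * (C * (Km * ?I + ennreal (p / (q - p)) * ?I))"
      by (intro mult_left_mono le) simp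
    also have "\<dots> = K * ?I" by (simp add: K_def distrib_right distrib_left mult.assoc)
    finally show ?thesis .
  qed
  moreover have "K < top" using C Km by (simp add: K_def ennreal_mult_less_top)
  ultimately show thesis by (intro that) (auto simp: N_def)
qed

section \<open>Weights with a doubling order\<close>

lemma emeasure_wmeasure_ball_finite:
  assumes "weight M w" "sets M = sets borel"
  shows "emeasure (wmeasure M w) (ball x r) < top"
proof (cases "0 < r")
  case True
  have "integrable M (\<lambda>y. indicator (ball x r) y *\<^sub>R w y)"
    using assms True by (simp add: weight_def set_integrable_def)
  then have "(\<integral>\<^sup>+y. ennreal (norm (indicator (ball x r) y *\<^sub>R w y)) \<partial>M) < top"
    by (simp add: integrable_iff_bounded)
  moreover have "emeasure (wmeasure M w) (ball x r) = (\<integral>\<^sup>+y. ennreal (norm (indicator (ball x r) y *\<^sub>R w y)) \<partial>M)"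
    using assms by (subst emeasure_wmeasure)
      (auto simp: weight_def intro!: nn_integral_cong split: split_indicator)
  ultimately show ?thesis by simp
qed (simp add: ball_empty)

lemma doubling_order_doubling_measure:
  assumes "weight M w" "sets M = sets borel" "doubling_order M w D"
  shows "doubling_measure (wmeasure M w)"
proof -
  obtain C :: real where "\<And>x r l. 0 < r \<Longrightarrow> 1 \<le> l \<Longrightarrow> emeasure (wmeasure M w) (ball x (l * r))
         \<le> ennreal (C * l powr D) * emeasure (wmeasure M w) (ball x r)"
    using assms(3) unfolding doubling_order_def by blast
  from this[of _ 2] have "emeasure (wmeasure M w) (ball x (2 * r)) \<le> ennreal (C * 2 powr D) * emeasure (wmeasure M w) (ball x r)"
    if "0 < r" for x r using that by simp
  then show ?thesis
    using emeasure_wmeasure_ball_finite[OF assms(1,2)] assms(2) unfolding doubling_measure_def by auto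
qed

text \<open>The dilates of a null ball stay null and exhaust the space. This isolates the degenerate
  weight that vanishes almost everywhere.\<close>

lemma doubling_order_null:
  assumes "sets M = sets borel" "doubling_order M w D" "0 < r" "emeasure (wmeasure M w) (ball x r) = 0"
  shows "emeasure (wmeasure M w) UNIV = 0"
proof -
  obtain C :: real where C: "\<And>x r l. 0 < r \<Longrightarrow> 1 \<le> l \<Longrightarrow> emeasure (wmeasure M w) (ball x (l * r))
         \<le> ennreal (C * l powr D) * emeasure (wmeasure M w) (ball x r)"
    using assms(2) unfolding doubling_order_def by blast
  have "emeasure (wmeasure M w) (ball x (real (Suc n) * r)) = 0" for n
    using C[OF assms(3), of "real (Suc n)" x] assms(4) by simp
  then have "emeasure (wmeasure M w) (\<Union>n. ball x (real (Suc n) * r)) = 0"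
    by (intro emeasure_UN_eq_0) (auto simp: assms(1))
  moreover have "(\<Union>n. ball x (real (Suc n) * r)) = UNIV"
  proof -
    have "y \<in> (\<Union>n. ball x (real (Suc n) * r))" for y
    proof -
      obtain n where "dist x y < real n * r" using reals_Archimedean3[OF assms(3)] by blast
      also have "\<dots> \<le> real (Suc n) * r" using assms(3) by (intro mult_right_mono) auto
      finally have "y \<in> ball x (real (Suc n) * r)" by simp
      then show ?thesis by blast
    qed
    then show ?thesis by blast
  qed
  ultimately show ?thesis by simp
qed

lemma Lp_norm_ennreal:
  "0 < p \<Longrightarrow> Lp_norm (ennreal p) N f = enn_powr (power_integral N p f) (1 / p)"
  by (simp add: Lp_norm_def)

text \<open>The supremum is evaluated at level 1; other levels come back by rescaling
  \<open>f\<close>.\<close>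

lemma weak_Lp_norm_level:
  assumes "weak_Lp_norm q N g \<le> ennreal C * Lp_norm (ennreal q) N f" "0 < q" "space N = UNIV"
  shows "emeasure N {x. 1 < norm (g x)} \<le> enn_powr (ennreal C) q * power_integral N q f"
proof -
  have "ennreal 1 * enn_powr (emeasure N {x \<in> space N. 1 < norm (g x)}) (1 / q) \<le> weak_Lp_norm q N g"
    unfolding weak_Lp_norm_def by (rule SUP_upper) simp
  also note assms(1)
  finally have "enn_powr (emeasure N {x. 1 < norm (g x)}) (1 / q) \<le> ennreal C * Lp_norm (ennreal q) N f"
    using assms(3) by simp
  from enn_powr_mono[OF assms(2) this] show ?thesis
    using assms(2) by (simp add: Lp_norm_ennreal enn_powr_mult)
qed

theorem theorem8p7:
  fixes M :: "(real ^ 'n) measure"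
    and w :: "real ^ 'n \<Rightarrow> real"
    and D_w p0 q :: real
    and q0 \<beta> :: ennreal
    and D1 D2 :: "(real ^ 'n \<Rightarrow> complex) set"
    and T :: "(real ^ 'n \<Rightarrow> complex) \<Rightarrow> (real ^ 'n \<Rightarrow> complex)"
    and A :: "real \<Rightarrow> (real ^ 'n \<Rightarrow> complex) \<Rightarrow> (real ^ 'n \<Rightarrow> complex)"
    and \<alpha> \<gamma> :: "nat \<Rightarrow> real"
  assumes doubling: "doubling_measure M"
    and w_A_infinity: "w \<in> A_infinity M"
    and w_order: "doubling_order M w D_w"
    and exponents: "1 \<le> p0" "ennreal p0 < q0"
    and D_subspaces: "function_subspace D1" "function_subspace D2"
    and D_subset: "D1 \<subseteq> D2" "D2 \<subseteq> Lp_space q0 (wmeasure M w)"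
    and D_truncation: "truncation_stable M D1" "truncation_stable M D2"
    and T_sublinear: "sublinear_operator M D2 T"
    and A_maps: "\<forall>r>0. \<forall>f\<in>D1. A r f \<in> D2"
    and a_q: "q \<in> W_exponents M w p0 q0"
    and a_weak_type: "\<exists>C::real. \<forall>f\<in>D2 \<inter> Lp_space (ennreal q) (wmeasure M w).
          weak_Lp_norm q (wmeasure M w) (T f)
            \<le> ennreal C * Lp_norm (ennreal q) (wmeasure M w) f"
    and b: "\<forall>j\<ge>1. 0 \<le> \<alpha> j \<and>
          (\<forall>x r. \<forall>f\<in>D1. 0 < r \<longrightarrow> (\<forall>y. y \<notin> ball x r \<longrightarrow> f y = 0) \<longrightarrow>
             Lp_average q0 M (ball x (2 ^ (j + 1) * r)) (annulus j x r) (A r f)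
               \<le> ennreal (\<alpha> j) * Lp_average (ennreal p0) M (ball x r) (ball x r) f)"
    and c_\<beta>: "conj_exponent (RH_sup M w) < \<beta>"
    and c: "\<forall>j\<ge>2. 0 \<le> \<gamma> j \<and>
          (\<forall>x r. \<forall>f\<in>D1. 0 < r \<longrightarrow> (\<forall>y. y \<notin> ball x r \<longrightarrow> f y = 0) \<longrightarrow>
             Lp_average \<beta> M (ball x (2 ^ (j + 1) * r)) (annulus j x r)
                 (T (\<lambda>y. f y - A r f y))
               \<le> ennreal (\<gamma> j) * Lp_average (ennreal p0) M (ball x r) (ball x r) f)"
    and d: "summable (\<lambda>j. \<alpha> j * 2 powr (D_w * real j))"
           "summable (\<lambda>j. \<gamma> j * 2 powr (D_w * real j))"
  shows "\<forall>p \<in> W_exponents M w p0 q0. p < q \<longrightarrow>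
          (\<exists>C::real. \<forall>f\<in>D1.
             Lp_norm (ennreal p) (wmeasure M w) (T f)
               \<le> ennreal C * Lp_norm (ennreal p) (wmeasure M w) f)"
proof -
  let ?N = "wmeasure M w"
  have setsM: "sets M = sets borel" by (rule doubling_measure_sets[OF doubling])
  have wt: "weight M w" using a_q by (simp add: W_exponents_def A_class_def)
  have q: "p0 < q" "ennreal q < q0" and q1: "1 < q"
    using a_q exponents(1) by (auto simp: W_exponents_def)
  have N: "doubling_measure ?N" by (rule doubling_order_doubling_measure[OF wt setsM w_order])
  show ?thesis
  proof (cases "\<forall>x r. 0 < r \<longrightarrow> 0 < emeasure ?N (ball x r)")
    \<comment> \<open>The weighted measure is then identically 0, and so are all norms with finite
      exponent.\<close>
    case False
    then obtain x r where "0 < r" "emeasure ?N (ball x r) = 0" by (auto simp: not_less)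
    then have "UNIV \<in> null_sets ?N"
      using doubling_order_null[OF setsM w_order] setsM by (intro null_setsI) auto
    then have zero: "(\<integral>\<^sup>+x. h x \<partial>?N) = 0" for h
      using nn_integral_null_set[of UNIV ?N h] by simp
    have "Lp_norm (ennreal p) ?N (T f) \<le> ennreal 0 * Lp_norm (ennreal p) ?N f" if "p0 < p" for p f
      using that exponents(1) by (simp add: Lp_norm_ennreal zero)
    then show ?thesis unfolding W_exponents_def by blast
  next
    case True
    then have posN: "0 < emeasure ?N (ball x r)" if "0 < r" for x r using that by blast
    have balls: "ball x r \<in> sets M" for x r by (simp add: setsM)
    have finM: "emeasure M (ball x r) < top" for x r by (rule doubling_measure_finite[OF doubling])
    have posM: "0 < emeasure M (ball x r)" if "0 < r" for x r
    proof (rule ccontr)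
      assume "\<not> 0 < emeasure M (ball x r)"
      then have "ball x r \<in> null_sets M" using balls by auto
      then have "emeasure ?N (ball x r) = 0" by (simp add: emeasure_wmeasure[OF wt balls] nn_integral_null_set)
      then show False using posN[OF that, of x] by simp
    qed
    have D2: "D2 \<subseteq> borel_measurable M"
      using D_subset(2) by (auto simp: Lp_space_def wmeasure_def)
    have Tm: "T f \<in> borel_measurable M" if "f \<in> D2" for f
      using T_sublinear that by (simp add: sublinear_operator_def)
    obtain Cd :: ennreal where Cd: "Cd < top" "\<And>x r j. 0 < r \<Longrightarrow>
      emeasure ?N (ball x (2 ^ (j + 1) * r)) \<le> Cd * ennreal (2 powr (D_w * real j)) * emeasure ?N (ball x (r / 3))"
      using doubling_order_dilation[OF w_order] by blast
    have "w \<in> RH_class M (conj_exponent (q0 / ennreal q))" using a_q by (simp add: W_exponents_def)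
    from RH_Holder[OF this less_imp_le[OF q1] q(2) balls posM finM]
    obtain Kb :: ennreal where Kb: "Kb < top" "\<And>x r E h. 0 < r \<Longrightarrow> E \<in> sets M \<Longrightarrow> E \<subseteq> ball x r \<Longrightarrow> h \<in> borel_measurable M \<Longrightarrow>
      (\<integral>\<^sup>+y\<in>E. norm_powr (h y) q \<partial>?N) \<le> Kb * emeasure ?N (ball x r) * enn_powr (Lp_average q0 M (ball x r) E h) q"
      by blast
    note \<beta> = RH_class_conj_exponent[OF c_\<beta> balls posM finM]
    \<comment> \<open>The exponent \<open>k = 1\<close> suffices on this side, because the terms
      \<open>T (I - A) b_i\<close> are handled by Chebyshev's inequality in L^1(w).\<close>
    have RH\<beta>: "w \<in> RH_class M (conj_exponent (\<beta> / ennreal 1))" using \<beta>(1) by (simp add: divide_ennreal_def)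
    have "ennreal 1 < \<beta>" using \<beta>(2) by simp
    from RH_Holder[OF RH\<beta> order_refl this balls posM finM]
    obtain Kc :: ennreal where Kc: "Kc < top" "\<And>x r E h. 0 < r \<Longrightarrow> E \<in> sets M \<Longrightarrow> E \<subseteq> ball x r \<Longrightarrow> h \<in> borel_measurable M \<Longrightarrow>
      (\<integral>\<^sup>+y\<in>E. norm_powr (h y) 1 \<partial>?N) \<le> Kc * emeasure ?N (ball x r) * enn_powr (Lp_average \<beta> M (ball x r) E h) 1"
      by blast
    obtain Cw :: real where Cw: "\<And>f. f \<in> D2 \<inter> Lp_space (ennreal q) ?N \<Longrightarrow>
        weak_Lp_norm q ?N (T f) \<le> ennreal Cw * Lp_norm (ennreal q) ?N f"
      using a_weak_type by blast
    have weak: "emeasure ?N {x. 1 < norm (T f x)} \<le> enn_powr (ennreal Cw) q * power_integral ?N q f"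
      if f: "f \<in> D2" and fq: "power_integral ?N q f < top" for f
    proof (rule weak_Lp_norm_level[OF Cw])
      have "f \<in> borel_measurable ?N" using f D2 by (auto simp: wmeasure_def)
      then show "f \<in> D2 \<inter> Lp_space (ennreal q) ?N"
        using f fq q1 by (simp add: Lp_space_def Lp_norm_ennreal enn_powr_less_top_iff)
    qed (use q1 doubling_measure_space[OF N] in auto)
    have Cw_top: "enn_powr (ennreal Cw) q < top" using q1 by (simp add: enn_powr_less_top_iff)
    have A: "A r f \<in> D2" if "0 < r" "f \<in> D1" for r f using A_maps that by blast
    have ann: "0 < 2 ^ (j + 1) * r" "annulus j x r \<in> sets M" "annulus j x r \<subseteq> ball x (2 ^ (j + 1) * r)"
      if "0 < r" "1 \<le> j" for j r and x :: "real ^ 'n"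
      using that annulus_subset[of j r x] by (auto simp: setsM)
    have b': "(\<integral>\<^sup>+y\<in>annulus j x r. enn_powr (ennreal (norm (A r f y))) q \<partial>?N) \<le>
        Kb * emeasure ?N (ball x (2 ^ (j + 1) * r)) *
        enn_powr (ennreal (\<alpha> j) * Lp_average (ennreal p0) M (ball x r) (ball x r) f) q"
      if j: "1 \<le> j" and r: "0 < r" and f: "f \<in> D1" and supp: "\<And>y. y \<notin> ball x r \<Longrightarrow> f y = 0" for j x r f
    proof -
      have "A r f \<in> borel_measurable M" using A[OF r f] D2 by blast
      note Kb(2)[OF ann[OF r j] this]
      also have "Kb * emeasure ?N (ball x (2 ^ (j + 1) * r)) *
          enn_powr (Lp_average q0 M (ball x (2 ^ (j + 1) * r)) (annulus j x r) (A r f)) q \<le>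
        Kb * emeasure ?N (ball x (2 ^ (j + 1) * r)) *
          enn_powr (ennreal (\<alpha> j) * Lp_average (ennreal p0) M (ball x r) (ball x r) f) q"
        using b j r f supp q1 by (intro mult_left_mono enn_powr_mono) auto
      finally show ?thesis .
    qed
    have c': "(\<integral>\<^sup>+y\<in>annulus j x r. ennreal (norm (T (\<lambda>y. f y - A r f y) y)) \<partial>?N) \<le>
        Kc * emeasure ?N (ball x (2 ^ (j + 1) * r)) *
        (ennreal (\<gamma> j) * Lp_average (ennreal p0) M (ball x r) (ball x r) f)"
      if j: "2 \<le> j" and r: "0 < r" and f: "f \<in> D1" and supp: "\<And>y. y \<notin> ball x r \<Longrightarrow> f y = 0" for j x r f
    proof -
      have j1: "1 \<le> j" using j by simp
      have "(\<lambda>y. f y - A r f y) \<in> D2"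
        using f D_subset(1) A[OF r f] by (intro function_subspace_diff[OF D_subspaces(2)]) auto
      from Kc(2)[OF ann[OF r j1] Tm[OF this]]
      have "(\<integral>\<^sup>+y\<in>annulus j x r. ennreal (norm (T (\<lambda>y. f y - A r f y) y)) \<partial>?N) \<le>
        Kc * emeasure ?N (ball x (2 ^ (j + 1) * r)) *
          Lp_average \<beta> M (ball x (2 ^ (j + 1) * r)) (annulus j x r) (T (\<lambda>y. f y - A r f y))" by simp
      also have "\<dots> \<le> Kc * emeasure ?N (ball x (2 ^ (j + 1) * r)) *
          (ennreal (\<gamma> j) * Lp_average (ennreal p0) M (ball x r) (ball x r) f)"
        using c j r f supp by (intro mult_left_mono) auto
      finally show ?thesis .
    qed
    have \<alpha>: "0 \<le> \<alpha> j" if "1 \<le> j" for j using b that by blast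
    have \<gamma>: "0 \<le> \<gamma> j" if "2 \<le> j" for j using c that by blast
    obtain C :: ennreal where C: "C < top" "\<And>f. f \<in> D1 \<Longrightarrow>
      power_integral ?N q f < top \<Longrightarrow>
      emeasure ?N {x. 3 < norm (T f x)} \<le>
      C * (emeasure ?N {x. 1 < maximal M (\<lambda>x. norm_powr (f x) p0) x} +
        (\<integral>\<^sup>+x\<in>{x. maximal M (\<lambda>x. norm_powr (f x) p0) x \<le> 1}. norm_powr (f x) q \<partial>?N))"
      using level_set_estimate[OF doubling wt N posN Cd exponents(1) q1 D_subspaces D_subset(1) D2
        D_truncation(1) T_sublinear A Cw_top weak \<alpha> d(1) Kb(1) b' \<gamma> d(2) Kc(1) c'] by blast
    show ?thesis
    proof (intro ballI impI)
      fix p assume p: "p \<in> W_exponents M w p0 q0" and pq: "p < q"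
      have p0: "p0 < p" "0 < p" and wA: "w \<in> A_class M (p / p0)"
        using p exponents(1) by (auto simp: W_exponents_def)
      obtain K :: ennreal where K: "K < top" "\<And>f. f \<in> D1 \<Longrightarrow>
        power_integral ?N q f < top \<Longrightarrow>
        power_integral ?N p (T f) \<le> K * power_integral ?N p f"
        using strong_type_of_level_estimate[OF doubling N posN wA exponents(1) p0(1) pq D_subspaces(1)
          D_subset(1) D2 T_sublinear C] by blast
      \<comment> \<open>The added 1 keeps \<open>L\<close> positive, so the right-hand side is
        infinite whenever \<open>f\<close> is not in L^p(w).\<close>
      define L where "L = 1 + enn_powr K (1 / p)"
      have L: "L < top" using K(1) p0 by (simp add: L_def enn_powr_less_top_iff)
      have "Lp_norm (ennreal p) ?N (T f) \<le> L * Lp_norm (ennreal p) ?N f" if f: "f \<in> D1" for f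
      proof (cases "power_integral ?N p f < top")
        case True
        have "f \<in> Lp_space q0 ?N" using f D_subset by blast
        from nn_integral_interpolation[OF this p0(2) pq q(2) True]
        have "Lp_norm (ennreal p) ?N (T f) \<le> enn_powr K (1 / p) * Lp_norm (ennreal p) ?N f"
          using enn_powr_mono[OF _ K(2)[OF f], of "1 / p"] p0 by (simp add: Lp_norm_ennreal enn_powr_mult)
        also have "\<dots> \<le> L * Lp_norm (ennreal p) ?N f"
          by (intro mult_right_mono) (simp_all add: L_def)
        finally show ?thesis .
      next
        case False
        then have "power_integral ?N p f = top"
          by (simp only: less_top[symmetric] not_not)
        then have "Lp_norm (ennreal p) ?N f = top" using p0 by (simp add: Lp_norm_ennreal)
        then show ?thesis by (simp add: L_def ennreal_mult_top)
      qed
      then have "\<forall>f\<in>D1. Lp_norm (ennreal p) ?N (T f) \<le> ennreal (enn2real L) * Lp_norm (ennreal p) ?N f"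
        using L by simp
      then show "\<exists>C::real. \<forall>f\<in>D1. Lp_norm (ennreal p) ?N (T f) \<le> ennreal C * Lp_norm (ennreal p) ?N f" by blast
    qed
  qed
qed

end
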